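(* For $N\ge1$ and for $\alpha_1,\alpha_2\ge0$ with $\alpha_1+\alpha_2=1$, let $a\in W_{\alpha_1,\alpha_2}^{N\times N}$ be such that $\det a(t)\ne0$ for all $t\in\mathbb{T}$ and $\det a(t)$ has winding number zero. Then there are constants $E_{a,1}[k]$ and $E_{a,2}[k]$, $k\in\{0,\dots,N-1\}$, such that for each $k_1,k_2\in\{0,\dots,N-1\}$ $$\lim_{m\to\infty}\frac{\det P_{k_1,k_2+mN}L(a)P_{k_1,k_2+mN}}{G^{k_2-k_1+mN}}=E_{a,1}[k_1]\,E_{a,2}[k_2],$$ where $G=\exp\left(\frac{1}{2\pi N}\int_0^{2\pi}\log\det a(e^{ix})\,dx\right)$.
   Context: $\mathbb{T}=\{t\in\mathbb{C}:|t|=1\}$. $W_{\alpha_1,\alpha_2}$ is the set of all $a\in L^1(\mathbb{T})$ with $\sum_{k\in\mathbb{Z}}\alpha(k)|a_k|<\infty$, where $a_k=\frac1{2\pi}\int_0^{2\pi}a(e^{ix})e^{-ikx}dx$, $\alpha(k)=(1+k)^{\alpha_1}$ for $k\ge0$ and $\alpha(k)=(1+|k|)^{\alpha_2}$ for $k<0$ (elements are identified with their continuous representatives). $W_{\alpha_1,\alpha_2}^{N\times N}$ is the set of $N\times N$ matrix functions with entries in $W_{\alpha_1,\alpha_2}$; its Fourier coefficients $a_k$ are $N\times N$ matrices. $L(a)=(a_{j-k})_{j,k\in\mathbb{Z}}$ is the block Laurent operator, regarded as an operator on the scalar space $l^2(\mathbb{Z})$: its entry in position $(jN+p,kN+q)$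 is the $(p,q)$ entry of $a_{j-k}$, for $j,k\in\mathbb{Z}$, $p,q\in\{0,\dots,N-1\}$. For integers $n_1<n_2$, $P_{n_1,n_2}$ is the projection on $l^2(\mathbb{Z})$ keeping the coordinates $x_k$ with $n_1\le k<n_2$ and setting the others to $0$; $P_{n_1,n_2}L(a)P_{n_1,n_2}$ is identified with a matrix of order $n_2-n_1$. $\log\det a$ is a continuous logarithm of $\det a$ on $\mathbb{T}$, which exists since the winding number is zero. *)

theory Defs
  imports "HOL-Complex_Analysis.Complex_Analysis" "Jordan_Normal_Form.Determinant"
begin

definition fourier_coeff :: "(complex \<Rightarrow> complex) \<Rightarrow> int \<Rightarrow> complex" where
  "fourier_coeff f k =
     integral {0..2*pi} (\<lambda>x. f (cis x) * cis (- (of_int k * x))) / of_real (2*pi)"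

definition wiener_weight :: "real \<Rightarrow> real \<Rightarrow> int \<Rightarrow> real" where
  "wiener_weight \<alpha>1 \<alpha>2 k =
     (if k \<ge> 0 then (1 + of_int k) powr \<alpha>1 else (1 + of_int \<bar>k\<bar>) powr \<alpha>2)"

(* The weights are at least 1 for nonnegative exponents, so an integrable function in the weighted
   Wiener algebra has absolutely summable Fourier coefficients and hence a unique continuous
   representative on the circle; the algebra is taken to consist of these representatives.
   Values off the unit circle are irrelevant. *)
definition wiener :: "real \<Rightarrow> real \<Rightarrow> (complex \<Rightarrow> complex) set" where
  "wiener \<alpha>1 \<alpha>2 = {f. continuous_on (sphere 0 1) f \<and>
     (\<lambda>k. wiener_weight \<alpha>1 \<alpha>2 k * norm (fourier_coeff f k)) summable_on UNIV}"

definition wiener_mat :: "nat \<Rightarrow> real \<Rightarrow> real \<Rightarrow> (complex \<Rightarrow> complex mat) set" where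
  "wiener_mat N \<alpha>1 \<alpha>2 = {a. (\<forall>t\<in>sphere 0 1. a t \<in> carrier_mat N N) \<and>
     (\<forall>p<N. \<forall>q<N. (\<lambda>t. a t $$ (p, q)) \<in> wiener \<alpha>1 \<alpha>2)}"

definition fourier_coeff_mat :: "nat \<Rightarrow> (complex \<Rightarrow> complex mat) \<Rightarrow> int \<Rightarrow> complex mat" where
  "fourier_coeff_mat N a k = mat N N (\<lambda>(p, q). fourier_coeff (\<lambda>t. a t $$ (p, q)) k)"

(* Row r = j N + p and column s = k N + q with 0 <= p, q < N: for N > 0, div and mod on the
   integers return exactly the pairs (j, p) and (k, q), also for negative r and s. *)
definition laurent_entry :: "nat \<Rightarrow> (complex \<Rightarrow> complex mat) \<Rightarrow> int \<Rightarrow> int \<Rightarrow> complex" where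
  "laurent_entry N a r s =
     fourier_coeff_mat N a (r div int N - s div int N) $$ (nat (r mod int N), nat (s mod int N))"

(* For a in the Wiener algebra and x square summable the series converges absolutely. *)
definition laurent_op ::
    "nat \<Rightarrow> (complex \<Rightarrow> complex mat) \<Rightarrow> (int \<Rightarrow> complex) \<Rightarrow> (int \<Rightarrow> complex)" where
  "laurent_op N a x = (\<lambda>r. \<Sum>\<^sub>\<infinity>s. laurent_entry N a r s * x s)"

definition coord_proj :: "int \<Rightarrow> int \<Rightarrow> (int \<Rightarrow> complex) \<Rightarrow> (int \<Rightarrow> complex)" where
  "coord_proj n1 n2 x = (\<lambda>k. if n1 \<le> k \<and> k < n2 then x k else 0)"

definition compression_mat ::
    "int \<Rightarrow> int \<Rightarrow> ((int \<Rightarrow> complex) \<Rightarrow> (int \<Rightarrow> complex)) \<Rightarrow> complex mat" where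
  "compression_mat n1 n2 A = mat (nat (n2 - n1)) (nat (n2 - n1))
     (\<lambda>(i, j). coord_proj n1 n2 (A (coord_proj n1 n2
        (\<lambda>k. if k = n1 + int j then 1 else 0))) (n1 + int i))"

lemma compression_mat_laurent_op:
  "compression_mat n1 n2 (laurent_op N a) = mat (nat (n2 - n1)) (nat (n2 - n1))
     (\<lambda>(i, j). laurent_entry N a (n1 + int i) (n1 + int j))"
proof -
  have "(\<Sum>\<^sub>\<infinity>s. laurent_entry N a r s *
           coord_proj n1 n2 (\<lambda>k. if k = n1 + int j then 1 else 0) s)
         = laurent_entry N a r (n1 + int j)" (is "infsum ?f UNIV = _")
    if "j < nat (n2 - n1)" for r j
  proof -
    have "infsum ?f UNIV = infsum ?f {n1 + int j}"
      by (rule infsum_cong_neutral) (auto simp: coord_proj_def)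
    also have "\<dots> = laurent_entry N a r (n1 + int j)"
      using that by (simp add: coord_proj_def)
    finally show ?thesis .
  qed
  then show ?thesis
    unfolding compression_mat_def laurent_op_def
    by (intro eq_matI) (auto, auto simp: coord_proj_def)
qed

definition continuous_log_on_circle :: "(complex \<Rightarrow> complex) \<Rightarrow> (complex \<Rightarrow> complex) \<Rightarrow> bool" where
  "continuous_log_on_circle f lg \<longleftrightarrow>
     continuous_on (sphere 0 1) lg \<and> (\<forall>t\<in>sphere 0 1. exp (lg t) = f t)"

lemma continuous_log_on_circle_exists:
  assumes f: "continuous_on (sphere 0 1) f" and nz: "\<And>t. t \<in> sphere 0 1 \<Longrightarrow> f t \<noteq> 0"
    and wn: "winding_number (f \<circ> circlepath 0 1) 0 = 0"
  shows "\<exists>lg. continuous_log_on_circle f lg"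
proof -
  define c where "c = circlepath 0 1"
  have cim: "c ` {0..1} = sphere 0 1"
    using path_image_circlepath[where z=0 and r=1] by (simp add: c_def path_image_def)
  have cc: "continuous_on {0..1} c"
    using path_circlepath[of 0 1] by (simp add: c_def path_def)
  have "path (f \<circ> c)"
    unfolding path_def using cc f cim by (intro continuous_on_compose) auto
  moreover have "0 \<notin> path_image (f \<circ> c)"
    using nz cim unfolding path_image_def by fastforce
  ultimately obtain q where q: "path q"
      "pathfinish q - pathstart q = 2 * of_real pi * \<i> * winding_number (f \<circ> c) 0"
      "\<And>t. t \<in> {0..1} \<Longrightarrow> (f \<circ> c) t = 0 + exp (q t)"
    using winding_number_as_continuous_log by blast
  have q01: "q 1 = q 0" using q(2) wn by (simp add: c_def pathfinish_def pathstart_def)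
  define lg where "lg = (\<lambda>z. q (Arg2pi z / (2*pi)))"
  have lgc: "lg (c t) = q t" if "t \<in> {0..1}" for t
  proof (cases "t = 1")
    case True
    have "c 1 = 1" using pathfinish_circlepath[of 0 1] by (simp add: c_def pathfinish_def)
    moreover have "Arg2pi 1 = 0" by (rule Arg2pi_unique[of 1]) auto
    ultimately show ?thesis using True q01 by (simp add: lg_def)
  next
    case False
    have "Arg2pi (c t) = 2 * pi * t"
      by (rule Arg2pi_unique[of 1])
         (use that False in \<open>auto simp: c_def circlepath_def part_circlepath_def linepath_def mult_ac\<close>)
    then show ?thesis by (simp add: lg_def)
  qed
  have "continuous_on {0..1} (lg \<circ> c)"
    using q(1) lgc continuous_on_cong[of "{0..1}" "{0..1}" "lg \<circ> c" q] by (simp add: path_def)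
  moreover have "quotient_map (top_of_set {0..1}) (top_of_set (sphere 0 1)) c"
    using cc cim
    by (intro continuous_closed_imp_quotient_map continuous_imp_closed_map)
       (auto simp: compact_space_subtopology Hausdorff_space_subtopology)
  ultimately have "continuous_on (sphere 0 1) lg"
    using continuous_compose_quotient_map[of "top_of_set {0..1}" "top_of_set (sphere 0 1)" c euclidean lg]
    by simp
  moreover have "exp (lg t) = f t" if "t \<in> sphere 0 1" for t
  proof -
    obtain s where "s \<in> {0..1}" "t = c s" using \<open>t \<in> sphere 0 1\<close> cim by blast
    then show ?thesis using q(3)[of s] lgc by simp
  qed
  ultimately show ?thesis unfolding continuous_log_on_circle_def by blast
qed

(* lg is the chosen continuous logarithm of det a. A different choice multiplies the constant by
   an N-th root of unity. *)
definition szego_const :: "nat \<Rightarrow> (complex \<Rightarrow> complex) \<Rightarrow> complex" where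
  "szego_const N lg = exp (integral {0..2*pi} (\<lambda>x. lg (cis x)) / of_real (2*pi*real N))"

end

theory Submission
  imports Defs
begin

text \<open>
  The proof rests on three observations.

  Truncation is almost multiplicative. Let \<open>B\<close> and \<open>C\<close> be doubly infinite matrices with
  \<open>|B i j| \<le> \<beta> (i - j)\<close> and \<open>|C i j| \<le> \<gamma> (i - j)\<close>. The truncation of \<open>B C\<close> to an interval
  \<open>[s, t)\<close> and the product of the truncations differ by the sums over the intermediate indices
  \<open>k < s\<close> and \<open>k \<ge> t\<close>. The first one is a matrix concentrated near the corner \<open>(s, s)\<close>, and in the
  sum of \<open>\<beta> (i - k) \<gamma> (k - j)\<close> over \<open>i, j \<ge> s > k\<close> a pair \<open>n = i - k\<close>, \<open>m = j - k\<close> occurs exactly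
  \<open>min n m\<close> times. Since \<open>min n m \<le> n powr \<alpha>1 * m powr \<alpha>2\<close> if \<open>\<alpha>1 + \<alpha>2 = 1\<close>, the weighted
  summability of \<open>\<beta>\<close> and \<open>\<gamma>\<close> makes the entries of the corner corrections absolutely summable
  (\<open>hankel_product_summable\<close>). Hence every product of truncated Laurent matrices is the sum of the
  truncation of the product, a summable matrix attached to the left end, a summable matrix attached
  to the right end, and an error that tends to zero (\<open>boundary_form_mult\<close>).

  If the symbol in this form is the identity, the determinants converge. A determinant
  of \<open>1 + K\<close> depends continuously on the entrywise \<open>l\<^sup>1\<close> norm of \<open>K\<close>, uniformly in the size
  (\<open>norm_det_diff_le\<close>), and the product of two corrections at opposite ends tends to zero. So the
  limit is a number that depends on the left end only times a number that depends on the right end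
  only (\<open>boundary_form_det_limit\<close>). This is the source of the product \<open>E1 k1 * E2 k2\<close>.

  Column operations bring the symbol to the identity while the determinants of the sections
  remain under control. The allowed operations are the addition of a multiple \<open>h\<close> of a
  column to another one and the multiplication of a column by \<open>exp l\<close>, with \<open>h\<close> and \<open>l\<close> in the algebra.
  Splitting \<open>h\<close> and \<open>l\<close> according to the sign of the frequency writes each of them as a product of
  two matrix functions whose Laurent matrices are triangular in the scalar indexing; so the
  determinants of their sections are products of diagonal entries, namely \<open>1\<close> or powers of
  \<open>exp (fourier_coeff l 0)\<close> (\<open>reduct_addcol\<close>, \<open>reduct_multcol\<close>). These powers add up to the \<open>m\<close>-th
  power of \<open>exp (fourier_coeff lg 0)\<close>, the \<open>N\<close>-th power of the constant \<open>G\<close>, up to factors that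
  depend on one end of the interval.

  The reduction treats the rows one after another. To make a row equal to a unit vector one needs a
  pivot without zeros on the circle. A polynomial curve has measure zero in the plane, so an
  arbitrarily small perturbation of a diagonal entry has no zeros (\<open>small_nonvanishing_shift\<close>), and
  by Cramer's rule a small perturbation of an entry is itself a sequence of allowed column
  operations (\<open>reduct_perturb_diagonal\<close>). The pivot can then be made \<open>1\<close> with the help of the next
  column. In the last row no further column is left, but there the pivot is the determinant,
  which has a continuous logarithm because its winding number is zero; and a continuous
  logarithm of an element of the weighted Wiener algebra belongs to the algebra (\<open>wiener_log\<close>).
\<close>

section \<open>Fourier coefficients on the circle\<close>

lemma integral_cis_int:
  "((\<lambda>x. cis (of_int n * x)) has_integral (if n = 0 then of_real (2*pi) else 0)) {0..2*pi}"
proof (cases "n = 0")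
  case True
  then show ?thesis using has_integral_const_real[of "1::complex" 0 "2*pi"] by (simp add: scaleR_conv_of_real)
next
  case False
  define F where "F = (\<lambda>x::real. cis (of_int n * x) / (\<i> * of_int n))"
  have "(F has_vector_derivative cis (of_int n * x)) (at x within {0..2*pi})" for x
  proof -
    have i2: "- (\<i> * (E * \<i>)) = E" for E by (simp add: mult.commute)
    have "((\<lambda>z. exp (\<i> * (of_int n * z)) / (\<i> * of_int n)) has_field_derivative exp (\<i> * (of_int n * of_real x))) (at (of_real x))"
      using False i2 by (auto intro!: derivative_eq_intros)
    from has_vector_derivative_real_field[OF this] show ?thesis
      unfolding F_def cis_conv_exp using has_vector_derivative_at_within by fastforce
  qed
  then have "((\<lambda>x. cis (of_int n * x)) has_integral (F (2*pi) - F 0)) {0..2*pi}"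
    by (intro fundamental_theorem_of_calculus) auto
  moreover have "cis (of_int n * (2*pi)) = 1"
    using cis_multiple_2pi[of "of_int n"] by (simp add: mult_ac)
  ultimately show ?thesis using False by (simp add: F_def)
qed

lemma continuous_on_circle_param:
  assumes "continuous_on (sphere 0 1) f"
  shows "continuous_on A (\<lambda>x. f (cis x))"
proof (rule continuous_on_compose2[OF assms])
  show "continuous_on A cis" by (intro continuous_intros)
qed (auto simp: dist_norm)

lemma fourier_integrand_integrable:
  assumes "continuous_on (sphere 0 1) f"
  shows "(\<lambda>x. f (cis x) * cis (- (of_int k * x))) integrable_on {0..2*pi}"
  using continuous_on_circle_param[OF assms, of "{0..2*pi}"]
  by (intro integrable_continuous_real continuous_intros) 

lemma fourier_coeff_cong:
  assumes "\<And>t. t \<in> sphere 0 1 \<Longrightarrow> f t = g t"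
  shows "fourier_coeff f k = fourier_coeff g k"
  unfolding fourier_coeff_def using assms by (simp add: dist_norm)

lemma fourier_coeff_add:
  assumes "continuous_on (sphere 0 1) f" "continuous_on (sphere 0 1) g"
  shows "fourier_coeff (\<lambda>t. f t + g t) k = fourier_coeff f k + fourier_coeff g k"
  unfolding fourier_coeff_def
  using integral_add[OF fourier_integrand_integrable[OF assms(1)] fourier_integrand_integrable[OF assms(2)], of k k]
  by (simp only: distrib_right add_divide_distrib)

lemma fourier_coeff_diff:
  assumes "continuous_on (sphere 0 1) f" "continuous_on (sphere 0 1) g"
  shows "fourier_coeff (\<lambda>t. f t - g t) k = fourier_coeff f k - fourier_coeff g k"
  unfolding fourier_coeff_def
  using integral_diff[OF fourier_integrand_integrable[OF assms(1)] fourier_integrand_integrable[OF assms(2)], of k k]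
  by (simp only: left_diff_distrib diff_divide_distrib)

lemma fourier_coeff_cmult:
  "fourier_coeff (\<lambda>t. c * f t) k = c * fourier_coeff f k"
  unfolding fourier_coeff_def by (simp add: mult.assoc)

lemma fourier_coeff_const: "fourier_coeff (\<lambda>t. c) k = (if k = 0 then c else 0)"
  using integral_cis_int[of "-k"] unfolding fourier_coeff_def
  by (auto simp: integral_unique)

lemma cis_powi: "cis x powi k = cis (of_int k * x)"
  by (simp add: cis_power_int)

lemma fourier_coeff_shift:
  "fourier_coeff (\<lambda>t. f t * t powi j) k = fourier_coeff f (k - j)"
proof -
  have "f (cis x) * cis x powi j * cis (- (of_int k * x)) = f (cis x) * cis (- (of_int (k - j) * x))" for x
  proof -
    have "cis x powi j * cis (- (of_int k * x)) = cis (- (of_int (k - j) * x))"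
      unfolding cis_powi cis_mult by (rule arg_cong[of _ _ cis]) (simp add: algebra_simps)
    then show ?thesis by (simp only: mult.assoc)
  qed
  then show ?thesis unfolding fourier_coeff_def by (simp only:)
qed

lemma norm_fourier_coeff_le:
  assumes f: "continuous_on (sphere 0 1) f" and B: "\<And>t. t \<in> sphere 0 1 \<Longrightarrow> norm (f t) \<le> B"
  shows "norm (fourier_coeff f k) \<le> B"
proof -
  have "norm (integral {0..2*pi} (\<lambda>x. f (cis x) * cis (- (of_int k * x)))) \<le> B * (2*pi - 0)"
  proof (rule integral_bound)
    show "continuous_on {0..2*pi} (\<lambda>x. f (cis x) * cis (- (of_int k * x)))"
      using continuous_on_circle_param[OF f, of "{0..2*pi}"] by (intro continuous_intros)
  qed (use B in \<open>auto simp: norm_mult dist_norm\<close>)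
  then show ?thesis unfolding fourier_coeff_def by (simp add: norm_divide field_simps)
qed

lemma norm_powi_circle: "t \<in> sphere 0 1 \<Longrightarrow> norm (t powi k) = (1::real)" for t :: complex
  by (simp add: norm_power_int)

text \<open>
  The series of \<open>g\<close> converges uniformly, so it may be multiplied by \<open>f\<close> and integrated term by
  term. The case \<open>f = 1\<close> recovers the coefficients of a series; the general case is the
  convolution theorem.
\<close>

lemma fourier_coeff_mult_series:
  fixes c :: "int \<Rightarrow> complex"
  assumes f: "continuous_on (sphere 0 1) f" and c: "(\<lambda>k. norm (c k)) summable_on UNIV"
    and g: "\<And>t. t \<in> sphere 0 1 \<Longrightarrow> g t = (\<Sum>\<^sub>\<infinity>k. c k * t powi k)"
  shows "continuous_on (sphere 0 1) g"
    and "((\<lambda>k. c k * fourier_coeff f (n - k)) has_sum fourier_coeff (\<lambda>t. f t * g t) n) UNIV"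
proof -
  let ?F = "finite_subsets_at_top (UNIV :: int set)"
  have ul: "uniform_limit (sphere 0 1) (\<lambda>X t. \<Sum>k\<in>X. c k * t powi k) (\<lambda>t. \<Sum>\<^sub>\<infinity>k. c k * t powi k) ?F"
    by (rule Weierstrass_m_test_general[OF _ c]) (simp add: norm_mult norm_powi_circle)
  then have ul': "uniform_limit (sphere 0 1) (\<lambda>X t. \<Sum>k\<in>X. c k * t powi k) g ?F"
    using g unfolding uniform_limit_iff by simp
  have ctp: "continuous_on (sphere 0 1) (\<lambda>t::complex. t powi k)" for k
    by (intro continuous_intros) auto
  have cont: "continuous_on (sphere 0 1) (\<lambda>t. \<Sum>k\<in>X. c k * t powi k)" for X
    by (intro continuous_intros) auto
  show cg: "continuous_on (sphere 0 1) g"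
    by (rule uniform_limit_theorem[OF _ ul']) (use cont in auto)
  have bd: "bounded (f ` sphere 0 1)"
    using f by (intro compact_imp_bounded compact_continuous_image) auto
  have bdg: "bounded (g ` sphere 0 1)"
    using cg by (intro compact_imp_bounded compact_continuous_image) auto
  have "uniform_limit (sphere 0 1) (\<lambda>X t. f t * (\<Sum>k\<in>X. c k * t powi k)) (\<lambda>t. f t * g t) ?F"
    by (rule uniform_lim_mult[OF uniform_limit_const ul' bd bdg])
  then have u1: "uniform_limit {0..2*pi} (\<lambda>X x. f (cis x) * (\<Sum>k\<in>X. c k * cis x powi k)) (\<lambda>x. f (cis x) * g (cis x)) ?F"
    by (rule uniform_limit_compose') (auto simp: dist_norm)
  have bd1: "bounded ((\<lambda>x. f (cis x) * g (cis x)) ` {0..2*pi})"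
    by (intro compact_imp_bounded compact_continuous_image continuous_intros
        continuous_on_circle_param f cg) auto
  have "uniform_limit {0..2*pi} (\<lambda>X x. f (cis x) * (\<Sum>k\<in>X. c k * cis x powi k) * cis (- (of_int n * x)))
          (\<lambda>x. f (cis x) * g (cis x) * cis (- (of_int n * x))) ?F"
    by (rule uniform_lim_mult[OF u1 uniform_limit_const bd1])
       (auto simp: bounded_iff intro!: exI[of _ 1])
  then obtain I J where IJ: "\<And>X. ((\<lambda>x. f (cis x) * (\<Sum>k\<in>X. c k * cis x powi k) * cis (- (of_int n * x))) has_integral I X) {0..2*pi}"
     "((\<lambda>x. f (cis x) * g (cis x) * cis (- (of_int n * x))) has_integral J) {0..2*pi}" "(I \<longlongrightarrow> J) ?F"
    by (rule uniform_limit_integral)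
       (auto intro!: continuous_intros continuous_on_circle_param[OF f] continuous_on_circle_param[OF cont])
  have J: "fourier_coeff (\<lambda>t. f t * g t) n = J / of_real (2*pi)"
    unfolding fourier_coeff_def using IJ(2) by (simp add: integral_unique)
  have fcsum: "fourier_coeff (\<lambda>t. \<Sum>k\<in>X. c k * (f t * t powi k)) n = (\<Sum>k\<in>X. c k * fourier_coeff f (n - k))" if "finite X" for X
    using that
  proof (induction X rule: finite_induct)
    case empty
    then show ?case using fourier_coeff_const[of 0] by simp
  next
    case (insert j X)
    then show ?case
      by (simp add: fourier_coeff_add f ctp continuous_intros fourier_coeff_cmult fourier_coeff_shift)
  qed
  have I: "I X / of_real (2*pi) = (\<Sum>k\<in>X. c k * fourier_coeff f (n - k))" if "finite X" for X
  proof -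
    have "I X / of_real (2*pi) = fourier_coeff (\<lambda>t. f t * (\<Sum>k\<in>X. c k * t powi k)) n"
      unfolding fourier_coeff_def using IJ(1)[of X] by (simp add: integral_unique)
    also have "\<dots> = fourier_coeff (\<lambda>t. \<Sum>k\<in>X. c k * (f t * t powi k)) n"
      by (simp add: sum_distrib_left mult_ac)
    finally show ?thesis using fcsum[OF that] by simp
  qed
  have "((\<lambda>X. I X / of_real (2*pi)) \<longlongrightarrow> J / of_real (2*pi)) ?F"
    by (intro tendsto_intros IJ) auto
  then have "((\<lambda>X. \<Sum>k\<in>X. c k * fourier_coeff f (n - k)) \<longlongrightarrow> fourier_coeff (\<lambda>t. f t * g t) n) ?F"
    unfolding J
    by (rule Lim_transform_eventually) (intro eventually_finite_subsets_at_top_weakI I)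
  then show "((\<lambda>k. c k * fourier_coeff f (n - k)) has_sum fourier_coeff (\<lambda>t. f t * g t) n) UNIV"
    by (simp add: has_sum_def)
qed

lemma fourier_coeff_of_series:
  fixes c :: "int \<Rightarrow> complex"
  assumes c: "(\<lambda>k. norm (c k)) summable_on UNIV"
    and g: "\<And>t. t \<in> sphere 0 1 \<Longrightarrow> g t = (\<Sum>\<^sub>\<infinity>k. c k * t powi k)"
  shows "fourier_coeff g n = c n"
proof -
  have "((\<lambda>k. c k * fourier_coeff (\<lambda>t. 1) (n - k)) has_sum fourier_coeff g n) UNIV"
    using fourier_coeff_mult_series(2)[OF continuous_on_const c g, of 1 n] by simp
  moreover have "((\<lambda>k. c k * fourier_coeff (\<lambda>t. 1) (n - k)) has_sum c n) UNIV"
    by (rule has_sum_finite_neutralI[of "{n}"]) (auto simp: fourier_coeff_const)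
  ultimately show ?thesis by (rule has_sum_unique)
qed

text \<open>
  On the circle \<open>Re t\<close> and \<open>Im t\<close> are combinations of \<open>t\<close> and \<open>1 / t\<close>. Real polynomials in the real
  and imaginary part, which are what the Stone-Weierstrass theorem supplies, are therefore
  trigonometric polynomials.
\<close>

lemma bounded_linear_on_circle:
  fixes p :: "complex \<Rightarrow> real"
  assumes p: "bounded_linear p" and t: "t \<in> sphere 0 1"
  shows "complex_of_real (p t) = of_real (p 1 / 2) * (t powi 1 + t powi (-1)) + of_real (p \<i> / 2) * (- \<i> * t powi 1 + \<i> * t powi (-1))"
proof -
  have t1: "norm t = 1" using t by simp
  have inv: "t powi (-1) = cnj t"
    using t1 by (simp add: power_int_minus inverse_complex_def)  (simp add: complex_eq_iff cmod_def)
  have "p t = p (Re t *\<^sub>R 1 + Im t *\<^sub>R \<i>)" by (rule arg_cong[of _ _ p]) (simp add: complex_eq_iff)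
  also have "\<dots> = Re t * p 1 + Im t * p \<i>"
    using p by (simp add: bounded_linear.linear linear_add linear_scale)
  finally show ?thesis unfolding inv by (simp add: complex_eq_iff)
qed

text \<open>
  The functions \<open>p\<close> that preserve the vanishing of all coefficients are closed under sums and
  products, and multiplication by \<open>t powi j\<close> only shifts the coefficients.
\<close>

lemma fourier_coeff_zero_mult_real_polynomial:
  fixes p :: "complex \<Rightarrow> real"
  assumes "real_polynomial_function p" "continuous_on (sphere 0 1) f" "\<And>k. fourier_coeff f k = 0"
  shows "fourier_coeff (\<lambda>t. f t * of_real (p t)) k = 0"
  using assms
proof (induction p arbitrary: f k rule: real_polynomial_function.induct)
  case (linear p)
  note eq = bounded_linear_on_circle[OF linear(1)]
  have "fourier_coeff (\<lambda>t. f t * of_real (p t)) k =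
     fourier_coeff (\<lambda>t. (of_real (p 1 / 2) - \<i> * of_real (p \<i> / 2)) * (f t * t powi 1) + (of_real (p 1 / 2) + \<i> * of_real (p \<i> / 2)) * (f t * t powi (-1))) k"
    by (rule fourier_coeff_cong) (simp only: eq, simp add: algebra_simps)
  also have "\<dots> = 0"
  proof (subst fourier_coeff_add)
    have "continuous_on (sphere 0 1) (\<lambda>t. f t * t powi j)" for j
      by (intro continuous_intros linear(2)) auto
    then show "continuous_on (sphere 0 1) (\<lambda>t. c * (f t * t powi j))" for c j
      by (rule continuous_on_mult_left)
    then show "continuous_on (sphere 0 1) (\<lambda>t. c * (f t * t powi j))" for c j .
  qed (simp only: fourier_coeff_cmult fourier_coeff_shift linear(3), simp)
  finally show ?case .
next
  case (const c)
  then show ?case using fourier_coeff_cmult[of "of_real c" f k] by (simp add: mult.commute)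
next
  case (add p q)
  have cp: "continuous_on (sphere 0 1) p" "continuous_on (sphere 0 1) q"
    using add(1,2) by (auto simp: real_polynomial_function_eq intro: continuous_on_polymonial_function)
  show ?case
    using add fourier_coeff_add[of "\<lambda>t. f t * of_real (p t)" "\<lambda>t. f t * of_real (q t)"]
    by (simp add: cp continuous_intros algebra_simps)
next
  case (mult p q)
  have cp: "continuous_on (sphere 0 1) p" 
    using mult(1) by (auto simp: real_polynomial_function_eq intro: continuous_on_polymonial_function)
  have "fourier_coeff (\<lambda>t. (f t * of_real (p t)) * of_real (q t)) k = 0"
    by (rule mult(4)) (use mult.IH(1)[OF mult.prems] mult.prems cp in \<open>auto intro!: continuous_intros\<close>)
  then show ?case by (simp add: mult.assoc)
qed

lemma fourier_coeff_zero_mult_polynomial: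
  fixes p :: "complex \<Rightarrow> complex"
  assumes p: "polynomial_function p" and f: "continuous_on (sphere 0 1) f" "\<And>k. fourier_coeff f k = 0"
  shows "fourier_coeff (\<lambda>t. f t * p t) k = 0"
proof -
  have re: "real_polynomial_function (Re \<circ> p)" "real_polynomial_function (Im \<circ> p)"
    using p bounded_linear_Re bounded_linear_Im unfolding polynomial_function_def by blast+
  note cp = continuous_on_polymonial_function[OF re(1)[unfolded real_polynomial_function_eq], of "sphere 0 1"]
    continuous_on_polymonial_function[OF re(2)[unfolded real_polynomial_function_eq], of "sphere 0 1"]
  have "fourier_coeff (\<lambda>t. f t * p t) k =
     fourier_coeff (\<lambda>t. f t * of_real ((Re \<circ> p) t) + \<i> * (f t * of_real ((Im \<circ> p) t))) k"
    by (rule fourier_coeff_cong) (simp add: complex_eq_iff algebra_simps)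
  also have "\<dots> = 0"
    using fourier_coeff_zero_mult_real_polynomial[OF re(1) f] fourier_coeff_zero_mult_real_polynomial[OF re(2) f]
    by (subst fourier_coeff_add) (auto simp: fourier_coeff_cmult intro!: continuous_intros f cp[unfolded o_def])
  finally show ?thesis .
qed

text \<open>
  Uniqueness of Fourier coefficients: \<open>f\<close> is orthogonal to all polynomial approximations of
  its conjugate, so the integral of its squared modulus vanishes.
\<close>

lemma fourier_coeff_zero_imp_zero:
  assumes f: "continuous_on (sphere 0 1) f" "\<And>k. fourier_coeff f k = 0" and t: "t \<in> sphere 0 1"
  shows "f t = 0"
proof -
  obtain B where B: "\<And>t. t \<in> sphere 0 1 \<Longrightarrow> norm (f t) \<le> B" "B > 0"
    using compact_imp_bounded[OF compact_continuous_image[OF f(1)]] 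
    unfolding bounded_pos using compact_sphere by blast
  have cf: "continuous_on (sphere 0 1) (\<lambda>t. cnj (f t))" by (intro continuous_intros f)
  define Q where "Q = fourier_coeff (\<lambda>t. f t * cnj (f t)) 0"
  have "norm Q \<le> e" if "e > 0" for e
  proof -
    obtain g where g: "polynomial_function g" "\<And>t. t \<in> sphere 0 1 \<Longrightarrow> norm (cnj (f t) - g t) < e / B"
      using Stone_Weierstrass_polynomial_function[OF compact_sphere cf, of "e / B"] \<open>e > 0\<close> \<open>B > 0\<close> by auto
    have cg: "continuous_on (sphere 0 1) g" using g(1) by (rule continuous_on_polymonial_function)
    have "Q = Q - fourier_coeff (\<lambda>t. f t * g t) 0"
      using fourier_coeff_zero_mult_polynomial[OF g(1) f] by simp
    also have "\<dots> = fourier_coeff (\<lambda>t. f t * (cnj (f t) - g t)) 0"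
      unfolding Q_def by (subst fourier_coeff_diff[symmetric]) (auto intro!: continuous_intros f cg simp: algebra_simps)
    also have "norm \<dots> \<le> B * (e / B)"
    proof (rule norm_fourier_coeff_le)
      show "norm (f t * (cnj (f t) - g t)) \<le> B * (e / B)" if "t \<in> sphere 0 1" for t
        unfolding norm_mult using B that by (intro mult_mono less_imp_le[OF g(2)]) auto
    qed (intro continuous_intros f cg)
    finally show ?thesis using \<open>B > 0\<close> by simp
  qed
  then have Q0: "Q = 0" by (metis dense_le_bounded field_lbound_gt_zero linorder_not_le norm_le_zero_iff zero_less_norm_iff)
  have eqr: "f (cis x) * cnj (f (cis x)) = of_real ((norm (f (cis x)))\<^sup>2)" for x
    by (rule complex_norm_square[symmetric])
  have cr: "continuous_on {0..2*pi} (\<lambda>x. (norm (f (cis x)))\<^sup>2)"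
    by (intro continuous_intros continuous_on_circle_param f)
  have hi: "((\<lambda>x. complex_of_real ((norm (f (cis x)))\<^sup>2)) has_integral
      complex_of_real (integral {0..2*pi} (\<lambda>x. (norm (f (cis x)))\<^sup>2))) {0..2*pi}"
    by (intro has_integral_of_real integrable_integral integrable_continuous_real cr)
  have "Q = of_real (integral {0..2*pi} (\<lambda>x. (norm (f (cis x)))\<^sup>2)) / of_real (2*pi)"
    unfolding Q_def fourier_coeff_def eqr using integral_unique[OF hi] by simp
  then have "integral {0..2*pi} (\<lambda>x. (norm (f (cis x)))\<^sup>2) = 0" using Q0 by simp
  then have z: "(norm (f (cis x)))\<^sup>2 = 0" if "x \<in> {0..2*pi}" for x
    using integral_eq_0_iff[OF cr] that by auto
  have "t = cis (Arg2pi t)" using complex_norm_eq_1_exp[of t] t by (simp add: cis_conv_exp)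
  moreover have "Arg2pi t \<in> {0..2*pi}" using Arg2pi_ge_0[of t] Arg2pi_lt_2pi[of t] by auto
  ultimately show ?thesis using z[of "Arg2pi t"] by simp
qed

lemma fourier_series_eq:
  assumes f: "continuous_on (sphere 0 1) f" and s: "(\<lambda>k. norm (fourier_coeff f k)) summable_on UNIV"
    and t: "t \<in> sphere 0 1"
  shows "f t = (\<Sum>\<^sub>\<infinity>k. fourier_coeff f k * t powi k)"
proof -
  let ?g = "\<lambda>t. \<Sum>\<^sub>\<infinity>k. fourier_coeff f k * t powi k"
  have g: "continuous_on (sphere 0 1) ?g" by (rule fourier_coeff_mult_series(1)[OF f s]) simp
  have "f t - ?g t = 0"
    by (rule fourier_coeff_zero_imp_zero[OF _ _ t])
       (use f g fourier_coeff_of_series[OF s] in \<open>auto intro!: continuous_intros simp: fourier_coeff_diff\<close>)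
  then show ?thesis by simp
qed

text \<open>
  The image of the circle is a differentiable curve, hence a null set in the plane, and cannot
  cover a disc.
\<close>

lemma polynomial_function_misses_small:
  fixes g :: "complex \<Rightarrow> complex"
  assumes g: "polynomial_function g" and d: "\<delta> > 0"
  obtains c where "norm c < \<delta>" "\<And>t. t \<in> sphere 0 1 \<Longrightarrow> g t \<noteq> c"
proof -
  have "(\<lambda>x::real. g (cis x)) differentiable_on UNIV"
  proof -
    have "cis differentiable (at x)" for x
    proof -
      have "((\<lambda>z. exp (\<i> * z)) has_field_derivative exp (\<i> * of_real x) * \<i>) (at (of_real x))"
        by (auto intro!: derivative_eq_intros)
      from has_vector_derivative_real_field[OF this] show ?thesis
        unfolding cis_conv_exp[abs_def] by (rule differentiableI_vector)
    qed
    then show ?thesis unfolding differentiable_on_def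
      using differentiable_chain_at[of cis _ g] differentiable_at_polynomial_function[OF g]
      by (auto simp: o_def)
  qed
  then have "negligible (range (\<lambda>x::real. g (cis x)))"
    by (intro negligible_differentiable_image_lowdim) auto
  moreover have "\<not> negligible (ball (0::complex) \<delta>)"
    using d by (intro open_not_negligible) auto
  ultimately have "\<not> ball 0 \<delta> \<subseteq> range (\<lambda>x::real. g (cis x))"
    using negligible_subset by blast
  then obtain c where "c \<in> ball 0 \<delta>" and c2: "c \<notin> range (\<lambda>x::real. g (cis x))" by blast
  then have c: "norm c < \<delta>" by simp
  have "g t \<noteq> c" if "t \<in> sphere 0 1" for t
  proof -
    have "t = cis (Arg2pi t)" using complex_norm_eq_1_exp[of t] that by (simp add: cis_conv_exp)
    then show ?thesis using c2 rangeI[of "\<lambda>x. g (cis x)" "Arg2pi t"] by auto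
  qed
  then show ?thesis using c that by blast
qed

section \<open>The weighted Wiener algebra\<close>

lemma norm_mult_powi_circle:
  fixes c :: "int \<Rightarrow> complex"
  assumes "t \<in> sphere 0 1"
  shows "norm (c k * t powi k) = norm (c k)"
  using norm_powi_circle[OF assms] by (simp add: norm_mult)

lemma has_sum_product:
  fixes f :: "'a \<Rightarrow> real" and g :: "'b \<Rightarrow> real"
  assumes f: "f summable_on A" "\<And>x. x \<in> A \<Longrightarrow> f x \<ge> 0" and g: "g summable_on B" "\<And>x. x \<in> B \<Longrightarrow> g x \<ge> 0"
  shows "((\<lambda>(x, y). f x * g y) has_sum (infsum f A * infsum g B)) (A \<times> B)"
proof -
  have 1: "((\<lambda>y. f x * g y) has_sum (f x * infsum g B)) B" for x
    using g(1) by (intro has_sum_cmult_right has_sum_infsum)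
  have 2: "((\<lambda>x. f x * infsum g B) has_sum (infsum f A * infsum g B)) A"
    using f(1) by (intro has_sum_cmult_left has_sum_infsum)
  have "(\<lambda>(x, y). f x * g y) summable_on (A \<times> B)"
    by (rule summable_on_SigmaI[where g = "\<lambda>x. f x * infsum g B"]) (use 1 2 f g in \<open>auto simp: summable_on_def\<close>)
  then show ?thesis
    by (intro has_sum_SigmaI[where g = "\<lambda>x. f x * infsum g B"]) (use 1 2 in auto)
qed

locale wiener_exponents =
  fixes \<alpha>1 \<alpha>2 :: real
  assumes nonneg: "\<alpha>1 \<ge> 0" "\<alpha>2 \<ge> 0" and sum1: "\<alpha>1 + \<alpha>2 = 1"
begin

abbreviation "W \<equiv> wiener \<alpha>1 \<alpha>2"
abbreviation "w \<equiv> wiener_weight \<alpha>1 \<alpha>2"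

definition wnorm :: "(complex \<Rightarrow> complex) \<Rightarrow> real" where
  "wnorm f = (\<Sum>\<^sub>\<infinity>k. w k * norm (fourier_coeff f k))"

lemma weight_ge_1: "w k \<ge> 1"
  using nonneg by (auto simp: wiener_weight_def intro!: ge_one_powr_ge_zero)

lemma weight_nonneg [simp]: "w k \<ge> 0"
  using weight_ge_1[of k] by linarith

lemma le_weight_mult: "x \<ge> 0 \<Longrightarrow> x \<le> w k * x"
  using mult_right_mono[OF weight_ge_1, of x k] by simp

lemma weight_le: "w k \<le> 1 + of_int \<bar>k\<bar>"
proof -
  have "(1 + of_int \<bar>k\<bar>) powr a \<le> (1 + of_int \<bar>k\<bar>) powr (1::real)" if "a \<le> 1" for a
    using that by (intro powr_mono) auto
  then show ?thesis using nonneg sum1 by (auto simp: wiener_weight_def)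
qed

text \<open>
  For moduli of indices of the same sign this is \<open>1 + j + k \<le> (1 + j) (1 + k)\<close>. For indices of opposite signs
  the modulus of the sum is at most the modulus of the index with the same sign as the sum, and the
  other weight is at least \<open>1\<close>; so the two exponents never have to be compared.
\<close>

lemma weight_submult: "w (j + k) \<le> w j * w k"
proof -
  have same: "(1 + of_int \<bar>j + k\<bar>) powr a \<le> (1 + of_int \<bar>j\<bar>) powr a * (1 + of_int \<bar>k\<bar>) powr a" if "a \<ge> 0" for a :: real
  proof -
    have "\<bar>j + k\<bar> \<le> \<bar>j\<bar> + \<bar>k\<bar> + \<bar>j\<bar> * \<bar>k\<bar>" by (meson abs_triangle_ineq abs_ge_zero add_increasing2 mult_nonneg_nonneg)
    then have "real_of_int \<bar>j + k\<bar> \<le> of_int (\<bar>j\<bar> + \<bar>k\<bar> + \<bar>j\<bar> * \<bar>k\<bar>)" by (rule of_int_le_iff[THEN iffD2])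
    then have "(1 + of_int \<bar>j + k\<bar>) powr a \<le> ((1 + of_int \<bar>j\<bar>) * (1 + of_int \<bar>k\<bar>)) powr a"
      using that by (intro powr_mono2) (auto simp: algebra_simps)
    then show ?thesis by (simp add: powr_mult)
  qed
  have mixed: "w (i + l) \<le> w i * w l" if "i \<ge> 0" "l < 0" for i l
  proof (cases "i + l \<ge> 0")
    case True
    have "w (i + l) \<le> w i * 1"
      using True that nonneg by (simp add: wiener_weight_def) (intro powr_mono2; simp)
    also have "\<dots> \<le> w i * w l" by (intro mult_left_mono weight_ge_1) auto
    finally show ?thesis .
  next
    case False
    have "w (i + l) \<le> 1 * w l"
      using False that nonneg by (simp add: wiener_weight_def) (intro powr_mono2; simp)
    also have "\<dots> \<le> w i * w l" by (intro mult_right_mono weight_ge_1) auto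
    finally show ?thesis .
  qed
  show ?thesis
  proof (cases "j \<ge> 0"; cases "k \<ge> 0")
    assume "j \<ge> 0" "k \<ge> 0"
    then show ?thesis using same[of \<alpha>1] nonneg by (simp add: wiener_weight_def)
  next
    assume "\<not> j \<ge> 0" "\<not> k \<ge> 0"
    then show ?thesis using same[of \<alpha>2] nonneg by (simp add: wiener_weight_def)
  next
    assume "j \<ge> 0" "\<not> k \<ge> 0"
    then show ?thesis using mixed[of j k] by simp
  next
    assume "\<not> j \<ge> 0" "k \<ge> 0"
    then show ?thesis using mixed[of k j] by (simp add: add.commute mult.commute)
  qed
qed

lemma wiener_continuous: "f \<in> W \<Longrightarrow> continuous_on (sphere 0 1) f"
  and wiener_weighted_summable: "f \<in> W \<Longrightarrow> (\<lambda>k. w k * norm (fourier_coeff f k)) summable_on UNIV"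
  by (auto simp: wiener_def)

lemma weighted_imp_summable:
  assumes "(\<lambda>k. w k * norm (c k)) summable_on A"
  shows "(\<lambda>k. norm (c k)) summable_on A"
  by (rule summable_on_comparison_test[OF assms]) (auto intro: le_weight_mult)

lemma wiener_summable: "f \<in> W \<Longrightarrow> (\<lambda>k. norm (fourier_coeff f k)) summable_on UNIV"
  by (intro weighted_imp_summable wiener_weighted_summable)

lemma wiener_series:
  "f \<in> W \<Longrightarrow> t \<in> sphere 0 1 \<Longrightarrow> f t = (\<Sum>\<^sub>\<infinity>k. fourier_coeff f k * t powi k)"
  by (intro fourier_series_eq wiener_continuous wiener_summable)

lemma wiener_cong:
  assumes "\<And>t. t \<in> sphere 0 1 \<Longrightarrow> f t = g t"
  shows "f \<in> W \<longleftrightarrow> g \<in> W"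
proof -
  have "fourier_coeff f = fourier_coeff g" using fourier_coeff_cong[of f g, OF assms] by blast
  moreover have "continuous_on (sphere 0 1) f \<longleftrightarrow> continuous_on (sphere 0 1) g"
    using assms by (intro continuous_on_cong) auto
  ultimately show ?thesis by (simp add: wiener_def)
qed

lemma wienerI_series:
  assumes c: "(\<lambda>k. w k * norm (c k)) summable_on UNIV"
    and g: "\<And>t. t \<in> sphere 0 1 \<Longrightarrow> g t = (\<Sum>\<^sub>\<infinity>k. c k * t powi k)"
  shows "g \<in> W" "fourier_coeff g k = c k"
proof -
  note c' = weighted_imp_summable[OF c]
  show fc: "fourier_coeff g k = c k" for k by (rule fourier_coeff_of_series[OF c' g])
  have "continuous_on (sphere 0 1) g"
    by (rule fourier_coeff_mult_series(1)[OF continuous_on_const[of _ 1] c' g])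
  then show "g \<in> W" using c fc by (simp add: wiener_def)
qed

lemma wnorm_nonneg: "wnorm f \<ge> 0"
  unfolding wnorm_def by (intro infsum_nonneg) auto

lemma norm_le_wnorm:
  assumes f: "f \<in> W" and t: "t \<in> sphere 0 1"
  shows "norm (f t) \<le> wnorm f"
proof -
  have s: "(\<lambda>k. norm (fourier_coeff f k * t powi k)) summable_on UNIV"
    using wiener_summable[OF f] by (simp add: norm_mult_powi_circle[OF t])
  have "norm (f t) \<le> (\<Sum>\<^sub>\<infinity>k. norm (fourier_coeff f k * t powi k))"
    unfolding wiener_series[OF f t] by (rule norm_infsum_bound[OF s])
  also have "\<dots> \<le> wnorm f"
    unfolding wnorm_def
    by (rule infsum_mono[OF s wiener_weighted_summable[OF f]])
       (auto simp: norm_mult_powi_circle[OF t] intro: le_weight_mult)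
  finally show ?thesis .
qed

lemma wiener_mult:
  assumes f: "f \<in> W" and g: "g \<in> W"
  shows "(\<lambda>t. f t * g t) \<in> W" "wnorm (\<lambda>t. f t * g t) \<le> wnorm f * wnorm g"
    "((\<lambda>k. fourier_coeff g k * fourier_coeff f (n - k)) has_sum fourier_coeff (\<lambda>t. f t * g t) n) UNIV"
proof -
  have hs: "((\<lambda>k. fourier_coeff g k * fourier_coeff f (n - k)) has_sum fourier_coeff (\<lambda>t. f t * g t) n) UNIV" for n
    by (rule fourier_coeff_mult_series(2)[OF wiener_continuous[OF f] wiener_summable[OF g] wiener_series[OF g]])
  then show "((\<lambda>k. fourier_coeff g k * fourier_coeff f (n - k)) has_sum fourier_coeff (\<lambda>t. f t * g t) n) UNIV" .
  let ?F = "\<lambda>k. w k * norm (fourier_coeff f k)" and ?G = "\<lambda>k. w k * norm (fourier_coeff g k)"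
  have P: "((\<lambda>(j, k). ?F j * ?G k) has_sum (wnorm f * wnorm g)) (UNIV \<times> UNIV)"
    unfolding wnorm_def
    by (rule has_sum_product) (use f g wiener_weighted_summable in auto)
  have bij: "bij_betw (\<lambda>(n, k). (n - k, k)) (UNIV \<times> UNIV) (UNIV \<times> (UNIV :: int set))"
    by (rule bij_betwI[where g = "\<lambda>(j, k). (j + k, k)"]) auto
  have P': "((\<lambda>(n, k). ?F (n - k) * ?G k) has_sum (wnorm f * wnorm g)) (UNIV \<times> UNIV)"
    using has_sum_reindex_bij_betw[OF bij, of "\<lambda>(j, k). ?F j * ?G k"] P by (simp add: case_prod_unfold)
  let ?H = "\<lambda>n. \<Sum>\<^sub>\<infinity>k. ?F (n - k) * ?G k"
  have sH: "(\<lambda>k. ?F (n - k) * ?G k) summable_on UNIV" for n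
    using summable_on_SigmaD1[where f = "\<lambda>n k. ?F (n - k) * ?G k", of UNIV "\<lambda>_. UNIV" n] P' by (auto simp: summable_on_def)
  have H: "(?H has_sum (wnorm f * wnorm g)) UNIV"
    by (rule has_sum_SigmaD[OF P']) (use sH in auto)
  have le: "w n * norm (fourier_coeff (\<lambda>t. f t * g t) n) \<le> ?H n" for n
  proof -
    have "((\<lambda>k. w n * (fourier_coeff g k * fourier_coeff f (n - k))) has_sum w n * fourier_coeff (\<lambda>t. f t * g t) n) UNIV"
      by (intro has_sum_cmult_right hs)
    then have "norm (w n * fourier_coeff (\<lambda>t. f t * g t) n) \<le> ?H n"
    proof (rule norm_infsum_le[OF _ has_sum_infsum[OF sH]])
      fix k
      have "w n \<le> w (n - k) * w k" using weight_submult[of "n - k" k] by simp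
      then have "w n * (norm (fourier_coeff g k) * norm (fourier_coeff f (n - k))) \<le> w (n - k) * w k * (norm (fourier_coeff g k) * norm (fourier_coeff f (n - k)))"
        by (intro mult_right_mono) auto
      then show "norm (w n * (fourier_coeff g k * fourier_coeff f (n - k))) \<le> ?F (n - k) * ?G k"
        by (simp add: norm_mult mult_ac)
    qed
    then show ?thesis by (simp add: norm_mult)
  qed
  have s: "(\<lambda>n. w n * norm (fourier_coeff (\<lambda>t. f t * g t) n)) summable_on UNIV"
    by (rule summable_on_comparison_test[where f = ?H]) (use H le in \<open>auto simp: summable_on_def\<close>)
  then show "(\<lambda>t. f t * g t) \<in> W"
    using wiener_continuous[OF f] wiener_continuous[OF g] by (auto simp: wiener_def intro!: continuous_intros)
  show "wnorm (\<lambda>t. f t * g t) \<le> wnorm f * wnorm g"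
    using infsum_mono[OF s has_sum_imp_summable[OF H]] le H unfolding wnorm_def[of "\<lambda>t. f t * g t"] by (simp add: infsumI)
qed

lemma wiener_add: 
  assumes f: "f \<in> W" and g: "g \<in> W"
  shows "(\<lambda>t. f t + g t) \<in> W" "wnorm (\<lambda>t. f t + g t) \<le> wnorm f + wnorm g"
proof -
  note c = wiener_continuous[OF f] wiener_continuous[OF g]
  let ?F = "\<lambda>k. w k * norm (fourier_coeff f k)" and ?G = "\<lambda>k. w k * norm (fourier_coeff g k)"
  have le: "w k * norm (fourier_coeff (\<lambda>t. f t + g t) k) \<le> ?F k + ?G k" for k
    unfolding fourier_coeff_add[OF c] distrib_left[symmetric] by (intro mult_left_mono norm_triangle_ineq) auto
  have s: "(\<lambda>k. ?F k + ?G k) summable_on UNIV"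
    by (intro summable_on_add wiener_weighted_summable f g)
  have s': "(\<lambda>k. w k * norm (fourier_coeff (\<lambda>t. f t + g t) k)) summable_on UNIV"
    by (rule summable_on_comparison_test[OF s]) (use le in auto)
  then show "(\<lambda>t. f t + g t) \<in> W"
    using c by (auto simp: wiener_def intro!: continuous_intros)
  show "wnorm (\<lambda>t. f t + g t) \<le> wnorm f + wnorm g"
    using infsum_mono[OF s' s le] unfolding wnorm_def
    by (simp add: infsum_add wiener_weighted_summable f g)
qed

lemma wiener_const: "(\<lambda>t. c) \<in> W" "wnorm (\<lambda>t. c) = norm c"
proof -
  have hs: "((\<lambda>k. w k * norm (fourier_coeff (\<lambda>t. c) k)) has_sum norm c) UNIV"
    by (rule has_sum_finite_neutralI[of "{0}"]) (auto simp: fourier_coeff_const wiener_weight_def)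
  then show "(\<lambda>t. c) \<in> W" by (auto simp: wiener_def summable_on_def)
  show "wnorm (\<lambda>t. c) = norm c" unfolding wnorm_def using hs by (rule infsumI)
qed

lemma wiener_cmult: "f \<in> W \<Longrightarrow> (\<lambda>t. c * f t) \<in> W" and wnorm_cmult: "f \<in> W \<Longrightarrow> wnorm (\<lambda>t. c * f t) \<le> norm c * wnorm f"
  using wiener_mult[OF wiener_const(1)[of c]] by (simp_all add: wiener_const)

lemma wiener_minus: "f \<in> W \<Longrightarrow> (\<lambda>t. - f t) \<in> W"
  using wiener_cmult[of f "-1"] by simp

lemma wiener_diff: "f \<in> W \<Longrightarrow> g \<in> W \<Longrightarrow> (\<lambda>t. f t - g t) \<in> W"
  using wiener_add(1)[OF _ wiener_minus] by fastforce

lemma wiener_power: "f \<in> W \<Longrightarrow> (\<lambda>t. f t ^ n) \<in> W \<and> wnorm (\<lambda>t. f t ^ n) \<le> wnorm f ^ n"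
proof (induction n)
  case (Suc n)
  then have IH: "(\<lambda>t. f t ^ n) \<in> W" "wnorm (\<lambda>t. f t ^ n) \<le> wnorm f ^ n" by auto
  have "wnorm (\<lambda>t. f t * f t ^ n) \<le> wnorm f * wnorm (\<lambda>t. f t ^ n)"
    by (rule wiener_mult(2)[OF Suc.prems IH(1)])
  also have "\<dots> \<le> wnorm f * wnorm f ^ n" by (intro mult_left_mono IH wnorm_nonneg)
  finally show ?case using wiener_mult(1)[OF Suc.prems IH(1)] by simp
qed (auto simp: wiener_const)

lemma wiener_sum: "(\<And>i. i \<in> I \<Longrightarrow> f i \<in> W) \<Longrightarrow> (\<lambda>t. \<Sum>i\<in>I. f i t) \<in> W"
  by (induction I rule: infinite_finite_induct) (auto simp: wiener_const wiener_add)

lemma wiener_prod: "(\<And>i. i \<in> I \<Longrightarrow> f i \<in> W) \<Longrightarrow> (\<lambda>t. \<Prod>i\<in>I. f i t) \<in> W"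
  by (induction I rule: infinite_finite_induct) (auto simp: wiener_const wiener_mult)

text \<open>
  Completeness of the algebra, in the form needed for power series: the double series of weighted
  coefficients converges absolutely, so the summations over \<open>n\<close> and over the frequencies commute.
\<close>

lemma wiener_suminf:
  assumes f: "\<And>n. f n \<in> W" and s: "summable (\<lambda>n. wnorm (f n))"
  shows "(\<lambda>t. \<Sum>n. f n t) \<in> W" "(\<lambda>n. fourier_coeff (f n) k) sums fourier_coeff (\<lambda>t. \<Sum>n. f n t) k"
proof -
  let ?c = "\<lambda>n k. fourier_coeff (f n) k"
  have s': "(\<lambda>n. wnorm (f n)) summable_on UNIV"
    using s by (simp add: summable_on_UNIV_nonneg_real_iff wnorm_nonneg)
  have P: "(\<lambda>(n, k). w k * norm (?c n k)) summable_on (UNIV \<times> UNIV)"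
    by (rule summable_on_SigmaI[where g = "\<lambda>n. wnorm (f n)"])
       (use s' wiener_weighted_summable[OF f] in \<open>auto simp: wnorm_def\<close>)
  have P': "(\<lambda>(n, k). norm (?c n k)) summable_on (UNIV \<times> UNIV)"
    by (rule summable_on_comparison_test[OF P]) (auto intro: le_weight_mult)
  have swap: "(\<lambda>(k, n). w k * norm (?c n k)) summable_on (UNIV \<times> UNIV)"
    using P summable_on_swap[of "\<lambda>(n, k). w k * norm (?c n k)" UNIV UNIV] by simp
  have sn: "(\<lambda>n. w k * norm (?c n k)) summable_on UNIV" for k
    using summable_on_SigmaD1[OF swap] by auto
  have sn': "(\<lambda>n. norm (?c n k)) summable_on UNIV" for k
    by (rule summable_on_comparison_test[OF sn[of k]]) (auto intro: le_weight_mult)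
  define C where "C = (\<lambda>k. \<Sum>\<^sub>\<infinity>n. ?c n k)"
  have C: "(\<lambda>k. w k * norm (C k)) summable_on UNIV"
  proof (rule summable_on_comparison_test[OF summable_on_Sigma_banach[OF swap]])
    fix k
    have "norm (C k) \<le> (\<Sum>\<^sub>\<infinity>n. norm (?c n k))" unfolding C_def by (rule norm_infsum_bound[OF sn'])
    then have "w k * norm (C k) \<le> w k * (\<Sum>\<^sub>\<infinity>n. norm (?c n k))" by (rule mult_left_mono) simp
    then show "w k * norm (C k) \<le> (\<Sum>\<^sub>\<infinity>n. w k * norm (?c n k))" by (simp add: infsum_cmult_right')
  qed auto
  have eq: "(\<Sum>n. f n t) = (\<Sum>\<^sub>\<infinity>k. C k * t powi k)" if t: "t \<in> sphere 0 1" for t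
  proof -
    have sm: "(\<lambda>(n, k). ?c n k * t powi k) summable_on (UNIV \<times> UNIV)"
      by (rule abs_summable_summable) (use P' in \<open>simp add: case_prod_unfold norm_mult_powi_circle[OF t]\<close>)
    have "(\<lambda>n. f n t) summable_on UNIV"
      using summable_on_Sigma_banach[OF sm] by (simp add: wiener_series[OF f t])
    then have "(\<Sum>n. f n t) = (\<Sum>\<^sub>\<infinity>n. f n t)"
      using has_sum_imp_sums has_sum_infsum sums_unique by metis
    also have "\<dots> = (\<Sum>\<^sub>\<infinity>n. \<Sum>\<^sub>\<infinity>k. ?c n k * t powi k)" by (simp add: wiener_series[OF f t])
    also have "\<dots> = (\<Sum>\<^sub>\<infinity>k. \<Sum>\<^sub>\<infinity>n. ?c n k * t powi k)" by (rule infsum_swap_banach[OF sm])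
    also have "\<dots> = (\<Sum>\<^sub>\<infinity>k. C k * t powi k)" unfolding C_def by (simp add: infsum_cmult_left')
    finally show ?thesis .
  qed
  show "(\<lambda>t. \<Sum>n. f n t) \<in> W" by (rule wienerI_series[OF C eq])
  have "fourier_coeff (\<lambda>t. \<Sum>n. f n t) k = C k" by (rule wienerI_series[OF C eq])
  moreover have "(\<lambda>n. ?c n k) sums C k"
    unfolding C_def by (rule has_sum_imp_sums[OF has_sum_infsum[OF abs_summable_summable[OF sn']]])
  ultimately show "(\<lambda>n. ?c n k) sums fourier_coeff (\<lambda>t. \<Sum>n. f n t) k" by simp
qed

lemma wiener_transfer:
  assumes "f \<in> W" "\<And>t. t \<in> sphere 0 1 \<Longrightarrow> g t = f t"
  shows "g \<in> W"
  using wiener_cong[of g f] assms by simp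

section \<open>Exponentials, logarithms and inverses in the algebra\<close>

text \<open>
  The closed subalgebras of functions with nonnegative (\<open>\<sigma> = 1\<close>) and nonpositive (\<open>\<sigma> = -1\<close>)
  frequencies. On each of them the coefficient at \<open>0\<close> is multiplicative, which determines the
  diagonal of the triangular matrices below.
\<close>

definition half_wiener :: "int \<Rightarrow> (complex \<Rightarrow> complex) \<Rightarrow> bool" where
  "half_wiener \<sigma> f \<longleftrightarrow> f \<in> W \<and> (\<forall>k. \<sigma> * k < 0 \<longrightarrow> fourier_coeff f k = 0)"

lemma half_wiener_mult:
  assumes f: "half_wiener \<sigma> f" and g: "half_wiener \<sigma> g" and \<sigma>: "\<sigma> \<noteq> 0"
  shows "half_wiener \<sigma> (\<lambda>t. f t * g t)" "fourier_coeff (\<lambda>t. f t * g t) 0 = fourier_coeff f 0 * fourier_coeff g 0"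
proof -
  have fW: "f \<in> W" "g \<in> W" using f g by (auto simp: half_wiener_def)
  note hs = wiener_mult(3)[OF fW]
  have "fourier_coeff (\<lambda>t. f t * g t) n = 0" if n: "\<sigma> * n < 0" for n
  proof -
    have "fourier_coeff g k * fourier_coeff f (n - k) = 0" for k
    proof (cases "\<sigma> * k < 0")
      case False
      then have "\<sigma> * (n - k) < 0" using n by (simp add: algebra_simps)
      then show ?thesis using f by (auto simp: half_wiener_def)
    qed (use g in \<open>auto simp: half_wiener_def\<close>)
    then show ?thesis by (intro has_sum_unique[OF hs[of n] has_sum_0])
  qed
  then show "half_wiener \<sigma> (\<lambda>t. f t * g t)"
    using wiener_mult(1)[OF fW] by (auto simp: half_wiener_def)
  have "((\<lambda>k. fourier_coeff g k * fourier_coeff f (0 - k)) has_sum fourier_coeff f 0 * fourier_coeff g 0) UNIV"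
  proof (rule has_sum_finite_neutralI[of "{0}"])
    fix k :: int assume "k \<in> UNIV - {0}"
    then have "\<sigma> * k \<noteq> 0" using \<sigma> by simp
    then consider "\<sigma> * k < 0" | "\<sigma> * (- k) < 0" by fastforce
    then show "fourier_coeff g k * fourier_coeff f (0 - k) = 0"
      using f g by cases (auto simp: half_wiener_def)
  qed auto
  then show "fourier_coeff (\<lambda>t. f t * g t) 0 = fourier_coeff f 0 * fourier_coeff g 0"
    using has_sum_unique[OF hs[of 0]] by blast
qed

lemma half_wiener_power:
  assumes f: "half_wiener \<sigma> f" and \<sigma>: "\<sigma> \<noteq> 0"
  shows "half_wiener \<sigma> (\<lambda>t. f t ^ n) \<and> fourier_coeff (\<lambda>t. f t ^ n) 0 = fourier_coeff f 0 ^ n"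
proof (induction n)
  case 0
  then show ?case using \<sigma> by (auto simp: half_wiener_def wiener_const fourier_coeff_const)
next
  case (Suc n)
  then show ?case using half_wiener_mult[OF f _ \<sigma>, of "\<lambda>t. f t ^ n"] by simp
qed

lemma wiener_exp_terms:
  assumes f: "f \<in> W"
  shows "(\<lambda>t. (1 / fact n) * f t ^ n) \<in> W" "summable (\<lambda>n. wnorm (\<lambda>t. (1 / fact n) * f t ^ n))"
    "exp (f t) = (\<Sum>n. (1 / fact n) * f t ^ n)"
proof -
  note p = wiener_power[OF f]
  show "(\<lambda>t. (1 / fact n) * f t ^ n) \<in> W" for n using p by (intro wiener_cmult) auto
  have "wnorm (\<lambda>t. (1 / fact n) * f t ^ n) \<le> wnorm f ^ n /\<^sub>R fact n" for n
  proof -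
    have "wnorm (\<lambda>t. (1 / fact n) * f t ^ n) \<le> norm (1 / fact n :: complex) * wnorm (\<lambda>t. f t ^ n)"
      using p by (intro wnorm_cmult) auto
    also have "\<dots> \<le> norm (1 / fact n :: complex) * wnorm f ^ n"
      using p by (intro mult_left_mono) auto
    finally show ?thesis by (simp add: norm_divide divide_simps)
  qed
  then show "summable (\<lambda>n. wnorm (\<lambda>t. (1 / fact n) * f t ^ n))"
    by (intro summable_comparison_test'[OF summable_exp_generic[of "wnorm f"]]) (auto simp: wnorm_nonneg)
  show "exp (f t) = (\<Sum>n. (1 / fact n) * f t ^ n)"
    by (simp add: exp_def scaleR_conv_of_real divide_inverse)
qed

lemma wiener_exp: "f \<in> W \<Longrightarrow> (\<lambda>t. exp (f t)) \<in> W"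
  using wiener_suminf(1)[of "\<lambda>n t. (1 / fact n) * f t ^ n"] wiener_exp_terms by simp

lemma half_wiener_exp:
  assumes f: "half_wiener \<sigma> f" and \<sigma>: "\<sigma> \<noteq> 0"
  shows "half_wiener \<sigma> (\<lambda>t. exp (f t))" "fourier_coeff (\<lambda>t. exp (f t)) 0 = exp (fourier_coeff f 0)"
proof -
  have fW: "f \<in> W" using f by (simp add: half_wiener_def)
  have s: "(\<lambda>n. (1 / fact n) * fourier_coeff (\<lambda>t. f t ^ n) k) sums fourier_coeff (\<lambda>t. exp (f t)) k" for k
    using wiener_suminf(2)[of "\<lambda>n t. (1 / fact n) * f t ^ n" k, OF wiener_exp_terms(1,2)[OF fW]]
    unfolding fourier_coeff_cmult wiener_exp_terms(3)[OF fW] .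
  have "fourier_coeff (\<lambda>t. exp (f t)) k = 0" if "\<sigma> * k < 0" for k
  proof -
    have "fourier_coeff (\<lambda>t. f t ^ n) k = 0" for n
      using half_wiener_power[OF f \<sigma>, of n] that by (auto simp: half_wiener_def)
    then have "(\<lambda>n. 0) sums fourier_coeff (\<lambda>t. exp (f t)) k" using s[of k] by simp
    then show ?thesis using sums_unique2[OF sums_zero] by metis
  qed
  then show "half_wiener \<sigma> (\<lambda>t. exp (f t))" using wiener_exp[OF fW] by (auto simp: half_wiener_def)
  have "(\<lambda>n. (1 / fact n) * fourier_coeff f 0 ^ n) sums exp (fourier_coeff f 0)"
    using exp_converges[of "fourier_coeff f 0"] by (simp add: scaleR_conv_of_real divide_inverse)
  then show "fourier_coeff (\<lambda>t. exp (f t)) 0 = exp (fourier_coeff f 0)"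
    using s[of 0] half_wiener_power[OF f \<sigma>] sums_unique2 by (metis (no_types, lifting) ext)
qed

definition fourier_part :: "int set \<Rightarrow> (complex \<Rightarrow> complex) \<Rightarrow> complex \<Rightarrow> complex" where
  "fourier_part S f t = (\<Sum>\<^sub>\<infinity>k. (if k \<in> S then fourier_coeff f k else 0) * t powi k)"

lemma fourier_part:
  assumes f: "f \<in> W"
  shows "fourier_part S f \<in> W" "fourier_coeff (fourier_part S f) k = (if k \<in> S then fourier_coeff f k else 0)"
proof -
  have "(\<lambda>k. w k * norm (if k \<in> S then fourier_coeff f k else 0)) summable_on UNIV"
    by (rule summable_on_comparison_test[OF wiener_weighted_summable[OF f]]) auto
  from wienerI_series[OF this, of "fourier_part S f"]
  show "fourier_part S f \<in> W" "fourier_coeff (fourier_part S f) k = (if k \<in> S then fourier_coeff f k else 0)"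
    by (auto simp: fourier_part_def)
qed

lemma fourier_part_add:
  assumes f: "f \<in> W" and t: "t \<in> sphere 0 1"
  shows "fourier_part S f t + fourier_part (- S) f t = f t"
proof -
  have fi: "fourier_coeff (\<lambda>t. fourier_part S f t + fourier_part (- S) f t) k = fourier_coeff f k" for k
    using fourier_part[OF f] wiener_continuous by (subst fourier_coeff_add) auto
  have "fourier_part S f t + fourier_part (- S) f t = (\<Sum>\<^sub>\<infinity>k. fourier_coeff f k * t powi k)"
    using wiener_series[OF wiener_add(1)[OF fourier_part(1)[OF f] fourier_part(1)[OF f]] t, of S "- S"] fi by simp
  then show ?thesis using wiener_series[OF f t] by simp
qed

lemma wiener_powi: "(\<lambda>t. t powi j) \<in> W"
proof -
  have "(\<lambda>k. w k * norm (if k = j then 1 else 0 :: complex)) summable_on UNIV"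
    by (rule has_sum_imp_summable, rule has_sum_finite_neutralI[of "{j}", OF _ _ _ refl]) auto
  moreover have "(\<Sum>\<^sub>\<infinity>k. (if k = j then 1 else 0) * t powi k) = t powi j" for t :: complex
    by (rule infsumI, rule has_sum_finite_neutralI[of "{j}"]) auto
  ultimately show ?thesis
    by (intro wienerI_series(1)[where c = "\<lambda>k. if k = j then 1 else 0"]) auto
qed

lemma wiener_real_polynomial:
  fixes p :: "complex \<Rightarrow> real"
  assumes "real_polynomial_function p"
  shows "(\<lambda>t. of_real (p t)) \<in> W"
  using assms
proof (induction p rule: real_polynomial_function.induct)
  case (linear p)
  show ?case
    by (rule wiener_transfer[OF _ bounded_linear_on_circle[OF linear]])
       (intro wiener_add wiener_cmult wiener_powi)
next
  case (const c)
  show ?case by (rule wiener_const)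
next
  case (add p q)
  then show ?case using wiener_add(1)[of "\<lambda>t. of_real (p t)" "\<lambda>t. of_real (q t)"] by simp
next
  case (mult p q)
  then show ?case using wiener_mult(1)[of "\<lambda>t. of_real (p t)" "\<lambda>t. of_real (q t)"] by simp
qed

lemma wiener_polynomial:
  fixes p :: "complex \<Rightarrow> complex"
  assumes p: "polynomial_function p"
  shows "p \<in> W"
proof -
  have re: "real_polynomial_function (Re \<circ> p)" "real_polynomial_function (Im \<circ> p)"
    using p bounded_linear_Re bounded_linear_Im unfolding polynomial_function_def by blast+
  have "(\<lambda>t. of_real ((Re \<circ> p) t) + \<i> * of_real ((Im \<circ> p) t)) \<in> W"
    by (intro wiener_add wiener_cmult wiener_real_polynomial re)
  moreover have "(\<lambda>t. of_real ((Re \<circ> p) t) + \<i> * of_real ((Im \<circ> p) t)) = p"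
    by (auto simp: complex_eq_iff)
  ultimately show ?thesis by simp
qed

lemma wnorm_sum: "(\<And>i. i \<in> I \<Longrightarrow> f i \<in> W) \<Longrightarrow> wnorm (\<lambda>t. \<Sum>i\<in>I. f i t) \<le> (\<Sum>i\<in>I. wnorm (f i))"
proof (induction I rule: infinite_finite_induct)
  case (insert i I)
  have "wnorm (\<lambda>t. f i t + (\<Sum>i\<in>I. f i t)) \<le> wnorm (f i) + wnorm (\<lambda>t. \<Sum>i\<in>I. f i t)"
    using insert.prems by (intro wiener_add(2) wiener_sum) auto
  then show ?case using insert by auto
qed (auto simp: wiener_const)

text \<open>
  The \<open>k\<close>-th power of a trigonometric polynomial of degree \<open>M\<close> has degree \<open>k M\<close>. Its
  algebra norm thus exceeds the \<open>k\<close>-th power of its supremum only by a factor that is polynomial in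
  \<open>k\<close>: the number of coefficients times the largest weight.
\<close>

lemma fourier_part_interval_power:
  assumes u: "u \<in> W" and B: "\<And>t. t \<in> sphere 0 1 \<Longrightarrow> norm (fourier_part {- M..M} u t) \<le> B" and M: "M \<ge> 0"
  shows "wnorm (\<lambda>t. fourier_part {- M..M} u t ^ k) \<le> (2 * real k * M + 1)\<^sup>2 * B ^ k"
proof -
  let ?P = "fourier_part {- M..M} u"
  have PW: "(\<lambda>t. ?P t ^ k) \<in> W" for k using wiener_power[OF fourier_part(1)[OF u]] by auto
  have supp: "fourier_coeff (\<lambda>t. ?P t ^ k) j = 0" if "\<bar>j\<bar> > int k * M" for j
    using that
  proof (induction k arbitrary: j)
    case 0
    then show ?case by (simp add: fourier_coeff_const)
  next
    case (Suc k)
    have "fourier_coeff (\<lambda>t. ?P t ^ k) i * fourier_coeff ?P (j - i) = 0" for i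
    proof (cases "\<bar>i\<bar> > int k * M")
      case False
      then have "\<not> \<bar>j - i\<bar> \<le> M" using Suc.prems by (simp add: algebra_simps)
      then show ?thesis by (auto simp: fourier_part(2)[OF u])
    qed (use Suc.IH in simp)
    then have "fourier_coeff (\<lambda>t. ?P t * ?P t ^ k) j = 0"
      by (intro has_sum_unique[OF wiener_mult(3)[OF fourier_part(1)[OF u] PW] has_sum_0])
    then show ?case by simp
  qed
  have B0: "B \<ge> 0" using B[of 1] norm_ge_zero[of "?P 1"] by (simp del: norm_ge_zero)
  have co: "norm (fourier_coeff (\<lambda>t. ?P t ^ k) j) \<le> B ^ k" for j
    by (rule norm_fourier_coeff_le[OF wiener_continuous[OF PW]]) (use B in \<open>simp add: norm_power power_mono\<close>)
  let ?I = "{- (int k * M)..int k * M}"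
  have "((\<lambda>j. w j * norm (fourier_coeff (\<lambda>t. ?P t ^ k) j)) has_sum (\<Sum>j\<in>?I. w j * norm (fourier_coeff (\<lambda>t. ?P t ^ k) j))) UNIV"
    by (rule has_sum_finite_neutralI) (auto simp: supp)
  then have "wnorm (\<lambda>t. ?P t ^ k) = (\<Sum>j\<in>?I. w j * norm (fourier_coeff (\<lambda>t. ?P t ^ k) j))"
    unfolding wnorm_def by (rule infsumI)
  also have "\<dots> \<le> (\<Sum>j\<in>?I. (1 + real k * M) * B ^ k)"
  proof (intro sum_mono mult_mono co)
    fix j assume j: "j \<in> ?I"
    then have "real_of_int \<bar>j\<bar> \<le> of_int (int k * M)" by (subst of_int_le_iff) auto
    then show "w j \<le> 1 + real k * M" using weight_le[of j] by simp
  qed (use M in auto)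
  also have "\<dots> = (2 * real k * M + 1) * ((1 + real k * M) * B ^ k)"
    using M by simp
  also have "\<dots> \<le> (2 * real k * M + 1) * ((2 * real k * M + 1) * B ^ k)"
    using M B0 by (intro mult_left_mono mult_right_mono) auto
  finally show ?thesis by (simp add: power2_eq_square mult_ac)
qed

lemma wiener_truncation:
  assumes u: "u \<in> W" and e: "e > 0"
  obtains M where "M \<ge> 0" "wnorm (fourier_part (- {- M..M}) u) \<le> e"
proof -
  let ?f = "\<lambda>k. w k * norm (fourier_coeff u k)"
  note s = wiener_weighted_summable[OF u]
  obtain F where F: "finite F" "dist (sum ?f F) (infsum ?f UNIV) \<le> e"
    using infsum_finite_approximation[OF s e] by auto
  define M where "M = (\<Sum>k\<in>F. \<bar>k\<bar>)"
  have M0: "M \<ge> 0" unfolding M_def by (intro sum_nonneg) auto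
  have FM: "F \<subseteq> {- M..M}"
  proof
    fix k assume "k \<in> F"
    then have "\<bar>k\<bar> \<le> M" unfolding M_def using F by (intro member_le_sum) auto
    then show "k \<in> {- M..M}" by auto
  qed
  have sub: "?f summable_on A" for A using s by (rule summable_on_subset) auto
  have "wnorm (fourier_part (- {- M..M}) u) = infsum ?f (- {- M..M})"
    unfolding wnorm_def by (rule infsum_cong_neutral) (auto simp: fourier_part(2)[OF u])
  also have "\<dots> \<le> infsum ?f (UNIV - F)"
    by (rule infsum_mono2) (use sub FM in auto)
  also have "\<dots> = infsum ?f UNIV - sum ?f F"
    using F s by (subst infsum_Diff) (auto simp: sub)
  also have "\<dots> \<le> e" using F by (simp add: dist_real_def abs_le_iff)
  finally show ?thesis using that M0 by blast
qed

lemma summable_quadratic_geometric: "summable (\<lambda>n. (2 * real n * C + 1)\<^sup>2 * (1/2) ^ n)"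
proof -
  have "(\<lambda>n. (real n + 1)\<^sup>2 * (1/2) ^ n) \<in> O(\<lambda>n. (3/4) ^ n)"
    by real_asymp
  then have s: "summable (\<lambda>n. (real n + 1)\<^sup>2 * (1/2) ^ n)"
    by (rule summable_comparison_test_bigo[rotated]) (simp add: summable_geometric)
  have "(2 * real n * C + 1)\<^sup>2 \<le> (2 * \<bar>C\<bar> + 1)\<^sup>2 * (real n + 1)\<^sup>2" for n
  proof -
    have "\<bar>2 * real n * C + 1\<bar> \<le> 2 * real n * \<bar>C\<bar> + 1"
      using abs_triangle_ineq[of "2 * real n * C" 1] by (simp add: abs_mult)
    also have "\<dots> \<le> (2 * \<bar>C\<bar> + 1) * (real n + 1)" by (simp add: algebra_simps)
    finally have "\<bar>2 * real n * C + 1\<bar>\<^sup>2 \<le> ((2 * \<bar>C\<bar> + 1) * (real n + 1))\<^sup>2" by (intro power_mono) auto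
    then show ?thesis by (simp add: power_mult_distrib)
  qed
  then have "norm ((2 * real n * C + 1)\<^sup>2 * (1/2) ^ n) \<le> (2 * \<bar>C\<bar> + 1)\<^sup>2 * ((real n + 1)\<^sup>2 * (1/2) ^ n)" for n
    by (simp add: mult_right_mono flip: mult.assoc)
  then show ?thesis by (intro summable_comparison_test'[OF summable_mult[OF s]])
qed

text \<open>
  The spectral radius in the algebra is governed by the supremum norm. Write \<open>u\<close> as a
  trigonometric polynomial \<open>P\<close> plus a remainder \<open>R\<close> of algebra norm at most \<open>1/6\<close>. Then \<open>|P| \<le> 1/3\<close>,
  and the binomial theorem bounds the norm of the \<open>n\<close>-th power by a polynomial in \<open>n\<close> times
  \<open>(1/3 + 1/6)\<^sup>n\<close>.
\<close>

lemma wiener_power_summable: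
  assumes u: "u \<in> W" and B: "\<And>t. t \<in> sphere 0 1 \<Longrightarrow> norm (u t) \<le> 1/6"
  shows "summable (\<lambda>n. wnorm (\<lambda>t. u t ^ n))"
proof -
  obtain M where M: "M \<ge> 0" "wnorm (fourier_part (- {- M..M}) u) \<le> 1/6"
    using wiener_truncation[OF u, of "1/6"] by auto
  let ?P = "fourier_part {- M..M} u" and ?R = "fourier_part (- {- M..M}) u"
  note PW = fourier_part(1)[OF u]
  have eq: "u t = ?P t + ?R t" if "t \<in> sphere 0 1" for t using fourier_part_add[OF u that, of "{-M..M}"] by simp
  have "norm (?P t) \<le> 1/3" if t: "t \<in> sphere 0 1" for t
  proof -
    have "?P t = u t - ?R t" using eq[OF t] by simp
    then have "norm (?P t) \<le> norm (u t) + norm (?R t)" using norm_triangle_ineq4[of "u t" "?R t"] by simp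
    then show ?thesis using B[OF t] M(2) norm_le_wnorm[OF PW t, of "- {- M..M}"] by linarith
  qed
  note Pp = fourier_part_interval_power[OF u this M(1)]
  have "wnorm (\<lambda>t. u t ^ n) \<le> (2 * real n * M + 1)\<^sup>2 * (1/2) ^ n" for n
  proof -
    have t1: "(\<lambda>t. of_nat (n choose k) * (?P t ^ k * ?R t ^ (n - k))) \<in> W" for k
      using wiener_power[OF PW] by (intro wiener_cmult wiener_mult(1)) auto
    have t2: "wnorm (\<lambda>t. of_nat (n choose k) * (?P t ^ k * ?R t ^ (n - k))) \<le> of_nat (n choose k) * ((2 * real n * M + 1)\<^sup>2 * (1/3) ^ k * (1/6) ^ (n - k))" if "k \<le> n" for k
    proof -
      have "wnorm (\<lambda>t. of_nat (n choose k) * (?P t ^ k * ?R t ^ (n - k))) \<le> norm (of_nat (n choose k) :: complex) * wnorm (\<lambda>t. ?P t ^ k * ?R t ^ (n - k))"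
        using wiener_power[OF PW] by (intro wnorm_cmult wiener_mult(1)) auto
      also have "\<dots> \<le> norm (of_nat (n choose k) :: complex) * (wnorm (\<lambda>t. ?P t ^ k) * wnorm (\<lambda>t. ?R t ^ (n - k)))"
        using wiener_power[OF PW] by (intro mult_left_mono wiener_mult(2)) auto
      also have "\<dots> \<le> norm (of_nat (n choose k) :: complex) * (((2 * real k * M + 1)\<^sup>2 * (1/3) ^ k) * (1/6) ^ (n - k))"
      proof (intro mult_left_mono mult_mono Pp)
        have "wnorm (\<lambda>t. ?R t ^ (n - k)) \<le> wnorm ?R ^ (n - k)" using wiener_power[OF PW] by auto
        also have "\<dots> \<le> (1/6) ^ (n - k)" by (intro power_mono M wnorm_nonneg)
        finally show "wnorm (\<lambda>t. ?R t ^ (n - k)) \<le> (1/6) ^ (n - k)" .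
      qed (auto simp: wnorm_nonneg)
      also have "\<dots> \<le> norm (of_nat (n choose k) :: complex) * (((2 * real n * M + 1)\<^sup>2 * (1/3) ^ k) * (1/6) ^ (n - k))"
        using that M(1) by (intro mult_left_mono mult_right_mono power_mono add_mono) (auto intro!: mult_right_mono)
      finally show ?thesis by (simp add: mult_ac)
    qed
    have "wnorm (\<lambda>t. u t ^ n) = wnorm (\<lambda>t. \<Sum>k\<le>n. of_nat (n choose k) * (?P t ^ k * ?R t ^ (n - k)))"
      unfolding wnorm_def
      by (intro infsum_cong arg_cong2[of _ _ _ _ "(*)"] arg_cong[of _ _ norm] refl fourier_coeff_cong)
         (simp add: eq binomial_ring mult.assoc)
    also have "\<dots> \<le> (\<Sum>k\<le>n. wnorm (\<lambda>t. of_nat (n choose k) * (?P t ^ k * ?R t ^ (n - k))))"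
      by (rule wnorm_sum) (rule t1)
    also have "\<dots> \<le> (\<Sum>k\<le>n. of_nat (n choose k) * ((2 * real n * M + 1)\<^sup>2 * (1/3) ^ k * (1/6) ^ (n - k)))"
      by (intro sum_mono t2) auto
    also have "\<dots> = (2 * real n * M + 1)\<^sup>2 * (\<Sum>k\<le>n. of_nat (n choose k) * (1/3) ^ k * (1/6) ^ (n - k))"
      by (simp add: sum_distrib_left mult_ac)
    also have "(\<Sum>k\<le>n. of_nat (n choose k) * (1/3) ^ k * (1/6) ^ (n - k)) = (1/3 + 1/6 :: real) ^ n"
      by (rule binomial_ring[symmetric])
    finally show ?thesis by simp
  qed
  then show ?thesis
    by (intro summable_comparison_test'[OF summable_quadratic_geometric[of M]]) (auto simp: wnorm_nonneg)
qed

lemma wiener_Ln_small: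
  assumes u: "u \<in> W" and B: "\<And>t. t \<in> sphere 0 1 \<Longrightarrow> norm (u t) \<le> 1/6"
  shows "(\<lambda>t. Ln (1 + u t)) \<in> W"
proof -
  let ?f = "\<lambda>n t. ((-1) ^ Suc n / of_nat n) * u t ^ n"
  note p = wiener_power[OF u]
  have f: "?f n \<in> W" for n using p by (intro wiener_cmult) auto
  have "wnorm (?f n) \<le> wnorm (\<lambda>t. u t ^ n)" for n
  proof -
    have "wnorm (?f n) \<le> norm ((-1) ^ Suc n / of_nat n :: complex) * wnorm (\<lambda>t. u t ^ n)"
      using p by (intro wnorm_cmult) auto
    also have "\<dots> \<le> 1 * wnorm (\<lambda>t. u t ^ n)"
      by (intro mult_right_mono wnorm_nonneg) (simp add: norm_divide norm_power divide_le_eq Suc_leI)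
    finally show ?thesis by simp
  qed
  then have s: "summable (\<lambda>n. wnorm (?f n))"
    by (intro summable_comparison_test'[OF wiener_power_summable[OF u B]]) (auto simp: wnorm_nonneg)
  have "Ln (1 + u t) = (\<Sum>n. ?f n t)" if "t \<in> sphere 0 1" for t
    using Ln_series[of "u t"] B[OF that] by (simp add: sums_iff)
  then show ?thesis by (rule wiener_transfer[OF wiener_suminf(1)[OF f s]])
qed

text \<open>
  Approximate \<open>lg\<close> uniformly by a polynomial \<open>l\<close>. Then \<open>exp (lg - l)\<close> belongs to the algebra and is
  uniformly close to \<open>1\<close>, so its principal logarithm \<open>lg - l\<close> is given by the logarithmic
  series.
\<close>

lemma wiener_log:
  assumes lg: "continuous_on (sphere 0 1) lg" and e: "(\<lambda>t. exp (lg t)) \<in> W"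
  shows "lg \<in> W"
proof -
  have "isCont (\<lambda>z::complex. exp z) 0" by (intro continuous_intros)
  then have "\<exists>d>0. \<forall>z::complex. dist z 0 < d \<longrightarrow> dist (exp z) (exp 0) < 1/6"
    unfolding continuous_at_eps_delta by (metis zero_less_divide_1_iff zero_less_numeral)
  then obtain d where d: "d > 0" "\<And>z. norm z < d \<Longrightarrow> norm (exp z - 1 :: complex) < 1/6"
    by (auto simp: dist_norm)
  obtain l where l: "polynomial_function l" "\<And>t. t \<in> sphere 0 1 \<Longrightarrow> norm (lg t - l t) < min d 1"
    using Stone_Weierstrass_polynomial_function[OF compact_sphere lg, of "min d 1"] d by auto
  note lW = wiener_polynomial[OF l(1)]
  \<comment> \<open>Written as a product to see that \<open>u\<close> is in the algebra before \<open>lg\<close> is known to be.\<close>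
  define u where "u = (\<lambda>t. exp (lg t) * exp (- l t) - 1)"
  have u: "u \<in> W" unfolding u_def by (intro wiener_diff wiener_mult(1) wiener_const e wiener_exp wiener_minus lW)
  have ue: "u t = exp (lg t - l t) - 1" for t by (simp add: u_def exp_diff exp_minus field_simps)
  have "norm (u t) \<le> 1/6" if "t \<in> sphere 0 1" for t
    unfolding ue using d(2)[of "lg t - l t"] l(2)[OF that] by simp
  then have "(\<lambda>t. l t + Ln (1 + u t)) \<in> W" by (intro wiener_add lW wiener_Ln_small u)
  moreover have "lg t = l t + Ln (1 + u t)" if "t \<in> sphere 0 1" for t
  proof -
    have "\<bar>Im (lg t - l t)\<bar> < 1" using l(2)[OF that] abs_Im_le_cmod[of "lg t - l t"] by simp
    then have "Ln (exp (lg t - l t)) = lg t - l t" using pi_gt3 by (intro Ln_exp) linarith+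
    then show ?thesis by (simp add: ue)
  qed
  ultimately show ?thesis by (rule wiener_transfer)
qed

lemma wiener_inverse_right_half_plane:
  assumes g: "g \<in> W" and re: "\<And>t. t \<in> sphere 0 1 \<Longrightarrow> Re (g t) > 0"
  shows "(\<lambda>t. 1 / g t) \<in> W"
proof -
  have ne: "g t \<noteq> 0" if "t \<in> sphere 0 1" for t using re[OF that] by auto
  have "continuous_on (sphere 0 1) (\<lambda>t. Ln (g t))"
  proof (rule continuous_on_Ln'[OF wiener_continuous[OF g]])
    fix t :: complex assume "t \<in> sphere 0 1"
    then show "g t \<notin> \<real>\<^sub>\<le>\<^sub>0" using re[of t] by (auto simp: complex_nonpos_Reals_iff)
  qed
  then have "(\<lambda>t. Ln (g t)) \<in> W"
    by (rule wiener_log) (rule wiener_transfer[OF g], use ne in auto)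
  then have "(\<lambda>t. exp (- Ln (g t))) \<in> W" by (intro wiener_exp wiener_minus)
  moreover have "1 / g t = exp (- Ln (g t))" if "t \<in> sphere 0 1" for t
    using ne[OF that] by (simp add: exp_minus divide_inverse)
  ultimately show ?thesis by (rule wiener_transfer)
qed

lemma compact_pos_lower_bound:
  fixes f :: "'a::topological_space \<Rightarrow> real"
  assumes "compact S" "continuous_on S f" "\<And>x. x \<in> S \<Longrightarrow> f x > 0"
  obtains d where "d > 0" "\<And>x. x \<in> S \<Longrightarrow> d \<le> f x"
proof (cases "S = {}")
  case False
  then show ?thesis using continuous_attains_inf[OF assms(1) _ assms(2)] assms(3) that by blast
qed (use that[of 1] in auto)

text \<open>
  Wiener's lemma. Unlike \<open>f\<close> in general, the product of \<open>f\<close> with an approximation of its conjugate has a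
  logarithm, since it takes values in the right half-plane. The conjugate itself need not belong to
  the algebra, because the two exponents may differ.
\<close>

lemma wiener_inverse:
  assumes f: "f \<in> W" and ne: "\<And>t. t \<in> sphere 0 1 \<Longrightarrow> f t \<noteq> 0"
  shows "(\<lambda>t. 1 / f t) \<in> W"
proof -
  note cf = wiener_continuous[OF f]
  obtain d where d: "d > 0" "\<And>t. t \<in> sphere 0 1 \<Longrightarrow> d \<le> norm (f t)"
    by (rule compact_pos_lower_bound[of "sphere 0 1" "\<lambda>t. norm (f t)"]) (use ne in \<open>auto intro!: continuous_intros cf\<close>)
  have "continuous_on (sphere 0 1) (\<lambda>t. cnj (f t))" by (intro continuous_intros cf)
  from Stone_Weierstrass_polynomial_function[OF compact_sphere this d(1)]
  obtain q where q: "polynomial_function q" "\<And>t. t \<in> sphere 0 1 \<Longrightarrow> norm (cnj (f t) - q t) < d" by auto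
  note qW = wiener_polynomial[OF q(1)]
  have re: "Re (f t * q t) > 0" if t: "t \<in> sphere 0 1" for t
  proof -
    have "f t * q t = f t * cnj (f t) - f t * (cnj (f t) - q t)" by (simp add: algebra_simps)
    then have "Re (f t * q t) = (norm (f t))\<^sup>2 - Re (f t * (cnj (f t) - q t))"
      by (simp flip: complex_norm_square)
    moreover have "Re (f t * (cnj (f t) - q t)) \<le> norm (f t) * norm (cnj (f t) - q t)"
      using complex_Re_le_cmod[of "f t * (cnj (f t) - q t)"] by (simp add: norm_mult)
    moreover have "norm (f t) * norm (cnj (f t) - q t) < norm (f t) * norm (f t)"
      using q(2)[OF t] d(2)[OF t] d(1) by (intro mult_strict_left_mono) auto
    ultimately show ?thesis by (simp add: power2_eq_square)
  qed
  have "(\<lambda>t. q t * (1 / (f t * q t))) \<in> W"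
    by (rule wiener_mult(1)[OF qW wiener_inverse_right_half_plane[OF wiener_mult(1)[OF f qW] re]])
  moreover have "1 / f t = q t * (1 / (f t * q t))" if "t \<in> sphere 0 1" for t
    using re[OF that] by (auto simp: divide_simps)
  ultimately show ?thesis by (rule wiener_transfer)
qed

end

section \<open>Determinants of small perturbations\<close>

text \<open>
  Expanding the product of \<open>y = x + (y - x)\<close>, every term other than the product of the \<open>x i\<close> is
  dominated by the corresponding term of the right-hand side.
\<close>

lemma norm_prod_diff_le:
  fixes x y :: "'a \<Rightarrow> complex" and c d :: "'a \<Rightarrow> real"
  assumes "finite S" "\<And>i. i \<in> S \<Longrightarrow> norm (x i) \<le> c i" "\<And>i. i \<in> S \<Longrightarrow> norm (y i - x i) \<le> d i"
  shows "norm ((\<Prod>i\<in>S. y i) - (\<Prod>i\<in>S. x i)) \<le> (\<Prod>i\<in>S. c i + d i) - (\<Prod>i\<in>S. c i)"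
  using assms
proof (induction S rule: finite_induct)
  case (insert j S)
  let ?X = "\<Prod>i\<in>S. x i" and ?Y = "\<Prod>i\<in>S. y i" and ?C = "\<Prod>i\<in>S. c i" and ?D = "\<Prod>i\<in>S. c i + d i"
  have IH: "norm (?Y - ?X) \<le> ?D - ?C" using insert by auto
  have cd: "norm (y i) \<le> c i + d i" if "i \<in> S" for i
    using insert.prems(1)[of i] insert.prems(2)[of i] that norm_triangle_ineq[of "x i" "y i - x i"] by auto
  have Y: "norm ?Y \<le> ?D" unfolding prod_norm[symmetric] by (intro prod_mono) (use cd in auto)
  have cj: "norm (x j) \<le> c j" "norm (y j - x j) \<le> d j" using insert.prems by auto
  have "norm (y j * ?Y - x j * ?X) = norm ((y j - x j) * ?Y + x j * (?Y - ?X))" by (simp add: algebra_simps)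
  also have "\<dots> \<le> norm (y j - x j) * norm ?Y + norm (x j) * norm (?Y - ?X)"
    by (metis norm_mult norm_triangle_ineq)
  also have "\<dots> \<le> d j * ?D + c j * (?D - ?C)"
    using cj norm_ge_zero[of "x j"] norm_ge_zero[of "y j - x j"] 
    by (intro add_mono mult_mono Y IH) (auto intro: order_trans[OF norm_ge_zero])
  finally show ?case using insert by (simp add: algebra_simps)
qed simp

lemma prod_add_minus_prod_le:
  fixes c d :: "'a \<Rightarrow> real"
  assumes "finite S" "\<And>i. i \<in> S \<Longrightarrow> c i \<ge> 1" "\<And>i. i \<in> S \<Longrightarrow> d i \<ge> 0"
  shows "(\<Prod>i\<in>S. c i + d i) - (\<Prod>i\<in>S. c i) \<le> (\<Sum>i\<in>S. d i) * (\<Prod>i\<in>S. c i + d i)"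
  using assms
proof (induction S rule: finite_induct)
  case (insert j S)
  let ?C = "\<Prod>i\<in>S. c i" and ?D = "\<Prod>i\<in>S. c i + d i" and ?s = "\<Sum>i\<in>S. d i"
  have IH: "?D - ?C \<le> ?s * ?D" using insert by auto
  have cj: "c j \<ge> 1" "d j \<ge> 0" using insert.prems by auto
  have s: "?s \<ge> 0" using insert.prems by (intro sum_nonneg) auto
  have D: "?D \<ge> 0" using insert.prems by (intro prod_nonneg) (metis add_nonneg_nonneg insertCI order.trans zero_le_one)
  have "(c j + d j) * ?D - c j * ?C = d j * ?D + c j * (?D - ?C)" by (simp add: algebra_simps)
  also have "\<dots> \<le> d j * ?D + c j * (?s * ?D)" using IH cj by (intro add_mono mult_left_mono) auto
  also have "\<dots> \<le> d j * ((c j + d j) * ?D) + (c j + d j) * (?s * ?D)"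
  proof (intro add_mono mult_left_mono mult_right_mono)
    show "?D \<le> (c j + d j) * ?D" using mult_right_mono[of 1 "c j + d j" ?D] cj D by simp
  qed (use cj s D in auto)
  finally show ?case using insert by (simp add: algebra_simps)
qed simp

text \<open>
  Summing over all maps instead of all permutations turns sums of products into products of row
  sums.
\<close>

lemma sum_prod_permutes_le:
  fixes h :: "(nat \<Rightarrow> nat) \<Rightarrow> real"
  assumes "finite S" "\<And>g. h g \<ge> 0" "\<And>g g'. (\<And>i. i \<in> S \<Longrightarrow> g i = g' i) \<Longrightarrow> h g = h g'"
  shows "(\<Sum>p | p permutes S. h p) \<le> (\<Sum>g\<in>PiE S (\<lambda>_. S). h g)"
proof -
  let ?r = "\<lambda>p. restrict p S"
  have inj: "inj_on ?r {p. p permutes S}"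
  proof (rule inj_onI)
    fix p q assume pq: "p \<in> {p. p permutes S}" "q \<in> {p. p permutes S}" "?r p = ?r q"
    show "p = q"
    proof
      fix i
      show "p i = q i"
      proof (cases "i \<in> S")
        case True
        have "?r p i = ?r q i" using pq(3) by simp
        then show ?thesis using True by (simp only: restrict_apply if_True)
      next
        case False
        then show ?thesis using pq by (simp add: permutes_def)
      qed
    qed
  qed
  have "(\<Sum>p | p permutes S. h p) = (\<Sum>p | p permutes S. h (?r p))"
    by (intro sum.cong refl assms(3)) auto
  also have "\<dots> = (\<Sum>g\<in>?r ` {p. p permutes S}. h g)"
    using sum.reindex[OF inj, of h] by simp
  also have "\<dots> \<le> (\<Sum>g\<in>PiE S (\<lambda>_. S). h g)"
    by (intro sum_mono2 finite_PiE assms) (auto simp: permutes_in_image)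
  finally show ?thesis .
qed

text \<open>
  Continuity of the determinant in the entrywise \<open>l\<^sup>1\<close> norm, with a bound that does not
  involve the size \<open>n\<close>. The Leibniz formula is dominated by the same sum over all maps, which is a
  product of row sums \<open>1 + \<dots>\<close>, and such products are at most the exponential of the total sum.
\<close>

lemma norm_det_diff_le:
  fixes A B :: "nat \<Rightarrow> nat \<Rightarrow> complex"
  shows "norm (Determinant.det (mat n n (\<lambda>(i, j). (if i = j then 1 else 0) + B i j)) -
      Determinant.det (mat n n (\<lambda>(i, j). (if i = j then 1 else 0) + A i j)))
    \<le> (\<Sum>i<n. \<Sum>j<n. norm (B i j - A i j)) *
       exp ((\<Sum>i<n. \<Sum>j<n. norm (A i j)) + (\<Sum>i<n. \<Sum>j<n. norm (B i j - A i j)))"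
proof -
  let ?\<delta> = "\<lambda>i j. if i = j then 1 else 0"
  let ?x = "\<lambda>i j. ?\<delta> i j + A i j" and ?y = "\<lambda>i j. ?\<delta> i j + B i j"
  define c where "c = (\<lambda>i j. ?\<delta> i j + norm (A i j))"
  define d where "d = (\<lambda>i j. norm (B i j - A i j))"
  let ?S = "{0..<n}"
  have c: "norm (?x i j) \<le> c i j" for i j unfolding c_def by (auto intro: order_trans[OF norm_triangle_ineq])
  have c0: "c i j \<ge> 0" and d0: "d i j \<ge> 0" for i j by (auto simp: c_def d_def)
  have d: "norm (?y i j - ?x i j) \<le> d i j" for i j unfolding d_def by simp
  have det: "Determinant.det (mat n n (\<lambda>(i, j). Z i j)) = (\<Sum>p | p permutes ?S. signof p * (\<Prod>i\<in>?S. Z i (p i)))" for Z :: "nat \<Rightarrow> nat \<Rightarrow> complex"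
    by (subst det_def'[of _ n]) (auto intro!: sum.cong prod.cong arg_cong2[of _ _ _ _ "(*)"] simp: permutes_in_image atLeast0LessThan)
  let ?h = "\<lambda>p. (\<Prod>i\<in>?S. c i (p i) + d i (p i)) - (\<Prod>i\<in>?S. c i (p i))"
  have "norm (Determinant.det (mat n n (\<lambda>(i, j). ?y i j)) - Determinant.det (mat n n (\<lambda>(i, j). ?x i j)))
     = norm (\<Sum>p | p permutes ?S. signof p * ((\<Prod>i\<in>?S. ?y i (p i)) - (\<Prod>i\<in>?S. ?x i (p i))))"
    unfolding det sum_subtractf[symmetric] by (simp add: right_diff_distrib)
  also have "\<dots> \<le> (\<Sum>p | p permutes ?S. ?h p)"
  proof (rule sum_norm_le)
    fix p
    have "norm (signof p :: complex) = 1" by (simp add: sign_def)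
    then show "norm (signof p * ((\<Prod>i\<in>?S. ?y i (p i)) - (\<Prod>i\<in>?S. ?x i (p i)))) \<le> ?h p"
      using norm_prod_diff_le[of ?S "\<lambda>i. ?x i (p i)" "\<lambda>i. c i (p i)" "\<lambda>i. ?y i (p i)" "\<lambda>i. d i (p i)"] c d
      by (simp add: norm_mult)
  qed
  also have "\<dots> \<le> (\<Sum>g\<in>PiE ?S (\<lambda>_. ?S). ?h g)"
  proof (rule sum_prod_permutes_le)
    show "0 \<le> ?h g" for g using prod_mono[of ?S "\<lambda>i. c i (g i)" "\<lambda>i. c i (g i) + d i (g i)"] c0 d0 by auto
  qed auto
  also have "\<dots> = (\<Prod>i\<in>?S. \<Sum>j\<in>?S. c i j + d i j) - (\<Prod>i\<in>?S. \<Sum>j\<in>?S. c i j)"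
    by (simp add: sum_subtractf prod_sum_PiE)
  also have "\<dots> = (\<Prod>i\<in>?S. (\<Sum>j\<in>?S. c i j) + (\<Sum>j\<in>?S. d i j)) - (\<Prod>i\<in>?S. \<Sum>j\<in>?S. c i j)"
    by (simp add: sum.distrib)
  also have "\<dots> \<le> (\<Sum>i\<in>?S. \<Sum>j\<in>?S. d i j) * (\<Prod>i\<in>?S. (\<Sum>j\<in>?S. c i j) + (\<Sum>j\<in>?S. d i j))"
  proof (rule prod_add_minus_prod_le)
    fix i assume i: "i \<in> ?S"
    have "c i i \<le> (\<Sum>j\<in>?S. c i j)" using i c0 by (intro member_le_sum) auto
    then show "1 \<le> (\<Sum>j\<in>?S. c i j)" by (simp add: c_def)  (smt (verit) norm_ge_zero)
  qed (auto intro: sum_nonneg d0)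
  also have "\<dots> \<le> (\<Sum>i\<in>?S. \<Sum>j\<in>?S. d i j) * exp ((\<Sum>i\<in>?S. \<Sum>j\<in>?S. norm (A i j)) + (\<Sum>i\<in>?S. \<Sum>j\<in>?S. d i j))"
  proof (rule mult_left_mono)
    have "(\<Prod>i\<in>?S. (\<Sum>j\<in>?S. c i j) + (\<Sum>j\<in>?S. d i j)) \<le> (\<Prod>i\<in>?S. exp ((\<Sum>j\<in>?S. norm (A i j)) + (\<Sum>j\<in>?S. d i j)))"
    proof (rule prod_mono)
      fix i assume i: "i \<in> ?S"
      have "(\<Sum>j\<in>?S. c i j) = 1 + (\<Sum>j\<in>?S. norm (A i j))"
        using i by (simp add: c_def sum.distrib)
      then show "0 \<le> (\<Sum>j\<in>?S. c i j) + (\<Sum>j\<in>?S. d i j) \<and> (\<Sum>j\<in>?S. c i j) + (\<Sum>j\<in>?S. d i j) \<le> exp ((\<Sum>j\<in>?S. norm (A i j)) + (\<Sum>j\<in>?S. d i j))"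
        using exp_ge_add_one_self[of "(\<Sum>j\<in>?S. norm (A i j)) + (\<Sum>j\<in>?S. d i j)"]
        by (auto simp: add.assoc intro!: add_nonneg_nonneg sum_nonneg d0)
    qed
    also have "\<dots> = exp ((\<Sum>i\<in>?S. \<Sum>j\<in>?S. norm (A i j)) + (\<Sum>i\<in>?S. \<Sum>j\<in>?S. d i j))"
      by (simp add: sum.distrib flip: exp_sum)
    finally show "(\<Prod>i\<in>?S. (\<Sum>j\<in>?S. c i j) + (\<Sum>j\<in>?S. d i j)) \<le> exp ((\<Sum>i\<in>?S. \<Sum>j\<in>?S. norm (A i j)) + (\<Sum>i\<in>?S. \<Sum>j\<in>?S. d i j))" .
  qed (auto intro!: sum_nonneg d0)
  finally show ?thesis by (simp add: d_def atLeast0LessThan)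
qed

text \<open>
  The section with rows and columns \<open>s, \<dots>, t - 1\<close>; it is the empty matrix if \<open>t \<le> s\<close>.
\<close>

definition finsec :: "int \<Rightarrow> int \<Rightarrow> (int \<Rightarrow> int \<Rightarrow> complex) \<Rightarrow> complex mat" where
  "finsec s t K = mat (nat (t - s)) (nat (t - s)) (\<lambda>(i, j). K (s + int i) (s + int j))"

definition kronecker :: "int \<Rightarrow> int \<Rightarrow> complex" where
  "kronecker i j = (if i = j then 1 else 0)"

lemma finsec_carrier [simp]: "finsec s t K \<in> carrier_mat (nat (t - s)) (nat (t - s))"
  by (simp add: finsec_def)

lemma finsec_cong:
  assumes "\<And>i j. s \<le> i \<Longrightarrow> i < t \<Longrightarrow> s \<le> j \<Longrightarrow> j < t \<Longrightarrow> K i j = K' i j"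
  shows "finsec s t K = finsec s t K'"
  unfolding finsec_def using assms by (intro cong_mat) auto

lemma finsec_shift: "finsec s t (\<lambda>i j. K (i - c) (j - c)) = finsec (s - c) (t - c) K"
  unfolding finsec_def by (intro cong_mat) (auto simp: algebra_simps)

lemma sum_nat_interval_int:
  fixes f :: "int \<Rightarrow> 'a::comm_monoid_add"
  shows "(\<Sum>i<nat (t - s). f (s + int i)) = (\<Sum>k\<in>{s..<t}. f k)"
  by (rule sum.reindex_bij_witness[of _ "\<lambda>k. nat (k - s)" "\<lambda>i. s + int i"]) auto

lemma prod_nat_interval_int:
  fixes f :: "int \<Rightarrow> 'a::comm_monoid_mult"
  shows "(\<Prod>i<nat (t - s). f (s + int i)) = (\<Prod>k\<in>{s..<t}. f k)"
  by (rule prod.reindex_bij_witness[of _ "\<lambda>k. nat (k - s)" "\<lambda>i. s + int i"]) auto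

lemma finsec_mult: "finsec s t K * finsec s t K' = finsec s t (\<lambda>i j. \<Sum>k\<in>{s..<t}. K i k * K' k j)"
  by (rule eq_matI) (auto simp: finsec_def scalar_prod_def atLeast0LessThan sum_nat_interval_int[where f = "\<lambda>k. K _ k * K' k _"])

lemma det_finsec_mult:
  "Determinant.det (finsec s t (\<lambda>i j. \<Sum>k\<in>{s..<t}. K i k * K' k j)) = Determinant.det (finsec s t K) * Determinant.det (finsec s t K')"
  unfolding finsec_mult[symmetric] by (rule det_mult[OF finsec_carrier finsec_carrier])

lemma det_finsec_lower_triangular:
  assumes "\<And>i j. i < j \<Longrightarrow> K i j = 0"
  shows "Determinant.det (finsec s t K) = (\<Prod>k\<in>{s..<t}. K k k)"
proof -
  have "Determinant.det (finsec s t K) = prod_list (diag_mat (finsec s t K))"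
    by (rule det_lower_triangular[of "nat (t - s)"]) (auto simp: finsec_def assms)
  also have "\<dots> = (\<Prod>i<nat (t - s). K (s + int i) (s + int i))"
    unfolding prod_list_diag_prod by (auto simp: finsec_def atLeast0LessThan)
  finally show ?thesis unfolding prod_nat_interval_int[where f = "\<lambda>k. K k k"] .
qed

lemma det_finsec_upper_triangular:
  assumes "\<And>i j. j < i \<Longrightarrow> K i j = 0"
  shows "Determinant.det (finsec s t K) = (\<Prod>k\<in>{s..<t}. K k k)"
proof -
  have "Determinant.det (finsec s t K) = prod_list (diag_mat (finsec s t K))"
    by (rule det_upper_triangular[of _ "nat (t - s)"]) (auto simp: finsec_def assms upper_triangular_def)
  also have "\<dots> = (\<Prod>i<nat (t - s). K (s + int i) (s + int i))"
    unfolding prod_list_diag_prod by (auto simp: finsec_def atLeast0LessThan)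
  finally show ?thesis unfolding prod_nat_interval_int[where f = "\<lambda>k. K k k"] .
qed

abbreviation box_norm :: "int \<Rightarrow> int \<Rightarrow> (int \<Rightarrow> int \<Rightarrow> complex) \<Rightarrow> real" where
  "box_norm s t K \<equiv> (\<Sum>i\<in>{s..<t}. \<Sum>j\<in>{s..<t}. norm (K i j))"

lemma box_norm_nonneg: "box_norm s t K \<ge> 0"
  by (intro sum_nonneg) auto

lemma norm_det_finsec_diff_le:
  "norm (Determinant.det (finsec s t (\<lambda>i j. kronecker i j + B i j)) - Determinant.det (finsec s t (\<lambda>i j. kronecker i j + A i j)))
    \<le> box_norm s t (\<lambda>i j. B i j - A i j) * exp (box_norm s t A + box_norm s t (\<lambda>i j. B i j - A i j))"
proof -
  have *: "(\<Sum>i<nat (t - s). \<Sum>j<nat (t - s). norm (Z (s + int i) (s + int j))) = box_norm s t Z" for Z :: "int \<Rightarrow> int \<Rightarrow> complex"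
    unfolding sum_nat_interval_int[where f = "\<lambda>k. norm (Z _ k)"]
      sum_nat_interval_int[where f = "\<lambda>i. \<Sum>j\<in>{s..<t}. norm (Z i j)"] ..
  show ?thesis
    using norm_det_diff_le[of "nat (t - s)" "\<lambda>i j. B (s + int i) (s + int j)" "\<lambda>i j. A (s + int i) (s + int j)"]
    unfolding * *[of "\<lambda>i j. B i j - A i j"] finsec_def kronecker_def by simp
qed

lemma det_finsec_extend_right:
  assumes "s \<le> t" "t \<le> t'"
  shows "Determinant.det (finsec s t' (\<lambda>i j. kronecker i j + (if i < t \<and> j < t then K i j else 0))) =
    Determinant.det (finsec s t (\<lambda>i j. kronecker i j + K i j))"
proof -
  let ?n = "nat (t - s)" and ?m = "nat (t' - t)"
  have nm: "nat (t' - s) = ?n + ?m" using assms by simp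
  have "finsec s t' (\<lambda>i j. kronecker i j + (if i < t \<and> j < t then K i j else 0)) =
    four_block_mat (finsec s t (\<lambda>i j. kronecker i j + K i j)) (0\<^sub>m ?n ?m) (0\<^sub>m ?m ?n) (1\<^sub>m ?m)"
    by (rule eq_matI) (use assms in \<open>auto simp: finsec_def kronecker_def nm\<close>, linarith?)
  then show ?thesis
    using det_four_block_mat_lower_left_zero[of "finsec s t (\<lambda>i j. kronecker i j + K i j)" ?n "0\<^sub>m ?n ?m" ?m "0\<^sub>m ?m ?n" "1\<^sub>m ?m"] by simp
qed

lemma det_finsec_extend_left:
  assumes "s' \<le> s" "s \<le> t"
  shows "Determinant.det (finsec s' t (\<lambda>i j. kronecker i j + (if s \<le> i \<and> s \<le> j then K i j else 0))) =
    Determinant.det (finsec s t (\<lambda>i j. kronecker i j + K i j))"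
proof -
  let ?n = "nat (s - s')" and ?m = "nat (t - s)"
  have nm: "nat (t - s') = ?n + ?m" using assms by simp
  have "finsec s' t (\<lambda>i j. kronecker i j + (if s \<le> i \<and> s \<le> j then K i j else 0)) =
    four_block_mat (1\<^sub>m ?n) (0\<^sub>m ?n ?m) (0\<^sub>m ?m ?n) (finsec s t (\<lambda>i j. kronecker i j + K i j))"
    by (rule eq_matI) (use assms in \<open>auto simp: finsec_def kronecker_def nm add.commute\<close>)
  then show ?thesis
    using det_four_block_mat_lower_left_zero[of "1\<^sub>m ?n" ?n "0\<^sub>m ?n ?m" ?m "0\<^sub>m ?m ?n" "finsec s t (\<lambda>i j. kronecker i j + K i j)"] by simp
qed

section \<open>Determinants along growing intervals\<close>

definition l1_kernel :: "(int \<Rightarrow> int \<Rightarrow> complex) \<Rightarrow> bool" where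
  "l1_kernel K \<longleftrightarrow> (\<lambda>(i, j). norm (K i j)) summable_on UNIV"

definition l1_norm :: "(int \<Rightarrow> int \<Rightarrow> complex) \<Rightarrow> real" where
  "l1_norm K = (\<Sum>\<^sub>\<infinity>(i, j). norm (K i j))"

lemma finite_sum_le_l1_norm:
  assumes "l1_kernel K" "finite X"
  shows "(\<Sum>(i, j)\<in>X. norm (K i j)) \<le> l1_norm K"
  unfolding l1_norm_def by (rule finite_sum_le_infsum) (use assms in \<open>auto simp: l1_kernel_def\<close>)

lemma box_norm_le_l1_norm:
  assumes "l1_kernel K"
  shows "box_norm s t K \<le> l1_norm K"
  using finite_sum_le_l1_norm[OF assms, of "{s..<t} \<times> {s..<t}"] by (simp add: sum.cartesian_product)

lemma l1_norm_nonneg: "l1_norm K \<ge> 0"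
  unfolding l1_norm_def by (rule infsum_nonneg) auto

text \<open>
  The sum is taken over finite sets so that it can be compared directly with the norm of a finite
  section.
\<close>

lemma l1_kernel_tail:
  assumes K: "l1_kernel K" and e: "e > 0"
  obtains R where "R \<ge> 0" "\<And>X. finite X \<Longrightarrow> (\<And>i j. (i, j) \<in> X \<Longrightarrow> \<bar>i\<bar> \<ge> R \<or> \<bar>j\<bar> \<ge> R) \<Longrightarrow> (\<Sum>(i, j)\<in>X. norm (K i j)) \<le> e"
proof -
  let ?f = "\<lambda>(i, j). norm (K i j)"
  have s: "?f summable_on UNIV" using K by (simp add: l1_kernel_def)
  obtain F where F: "finite F" "dist (sum ?f F) (infsum ?f UNIV) \<le> e"
    using infsum_finite_approximation[OF s e] by auto
  define R where "R = (\<Sum>(i, j)\<in>F. \<bar>i\<bar> + \<bar>j\<bar>) + 1"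
  have R: "\<bar>i\<bar> < R \<and> \<bar>j\<bar> < R" if "(i, j) \<in> F" for i j
  proof -
    have "(case (i, j) of (i, j) \<Rightarrow> \<bar>i\<bar> + \<bar>j\<bar>) \<le> (\<Sum>(i, j)\<in>F. \<bar>i\<bar> + \<bar>j\<bar>)"
      by (rule member_le_sum[OF that]) (use F in auto)
    then show ?thesis unfolding R_def by auto
  qed
  show ?thesis
  proof
    show "R \<ge> 0" unfolding R_def by (intro add_nonneg_nonneg sum_nonneg) auto
    fix X :: "(int \<times> int) set" assume X: "finite X" "\<And>i j. (i, j) \<in> X \<Longrightarrow> \<bar>i\<bar> \<ge> R \<or> \<bar>j\<bar> \<ge> R"
    then have "X \<inter> F = {}" using R by fastforce
    then have "sum ?f X + sum ?f F = sum ?f (X \<union> F)" using X F by (simp add: sum.union_disjoint)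
    also have "\<dots> \<le> infsum ?f UNIV" by (rule finite_sum_le_infsum) (use X F s in auto)
    finally show "sum ?f X \<le> e" using F by (simp add: dist_real_def abs_le_iff)
  qed
qed

abbreviation perturbed_det :: "(int \<Rightarrow> int \<Rightarrow> complex) \<Rightarrow> int \<Rightarrow> int \<Rightarrow> complex" where
  "perturbed_det K s t \<equiv> Determinant.det (finsec s t (\<lambda>i j. kronecker i j + K i j))"

text \<open>
  Extending a section far away from the origin changes the determinant by little. The smaller
  determinant equals that of the larger size with \<open>K\<close> set to zero outside the smaller square, and
  the entries that were removed have a small sum.
\<close>

lemma det_finsec_stable:
  assumes K: "l1_kernel K" and e: "e > 0"
  shows "\<exists>R. \<forall>s s' t t'. s' \<le> s \<and> s \<le> t \<and> t \<le> t' \<and> (\<forall>i\<in>{s'..<t'} - {s..<t}. \<bar>i\<bar> \<ge> R) \<longrightarrow>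
     norm (perturbed_det K s' t' - perturbed_det K s t) \<le> e"
proof -
  define e' where "e' = min 1 (e / exp (l1_norm K + 1))"
  have e': "e' > 0" using e by (auto simp: e'_def)
  obtain R where R: "R \<ge> 0" "\<And>X. finite X \<Longrightarrow> (\<And>i j. (i, j) \<in> X \<Longrightarrow> \<bar>i\<bar> \<ge> R \<or> \<bar>j\<bar> \<ge> R) \<Longrightarrow> (\<Sum>(i, j)\<in>X. norm (K i j)) \<le> e'"
    using l1_kernel_tail[OF K e'] by blast
  let ?D = "perturbed_det K"
  have "norm (?D s' t' - ?D s t) \<le> e"
    if st: "s' \<le> s" "s \<le> t" "t \<le> t'" and far: "\<forall>i\<in>{s'..<t'} - {s..<t}. \<bar>i\<bar> \<ge> R" for s s' t t'
  proof -
    let ?A = "\<lambda>i j. if i < t \<and> j < t then (if s \<le> i \<and> s \<le> j then K i j else 0) else 0"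
    let ?I = "{s'..<t'}"
    let ?X = "{x\<in>?I \<times> ?I. \<not> (s \<le> fst x \<and> fst x < t \<and> s \<le> snd x \<and> snd x < t)}"
    have "box_norm s' t' (\<lambda>i j. K i j - ?A i j) = (\<Sum>(i, j)\<in>?X. norm (K i j))"
      unfolding sum.cartesian_product by (rule sum.mono_neutral_cong_right) auto
    also have "\<dots> \<le> e'"
    proof (rule R(2))
      fix i j assume "(i, j) \<in> ?X"
      then show "\<bar>i\<bar> \<ge> R \<or> \<bar>j\<bar> \<ge> R" using far by fastforce
    qed auto
    finally have 1: "box_norm s' t' (\<lambda>i j. K i j - ?A i j) \<le> e'" .
    have 2: "box_norm s' t' ?A \<le> l1_norm K"
      by (rule order_trans[OF _ box_norm_le_l1_norm[OF K, of s' t']]) (intro sum_mono, auto)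
    have "?D s t = Determinant.det (finsec s' t' (\<lambda>i j. kronecker i j + ?A i j))"
      using st det_finsec_extend_right[of s' t t' "\<lambda>i j. if s \<le> i \<and> s \<le> j then K i j else 0"]
        det_finsec_extend_left[of s' s t K] by simp
    then have "norm (?D s' t' - ?D s t) \<le> box_norm s' t' (\<lambda>i j. K i j - ?A i j) * exp (box_norm s' t' ?A + box_norm s' t' (\<lambda>i j. K i j - ?A i j))"
      using norm_det_finsec_diff_le[of s' t' K ?A] by simp
    also have "\<dots> \<le> e' * exp (l1_norm K + 1)"
      using 1 2 e' by (intro mult_mono) (auto simp: box_norm_nonneg e'_def)
    also have "\<dots> \<le> e / exp (l1_norm K + 1) * exp (l1_norm K + 1)"
      by (rule mult_right_mono) (auto simp: e'_def)
    finally show ?thesis by simp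
  qed
  then show ?thesis by (intro exI[of _ R]) blast
qed

lemma det_right_limit:
  assumes K: "l1_kernel K"
  obtains L where "(perturbed_det K s \<longlongrightarrow> L) at_top"
proof -
  let ?D = "perturbed_det K s"
  have "Cauchy (\<lambda>n. ?D (int n))"
  proof (rule CauchyI')
    fix e :: real assume "e > 0"
    then have e2: "e / 2 > 0" by simp
    obtain R where R: "\<forall>s s' t t'. s' \<le> s \<and> s \<le> t \<and> t \<le> t' \<and> (\<forall>i\<in>{s'..<t'} - {s..<t}. \<bar>i\<bar> \<ge> R) \<longrightarrow>
        norm (perturbed_det K s' t' - perturbed_det K s t) \<le> e / 2"
      using det_finsec_stable[OF K e2] by blast
    have "dist (?D (int m)) (?D (int n)) < e" if "nat (max s R) \<le> m" "m < n" for m n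
    proof -
      have "s \<le> int m" "R \<le> int m" "int m \<le> int n" using that by auto
      then have "norm (?D (int n) - ?D (int m)) \<le> e / 2" by (intro R[rule_format]) auto
      then show ?thesis using \<open>e > 0\<close> unfolding dist_norm by (subst norm_minus_commute) linarith
    qed
    then show "\<exists>M. \<forall>m\<ge>M. \<forall>n>m. dist (?D (int m)) (?D (int n)) < e" by blast
  qed
  then obtain L where L: "(\<lambda>n. ?D (int n)) \<longlonglongrightarrow> L" using Cauchy_convergent convergent_def by blast
  have "filterlim nat sequentially at_top"
    unfolding filterlim_at_top eventually_at_top_linorder by (metis nat_mono nat_int)
  from filterlim_compose[OF L this] have "((\<lambda>t. ?D (int (nat t))) \<longlongrightarrow> L) at_top" .
  then have "(?D \<longlongrightarrow> L) at_top"
    by (rule Lim_transform_eventually) (auto intro!: eventually_at_top_linorderI[of 0])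
  then show ?thesis by (rule that)
qed

lemma det_left_limit:
  assumes K: "l1_kernel K"
  obtains L where "((\<lambda>s. perturbed_det K s t) \<longlongrightarrow> L) at_bot"
proof -
  let ?D = "\<lambda>s. perturbed_det K s t"
  have "Cauchy (\<lambda>n. ?D (- int n))"
  proof (rule CauchyI')
    fix e :: real assume "e > 0"
    then have e2: "e / 2 > 0" by simp
    obtain R where R: "\<forall>s s' t t'. s' \<le> s \<and> s \<le> t \<and> t \<le> t' \<and> (\<forall>i\<in>{s'..<t'} - {s..<t}. \<bar>i\<bar> \<ge> R) \<longrightarrow>
        norm (perturbed_det K s' t' - perturbed_det K s t) \<le> e / 2"
      using det_finsec_stable[OF K e2] by blast
    have "dist (?D (- int m)) (?D (- int n)) < e" if "nat (max (- t) R) \<le> m" "m < n" for m n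
    proof -
      have "- int m \<le> t" "R \<le> int m" "- int n \<le> - int m" using that by auto
      then have "norm (?D (- int n) - ?D (- int m)) \<le> e / 2" by (intro R[rule_format]) auto
      then show ?thesis using \<open>e > 0\<close> unfolding dist_norm by (subst norm_minus_commute) linarith
    qed
    then show "\<exists>M. \<forall>m\<ge>M. \<forall>n>m. dist (?D (- int m)) (?D (- int n)) < e" by blast
  qed
  then obtain L where L: "(\<lambda>n. ?D (- int n)) \<longlonglongrightarrow> L" using Cauchy_convergent convergent_def by blast
  have "filterlim (\<lambda>s. nat (- s)) sequentially at_bot"
    unfolding filterlim_at_top eventually_at_bot_linorder by (intro allI, rule_tac x = "- int Z" in exI) auto
  from filterlim_compose[OF L this] have "((\<lambda>s. ?D (- int (nat (- s)))) \<longlongrightarrow> L) at_bot" .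
  then have "(?D \<longlongrightarrow> L) at_bot"
    by (rule Lim_transform_eventually) (auto simp: eventually_at_bot_linorder intro!: exI[of _ 0])
  then show ?thesis by (rule that)
qed

lemma box_norm_shift: "box_norm s t (\<lambda>i j. K (i - c) (j - c)) = box_norm (s - c) (t - c) K"
proof -
  have sh: "(\<Sum>i\<in>{s..<t}. f (i - c)) = (\<Sum>i\<in>{s - c..<t - c}. f i)" for f :: "int \<Rightarrow> real"
    by (rule sum.reindex_bij_witness[of _ "\<lambda>i. i + c" "\<lambda>i. i - c"]) auto
  show ?thesis unfolding sh[of "\<lambda>j. norm (K _ j)"] sh[of "\<lambda>i. \<Sum>j\<in>{s - c..<t - c}. norm (K i j)"] ..
qed

lemma box_norm_add_le: "box_norm s t (\<lambda>i j. A i j + B i j) \<le> box_norm s t A + box_norm s t B"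
  unfolding sum.distrib[symmetric] by (intro sum_mono norm_triangle_ineq)

lemma box_norm_product_le:
  "box_norm s t (\<lambda>i j. \<Sum>k\<in>{s..<t}. A i k * B k j) \<le> (\<Sum>k\<in>{s..<t}. (\<Sum>i\<in>{s..<t}. norm (A i k)) * (\<Sum>j\<in>{s..<t}. norm (B k j)))"
proof -
  have "box_norm s t (\<lambda>i j. \<Sum>k\<in>{s..<t}. A i k * B k j) \<le> (\<Sum>i\<in>{s..<t}. \<Sum>j\<in>{s..<t}. \<Sum>k\<in>{s..<t}. norm (A i k) * norm (B k j))"
    by (intro sum_mono sum_norm_le) (simp add: norm_mult)
  also have "\<dots> = (\<Sum>i\<in>{s..<t}. \<Sum>k\<in>{s..<t}. \<Sum>j\<in>{s..<t}. norm (A i k) * norm (B k j))"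
    by (intro sum.cong refl sum.swap)
  also have "\<dots> = (\<Sum>k\<in>{s..<t}. \<Sum>i\<in>{s..<t}. \<Sum>j\<in>{s..<t}. norm (A i k) * norm (B k j))"
    by (rule sum.swap)
  finally show ?thesis by (simp add: sum_product)
qed

text \<open>
  The matrix \<open>M s t m\<close> lives on the interval \<open>[s, t + m N)\<close>. The left correction \<open>KL\<close> stays in place
  when the interval grows, whereas the right correction is a fixed kernel \<open>KR t\<close> moved to the
  right end.
\<close>

definition boundary_form :: "nat \<Rightarrow> (int \<Rightarrow> int \<Rightarrow> complex) \<Rightarrow> (int \<Rightarrow> int \<Rightarrow> nat \<Rightarrow> int \<Rightarrow> int \<Rightarrow> complex) \<Rightarrow> bool" where
  "boundary_form N B M \<longleftrightarrow> (\<exists>KL KR. (\<forall>s. l1_kernel (KL s)) \<and> (\<forall>t. l1_kernel (KR t)) \<and>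
     (\<forall>s t. (\<lambda>m. box_norm s (t + int m * int N)
        (\<lambda>i j. M s t m i j - B i j - KL s i j - KR t (i - int m * int N) (j - int m * int N))) \<longlonglongrightarrow> 0))"

text \<open>
  An intermediate index \<open>k\<close> is either at least \<open>r1\<close>, in the tail of \<open>L\<close>, or far to the left of
  the right end, in the tail of the shifted \<open>R\<close>.
\<close>

lemma opposite_corners_product_tendsto_0:
  assumes L: "l1_kernel L" and R: "l1_kernel R" and N: "N \<ge> 1"
  shows "(\<lambda>m. \<Sum>k\<in>{s..<t + int m * int N}. (\<Sum>i\<in>{s..<t + int m * int N}. norm (L i k)) *
     (\<Sum>j\<in>{s..<t + int m * int N}. norm (R (k - int m * int N) (j - int m * int N)))) \<longlonglongrightarrow> 0"
proof (rule LIMSEQ_I)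
  fix e :: real assume e: "e > 0"
  define e' where "e' = e / (2 * (l1_norm L + l1_norm R + 1))"
  have pos: "l1_norm L + l1_norm R + 1 > 0" using l1_norm_nonneg[of L] l1_norm_nonneg[of R] by linarith
  have e': "e' > 0" using e pos by (simp add: e'_def)
  obtain r1 where r1: "r1 \<ge> 0" "\<And>X. finite X \<Longrightarrow> (\<And>i j. (i, j) \<in> X \<Longrightarrow> \<bar>i\<bar> \<ge> r1 \<or> \<bar>j\<bar> \<ge> r1) \<Longrightarrow> (\<Sum>(i, j)\<in>X. norm (L i j)) \<le> e'"
    using l1_kernel_tail[OF L e'] by blast
  obtain r2 where r2: "r2 \<ge> 0" "\<And>X. finite X \<Longrightarrow> (\<And>i j. (i, j) \<in> X \<Longrightarrow> \<bar>i\<bar> \<ge> r2 \<or> \<bar>j\<bar> \<ge> r2) \<Longrightarrow> (\<Sum>(i, j)\<in>X. norm (R i j)) \<le> e'"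
    using l1_kernel_tail[OF R e'] by blast
  have "norm (\<Sum>k\<in>{s..<t + int m * int N}. (\<Sum>i\<in>{s..<t + int m * int N}. norm (L i k)) *
     (\<Sum>j\<in>{s..<t + int m * int N}. norm (R (k - int m * int N) (j - int m * int N)))) < e" if m: "m \<ge> nat (2 * (r1 + r2))" for m
  proof -
    define c where "c = int m * int N"
    define I where "I = {s..<t + c}"
    let ?l = "\<lambda>k. \<Sum>i\<in>I. norm (L i k)" and ?r = "\<lambda>k. \<Sum>j\<in>I. norm (R (k - c) (j - c))"
    have cm: "c \<ge> int m" using N unfolding c_def by (simp add: mult_le_cancel_left1)
    have fin: "finite I" by (simp add: I_def)
    have l0: "?l k \<ge> 0" and r0: "?r k \<ge> 0" for k by (auto intro: sum_nonneg)
    have sumr: "(\<Sum>k\<in>X. ?r k) = (\<Sum>(i, j)\<in>(\<lambda>(k, j). (k - c, j - c)) ` (X \<times> I). norm (R i j))" for X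
      by (subst sum.reindex) (auto simp: inj_on_def sum.cartesian_product intro!: sum.cong)
    have suml: "(\<Sum>k\<in>X. ?l k) = (\<Sum>(i, j)\<in>I \<times> X. norm (L i j))" for X
      by (subst sum.swap) (simp add: sum.cartesian_product)
    have lle: "?l k \<le> l1_norm L" for k
      using finite_sum_le_l1_norm[OF L, of "I \<times> {k}"] suml[of "{k}"] fin by simp
    have rle: "?r k \<le> l1_norm R" for k
      using finite_sum_le_l1_norm[OF R, of "(\<lambda>(k, j). (k - c, j - c)) ` ({k} \<times> I)"] sumr[of "{k}"] fin by simp
    have mm: "int m \<ge> 2 * (r1 + r2)" using m by simp
    have "(\<Sum>k\<in>I. ?l k * ?r k) = (\<Sum>k\<in>{k\<in>I. k \<ge> r1}. ?l k * ?r k) + (\<Sum>k\<in>{k\<in>I. \<not> k \<ge> r1}. ?l k * ?r k)"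
      using fin by (subst sum.union_disjoint[symmetric]) (auto intro!: sum.cong)
    also have "\<dots> \<le> (\<Sum>k\<in>{k\<in>I. k \<ge> r1}. ?l k * l1_norm R) + (\<Sum>k\<in>{k\<in>I. \<not> k \<ge> r1}. l1_norm L * ?r k)"
      by (intro add_mono sum_mono mult_left_mono mult_right_mono lle rle l0 r0)
    also have "\<dots> = (\<Sum>k\<in>{k\<in>I. k \<ge> r1}. ?l k) * l1_norm R + l1_norm L * (\<Sum>k\<in>{k\<in>I. \<not> k \<ge> r1}. ?r k)"
      by (simp only: sum_distrib_left sum_distrib_right)
    also have "\<dots> \<le> e' * l1_norm R + l1_norm L * e'"
    proof (intro add_mono mult_left_mono mult_right_mono l1_norm_nonneg)
      show "(\<Sum>k\<in>{k\<in>I. k \<ge> r1}. ?l k) \<le> e'"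
        unfolding suml by (rule r1(2)) (use fin r1(1) in auto)
      show "(\<Sum>k\<in>{k\<in>I. \<not> k \<ge> r1}. ?r k) \<le> e'"
        unfolding sumr by (rule r2(2)) (use fin r2(1) r1(1) mm cm in auto)
    qed
    \<comment> \<open>Strictness comes from the summand \<open>1\<close> in the denominator of \<open>e'\<close>, which also covers \<open>L = R = 0\<close>.\<close>
    also have "\<dots> = e * (l1_norm L + l1_norm R) / (2 * (l1_norm L + l1_norm R + 1))" by (simp add: e'_def algebra_simps add_divide_distrib)
    also have "\<dots> < e" using e l1_norm_nonneg[of L] l1_norm_nonneg[of R] pos 
      by (simp add: divide_less_eq)
    finally show ?thesis
      using sum_nonneg[of I "\<lambda>k. ?l k * ?r k"] l0 r0 unfolding I_def c_def by simp
  qed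
  then show "\<exists>m0. \<forall>m\<ge>m0. norm ((\<Sum>k\<in>{s..<t + int m * int N}. (\<Sum>i\<in>{s..<t + int m * int N}. norm (L i k)) *
     (\<Sum>j\<in>{s..<t + int m * int N}. norm (R (k - int m * int N) (j - int m * int N)))) - 0) < e"
    unfolding diff_zero by blast
qed

lemma filterlim_right_end: 
  assumes "N \<ge> 1"
  shows "filterlim (\<lambda>m. t + int m * int N) at_top sequentially" "filterlim (\<lambda>m. s - int m * int N) at_bot sequentially"
proof -
  have le: "int m \<le> int m * int N" for m using assms by (simp add: mult_le_cancel_left1)
  show "filterlim (\<lambda>m. t + int m * int N) at_top sequentially"
    unfolding filterlim_at_top eventually_sequentially
    using le by (intro allI, rule_tac x = "nat (Z - t)" in exI) (smt (verit) nat_le_iff)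
  show "filterlim (\<lambda>m. s - int m * int N) at_bot sequentially"
    unfolding filterlim_at_bot eventually_sequentially
    using le by (intro allI, rule_tac x = "nat (s - Z)" in exI) (smt (verit) nat_le_iff)
qed

text \<open>
  Up to a small error the matrix is \<open>(1 + KL) (1 + KR)\<close>, since the product of the two
  corrections is small. The determinants of the two factors converge as the interval grows away from
  the respective end.
\<close>

lemma boundary_form_det_limit:
  assumes M: "boundary_form N kronecker M" and N: "N \<ge> 1"
  obtains E1 E2 where "\<And>s t. (\<lambda>m. Determinant.det (finsec s (t + int m * int N) (M s t m))) \<longlonglongrightarrow> E1 s * E2 t"
proof -
  obtain KL KR where KL: "\<And>s. l1_kernel (KL s)" and KR: "\<And>t. l1_kernel (KR t)"
    and lim: "\<And>s t. (\<lambda>m. box_norm s (t + int m * int N)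
        (\<lambda>i j. M s t m i j - kronecker i j - KL s i j - KR t (i - int m * int N) (j - int m * int N))) \<longlonglongrightarrow> 0"
    using M unfolding boundary_form_def by blast
  have "\<exists>L. ((\<lambda>t. perturbed_det (KL s) s t) \<longlongrightarrow> L) at_top" for s
    using det_right_limit[OF KL[of s]] by metis
  then obtain E1 where E1: "\<And>s. ((\<lambda>t. perturbed_det (KL s) s t) \<longlongrightarrow> E1 s) at_top" by metis
  have "\<exists>L. ((\<lambda>s. perturbed_det (KR t) s t) \<longlongrightarrow> L) at_bot" for t
    using det_left_limit[OF KR[of t]] by metis
  then obtain E2 where E2: "\<And>t. ((\<lambda>s. perturbed_det (KR t) s t) \<longlongrightarrow> E2 t) at_bot" by metis
  have "(\<lambda>m. Determinant.det (finsec s (t + int m * int N) (M s t m))) \<longlonglongrightarrow> E1 s * E2 t" for s t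
  proof -
    let ?T = "\<lambda>m. t + int m * int N" and ?c = "\<lambda>m. int m * int N"
    let ?L = "KL s" and ?R = "\<lambda>m i j. KR t (i - ?c m) (j - ?c m)"
    let ?P = "\<lambda>m i j. \<Sum>k\<in>{s..<?T m}. ?L i k * ?R m k j"
    let ?A = "\<lambda>m i j. ?L i j + (?R m i j + ?P m i j)"
    let ?E = "\<lambda>m i j. M s t m i j - kronecker i j - ?L i j - ?R m i j"
    let ?X = "\<lambda>m. Determinant.det (finsec s (?T m) (\<lambda>i j. kronecker i j + ?L i j))"
    let ?Y = "\<lambda>m. Determinant.det (finsec s (?T m) (\<lambda>i j. kronecker i j + ?R m i j))"
    have X: "?X \<longlonglongrightarrow> E1 s" by (rule filterlim_compose[OF E1 filterlim_right_end(1)[OF N]])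
    have "?Y = (\<lambda>m. Determinant.det (finsec (s - ?c m) t (\<lambda>i j. kronecker i j + KR t i j)))"
    proof
      fix m
      have "(\<lambda>i j. kronecker i j + ?R m i j) = (\<lambda>i j. kronecker (i - ?c m) (j - ?c m) + ?R m i j)" by (simp add: kronecker_def)
      then show "?Y m = Determinant.det (finsec (s - ?c m) t (\<lambda>i j. kronecker i j + KR t i j))"
        using finsec_shift[of s "?T m" "\<lambda>i j. kronecker i j + KR t i j" "?c m"] by simp
    qed
    then have Y: "?Y \<longlonglongrightarrow> E2 t" using filterlim_compose[OF E2 filterlim_right_end(2)[OF N]] by simp
    have XY: "?X m * ?Y m = Determinant.det (finsec s (?T m) (\<lambda>i j. kronecker i j + ?A m i j))" for m
    proof -
      have "(\<Sum>k\<in>{s..<?T m}. (kronecker i k + ?L i k) * (kronecker k j + ?R m k j)) = kronecker i j + ?A m i j"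
        if "s \<le> i" "i < ?T m" "s \<le> j" "j < ?T m" for i j
      proof -
        have 1: "(\<Sum>k\<in>{s..<?T m}. kronecker i k * f k) = f i" "(\<Sum>k\<in>{s..<?T m}. f k * kronecker k j) = f j" for f
          using that by (simp_all add: kronecker_def if_distrib[of "\<lambda>x. x * _"] if_distrib[of "\<lambda>x. _ * x"] cong: if_cong)
        show ?thesis by (simp add: distrib_left distrib_right sum.distrib 1)
      qed
      then show ?thesis unfolding det_finsec_mult[symmetric] by (intro arg_cong[of _ _ Determinant.det] finsec_cong)
    qed
    let ?d = "\<lambda>m. box_norm s (?T m) (\<lambda>i j. (M s t m i j - kronecker i j) - ?A m i j)"
    have P0: "(\<lambda>m. box_norm s (?T m) (?P m)) \<longlonglongrightarrow> 0"
      by (rule tendsto_sandwich[OF _ _ tendsto_const opposite_corners_product_tendsto_0[OF KL KR N]])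
         (auto intro!: always_eventually box_norm_nonneg box_norm_product_le)
    have dle: "?d m \<le> box_norm s (?T m) (?E m) + box_norm s (?T m) (?P m)" for m
    proof -
      have "?d m = box_norm s (?T m) (\<lambda>i j. ?E m i j + - ?P m i j)" by (simp add: algebra_simps)
      then show ?thesis using box_norm_add_le[of "?E m" "\<lambda>i j. - ?P m i j" s "?T m"] by simp
    qed
    have d0: "?d \<longlonglongrightarrow> 0"
      by (rule tendsto_sandwich[OF _ _ tendsto_const tendsto_add_zero[OF lim P0]])
         (auto intro!: always_eventually box_norm_nonneg dle)
    have Ale: "box_norm s (?T m) (?A m) \<le> l1_norm ?L + (l1_norm (KR t) + box_norm s (?T m) (?P m))" for m
      by (intro order_trans[OF box_norm_add_le] add_mono box_norm_le_l1_norm KL order_refl)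
         (use box_norm_le_l1_norm[OF KR] in \<open>simp add: box_norm_shift\<close>)
    have bd: "norm (Determinant.det (finsec s (?T m) (M s t m)) - ?X m * ?Y m)
       \<le> ?d m * exp (l1_norm ?L + (l1_norm (KR t) + box_norm s (?T m) (?P m)) + ?d m)" for m
    proof -
      have "norm (Determinant.det (finsec s (?T m) (M s t m)) - ?X m * ?Y m) \<le> ?d m * exp (box_norm s (?T m) (?A m) + ?d m)"
        using norm_det_finsec_diff_le[of s "?T m" "\<lambda>i j. M s t m i j - kronecker i j" "?A m"] unfolding XY by simp
      also have "\<dots> \<le> ?d m * exp (l1_norm ?L + (l1_norm (KR t) + box_norm s (?T m) (?P m)) + ?d m)"
        using Ale[of m] by (intro mult_left_mono box_norm_nonneg) auto
      finally show ?thesis .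
    qed
    have "(\<lambda>m. ?d m * exp (l1_norm ?L + (l1_norm (KR t) + box_norm s (?T m) (?P m)) + ?d m))
       \<longlonglongrightarrow> 0 * exp (l1_norm ?L + (l1_norm (KR t) + 0) + 0)"
      by (intro tendsto_intros d0 P0)
    then have "(\<lambda>m. Determinant.det (finsec s (?T m) (M s t m)) - ?X m * ?Y m) \<longlonglongrightarrow> 0"
      unfolding mult_zero_left by (rule Lim_null_comparison[OF always_eventually[OF allI[OF bd]]])
    from tendsto_add[OF this tendsto_mult[OF X Y]] show ?thesis by simp
  qed
  then show ?thesis by (rule that)
qed

section \<open>Products of truncated matrices\<close>

lemma min_le_powr_mult:
  fixes x y :: real
  assumes "x > 0" "y > 0" "p \<ge> 0" "q \<ge> 0" "p + q = 1"
  shows "min x y \<le> x powr p * y powr q"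
proof -
  have "min x y = min x y powr p * min x y powr q"
    using assms by (simp flip: powr_add)
  also have "\<dots> \<le> x powr p * y powr q"
    using assms by (intro mult_mono powr_mono2) auto
  finally show ?thesis .
qed

text \<open>
  In the coordinates \<open>n = i - k\<close>, \<open>m = j - k\<close>, \<open>l = s - 1 - k\<close> the index set consists of the triples
  with \<open>0 \<le> l < min n m\<close>, so the sum over \<open>l\<close> contributes the factor \<open>min n m\<close>. The
  weights absorb this factor because the exponents add up to \<open>1\<close>.
\<close>

lemma hankel_product_summable:
  fixes \<beta> \<gamma> :: "int \<Rightarrow> real"
  assumes \<beta>: "(\<lambda>n. of_int n powr p * \<beta> n) summable_on {0<..}" "\<And>n. \<beta> n \<ge> 0"
    and \<gamma>: "(\<lambda>n. of_int n powr q * \<gamma> n) summable_on {0<..}" "\<And>n. \<gamma> n \<ge> 0"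
    and pq: "p \<ge> 0" "q \<ge> 0" "p + q = 1"
  shows "(\<lambda>(i, k, j). \<beta> (i - k) * \<gamma> (j - k)) summable_on ({s..} \<times> {..<s} \<times> {s..})"
proof -
  let ?A = "{0<..} \<times> {0<..} :: (int \<times> int) set"
  let ?g = "\<lambda>(x, l::int). case x of (n, m) \<Rightarrow> \<beta> n * \<gamma> m"
  let ?f = "\<lambda>(n, m). (of_int n powr p * \<beta> n) * (of_int m powr q * \<gamma> m)"
  have "?f summable_on ?A"
    by (rule has_sum_imp_summable[OF has_sum_product[OF \<beta>(1) _ \<gamma>(1)]]) (auto simp: \<beta> \<gamma>)
  then have "(\<lambda>x. case x of (n, m) \<Rightarrow> of_int (min n m) * (\<beta> n * \<gamma> m)) summable_on ?A"
  proof (rule summable_on_comparison_test)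
    fix x :: "int \<times> int" assume "x \<in> ?A"
    moreover obtain n m where x: "x = (n, m)" by force
    ultimately have nm: "n > 0" "m > 0" by auto
    have "of_int (min n m) * (\<beta> n * \<gamma> m) \<le> (of_int n powr p * of_int m powr q) * (\<beta> n * \<gamma> m)"
      using min_le_powr_mult[of "of_int n" "of_int m" p q] nm pq by (intro mult_right_mono) (auto simp: \<beta> \<gamma>)
    then show "(case x of (n, m) \<Rightarrow> of_int (min n m) * (\<beta> n * \<gamma> m)) \<le> ?f x" by (simp add: x mult_ac)
  qed (auto simp: \<beta> \<gamma>)
  then have "?g summable_on Sigma ?A (\<lambda>(n, m). {0..<min n m})"
    by (intro summable_on_SigmaI[where g = "\<lambda>x. case x of (n, m) \<Rightarrow> of_int (min n m) * (\<beta> n * \<gamma> m)"])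
       (auto simp: \<beta> \<gamma> intro!: has_sum_finiteI)
  moreover have "(\<lambda>(i, k, j). \<beta> (i - k) * \<gamma> (j - k)) summable_on ({s..} \<times> {..<s} \<times> {s..})
      \<longleftrightarrow> ?g summable_on Sigma ?A (\<lambda>(n, m). {0..<min n m})"
    by (rule summable_on_reindex_bij_witness[of _ "\<lambda>((n, m), l). (s - 1 - l + n, s - 1 - l, s - 1 - l + m)" "\<lambda>(i, k, j). ((i - k, j - k), s - 1 - k)"]) auto
  ultimately show ?thesis by blast
qed

lemma l1_kernel_contraction:
  fixes F :: "int \<Rightarrow> int \<Rightarrow> int \<Rightarrow> complex"
  assumes F: "(\<lambda>(i, k, j). norm (F i k j)) summable_on (I \<times> K \<times> J)"
  shows "l1_kernel (\<lambda>i j. if i \<in> I \<and> j \<in> J then \<Sum>\<^sub>\<infinity>k\<in>K. F i k j else 0)"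
proof -
  have F': "(\<lambda>((i, j), k). norm (F i k j)) summable_on ((I \<times> J) \<times> K)"
    using summable_on_reindex_bij_witness[of "I \<times> K \<times> J" "\<lambda>((i, j), k). (i, k, j)" "\<lambda>(i, k, j). ((i, j), k)" "(I \<times> J) \<times> K"
      "\<lambda>((i, j), k). norm (F i k j)" "\<lambda>(i, k, j). norm (F i k j)"] F by auto
  have s: "(\<lambda>k. norm (F i k j)) summable_on K" if "i \<in> I" "j \<in> J" for i j
    using summable_on_SigmaD1[where f = "\<lambda>(i, j) k. norm (F i k j)" and A = "I \<times> J" and B = "\<lambda>_. K" and x = "(i, j)"] F' that
    by (simp add: case_prod_unfold)
  have "(\<lambda>x. \<Sum>\<^sub>\<infinity>k\<in>K. norm (F (fst x) k (snd x))) summable_on (I \<times> J)"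
    using summable_on_Sigma_banach[where f = "\<lambda>x k. norm (F (fst x) k (snd x))" and A = "I \<times> J" and B = "\<lambda>_. K"] F'
    by (simp add: case_prod_unfold)
  then have "(\<lambda>x. norm (\<Sum>\<^sub>\<infinity>k\<in>K. F (fst x) k (snd x))) summable_on (I \<times> J)"
    by (rule summable_on_comparison_test) (use s in \<open>auto intro: norm_infsum_bound\<close>)
  then show ?thesis unfolding l1_kernel_def
    by (subst summable_on_cong_neutral[of "I \<times> J" UNIV]) (auto simp: case_prod_unfold)
qed

lemma l1_kernel_add: "l1_kernel A \<Longrightarrow> l1_kernel B \<Longrightarrow> l1_kernel (\<lambda>i j. A i j + B i j)"
  unfolding l1_kernel_def case_prod_unfold
  by (rule summable_on_comparison_test[OF summable_on_add[of "\<lambda>x. norm (A (fst x) (snd x))" UNIV "\<lambda>x. norm (B (fst x) (snd x))"]])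
     (auto intro: norm_triangle_ineq)

lemma l1_kernel_uminus: "l1_kernel A \<Longrightarrow> l1_kernel (\<lambda>i j. - A i j)"
  by (simp add: l1_kernel_def)

text \<open>
  The comparison of truncations uses two properties of a Laurent matrix: its periodicity and this
  domination by a weighted summable function of \<open>i - j\<close>. The bound is formulated with scalar
  instead of block indices because the ends of the intervals need not be block boundaries.
\<close>

definition off_diagonal_decay :: "real \<Rightarrow> real \<Rightarrow> (int \<Rightarrow> int \<Rightarrow> complex) \<Rightarrow> bool" where
  "off_diagonal_decay \<alpha>1 \<alpha>2 B \<longleftrightarrow> (\<exists>\<beta>. (\<forall>n. 0 \<le> \<beta> n) \<and>
     (\<lambda>n. wiener_weight \<alpha>1 \<alpha>2 n * \<beta> n) summable_on UNIV \<and> (\<forall>i j. norm (B i j) \<le> \<beta> (i - j)))"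

lemma weighted_summable_parts:
  fixes \<beta> :: "int \<Rightarrow> real"
  assumes \<beta>: "(\<lambda>n. wiener_weight \<alpha>1 \<alpha>2 n * \<beta> n) summable_on UNIV" "\<And>n. \<beta> n \<ge> 0" and nn: "\<alpha>1 \<ge> 0" "\<alpha>2 \<ge> 0"
  shows "\<beta> summable_on UNIV" "(\<lambda>n. of_int n powr \<alpha>1 * \<beta> n) summable_on {0<..}"
    "(\<lambda>n. of_int n powr \<alpha>2 * \<beta> (- n)) summable_on {0<..}"
proof -
  have ge1: "wiener_weight \<alpha>1 \<alpha>2 n \<ge> 1" for n
    using nn by (auto simp: wiener_weight_def intro!: ge_one_powr_ge_zero)
  show "\<beta> summable_on UNIV"
    by (rule summable_on_comparison_test[OF \<beta>(1)]) (use \<beta>(2) mult_right_mono[OF ge1 \<beta>(2)] in auto)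
  have sub: "(\<lambda>n. wiener_weight \<alpha>1 \<alpha>2 n * \<beta> n) summable_on A" for A
    using \<beta>(1) by (rule summable_on_subset) auto
  show "(\<lambda>n. of_int n powr \<alpha>1 * \<beta> n) summable_on {0<..}"
    by (rule summable_on_comparison_test[OF sub[of "{0<..}"]])
       (use nn in \<open>auto simp: wiener_weight_def \<beta>(2) intro!: mult_right_mono powr_mono2\<close>)
  have "(\<lambda>n. wiener_weight \<alpha>1 \<alpha>2 (- n) * \<beta> (- n)) summable_on {0<..}"
    using summable_on_reindex_bij_witness[of "{0<..}" uminus uminus "{..<0}" "\<lambda>n. wiener_weight \<alpha>1 \<alpha>2 n * \<beta> n" "\<lambda>n. wiener_weight \<alpha>1 \<alpha>2 (- n) * \<beta> (- n)"] sub[of "{..<0}"] by auto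
  then show "(\<lambda>n. of_int n powr \<alpha>2 * \<beta> (- n)) summable_on {0<..}"
    by (rule summable_on_comparison_test)
       (use nn in \<open>auto simp: wiener_weight_def \<beta>(2) intro!: mult_right_mono powr_mono2\<close>)
qed

text \<open>
  The corner at the right end is the corner at the left end after the reflection of all indices; the
  reflection interchanges the two exponents.
\<close>

lemma corner_products_summable:
  assumes B: "off_diagonal_decay \<alpha>1 \<alpha>2 B" and C: "off_diagonal_decay \<alpha>1 \<alpha>2 C"
    and nn: "\<alpha>1 \<ge> 0" "\<alpha>2 \<ge> 0" "\<alpha>1 + \<alpha>2 = 1"
  shows "(\<lambda>(i, k, j). norm (B i k * C k j)) summable_on ({s..} \<times> {..<s} \<times> {s..})"
    "(\<lambda>(i, k, j). norm (B i k * C k j)) summable_on ({..<t} \<times> {t..} \<times> {..<t})"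
proof -
  obtain \<beta> where \<beta>: "\<And>n. 0 \<le> \<beta> n" "(\<lambda>n. wiener_weight \<alpha>1 \<alpha>2 n * \<beta> n) summable_on UNIV" "\<And>i j. norm (B i j) \<le> \<beta> (i - j)"
    using B unfolding off_diagonal_decay_def by blast
  obtain \<gamma> where \<gamma>: "\<And>n. 0 \<le> \<gamma> n" "(\<lambda>n. wiener_weight \<alpha>1 \<alpha>2 n * \<gamma> n) summable_on UNIV" "\<And>i j. norm (C i j) \<le> \<gamma> (i - j)"
    using C unfolding off_diagonal_decay_def by blast
  note b = weighted_summable_parts[OF \<beta>(2,1) nn(1,2)] and c = weighted_summable_parts[OF \<gamma>(2,1) nn(1,2)]
  have le: "norm (B i k * C k j) \<le> \<beta> (i - k) * \<gamma> (k - j)" for i k j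
    unfolding norm_mult by (intro mult_mono \<beta> \<gamma>) auto
  have "(\<lambda>(i, k, j). \<beta> (i - k) * \<gamma> (- (j - k))) summable_on ({s..} \<times> {..<s} \<times> {s..})"
    by (rule hankel_product_summable[where \<gamma> = "\<lambda>n. \<gamma> (- n)"]) (use b(2) c(3) \<beta>(1) \<gamma>(1) nn in auto)
  then show "(\<lambda>(i, k, j). norm (B i k * C k j)) summable_on ({s..} \<times> {..<s} \<times> {s..})"
    by (rule summable_on_comparison_test) (use le in auto)
  have "(\<lambda>(i, k, j). \<beta> (- (i - k)) * \<gamma> (j - k)) summable_on ({1 - t..} \<times> {..<1 - t} \<times> {1 - t..})"
    by (rule hankel_product_summable[where \<beta> = "\<lambda>n. \<beta> (- n)" and p = \<alpha>2 and q = \<alpha>1]) (use b(3) c(2) \<beta>(1) \<gamma>(1) nn in auto)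
  then have "(\<lambda>(i, k, j). \<beta> (i - k) * \<gamma> (k - j)) summable_on ({..<t} \<times> {t..} \<times> {..<t})"
    using summable_on_reindex_bij_witness[of "{1 - t..} \<times> {..<1 - t} \<times> {1 - t..}" "\<lambda>(i, k, j). (- i, - k, - j)" "\<lambda>(i, k, j). (- i, - k, - j)"
       "{..<t} \<times> {t..} \<times> {..<t}" "\<lambda>(i, k, j). \<beta> (i - k) * \<gamma> (k - j)" "\<lambda>(i, k, j). \<beta> (- (i - k)) * \<gamma> (j - k)"] by auto
  then show "(\<lambda>(i, k, j). norm (B i k * C k j)) summable_on ({..<t} \<times> {t..} \<times> {..<t})"
    by (rule summable_on_comparison_test) (use le in auto)
qed

lemma off_diagonal_decay_row_sums:
  assumes C: "off_diagonal_decay \<alpha>1 \<alpha>2 C" and nn: "\<alpha>1 \<ge> 0" "\<alpha>2 \<ge> 0"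
  obtains G where "G \<ge> 0" "\<And>k. (\<lambda>j. norm (C k j)) summable_on UNIV" "\<And>k. (\<Sum>\<^sub>\<infinity>j. norm (C k j)) \<le> G"
    "\<And>k X. finite X \<Longrightarrow> (\<Sum>j\<in>X. norm (C k j)) \<le> G" "\<And>k j. norm (C k j) \<le> G"
proof -
  obtain \<gamma> where \<gamma>: "\<And>n. 0 \<le> \<gamma> n" "(\<lambda>n. wiener_weight \<alpha>1 \<alpha>2 n * \<gamma> n) summable_on UNIV" "\<And>i j. norm (C i j) \<le> \<gamma> (i - j)"
    using C unfolding off_diagonal_decay_def by blast
  note s = weighted_summable_parts(1)[OF \<gamma>(2,1) nn]
  have hs: "((\<lambda>j. \<gamma> (k - j)) has_sum infsum \<gamma> UNIV) UNIV" for k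
    using has_sum_reindex_bij_witness[of UNIV "\<lambda>j. k - j" "\<lambda>j. k - j" UNIV \<gamma> "\<lambda>j. \<gamma> (k - j)"] has_sum_infsum[OF s] by auto
  have 1: "(\<lambda>j. norm (C k j)) summable_on UNIV" for k
    by (rule summable_on_comparison_test[OF has_sum_imp_summable[OF hs[of k]]]) (auto simp: \<gamma>)
  have 2: "(\<Sum>\<^sub>\<infinity>j. norm (C k j)) \<le> infsum \<gamma> UNIV" for k
    using infsum_mono[OF 1 has_sum_imp_summable[OF hs] \<gamma>(3), of k] infsumI[OF hs[of k]] by simp
  have 3: "(\<Sum>j\<in>X. norm (C k j)) \<le> infsum \<gamma> UNIV" if "finite X" for k X
    using finite_sum_le_infsum[OF 1[of k] that] 2[of k] by auto
  show ?thesis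
  proof (rule that[of "infsum \<gamma> UNIV"])
    show "infsum \<gamma> UNIV \<ge> 0" by (rule infsum_nonneg) (rule \<gamma>)
    show "norm (C k j) \<le> infsum \<gamma> UNIV" for k j using 3[of "{j}" k] by simp
  qed (use 1 2 3 in auto)
qed

lemma l1_kernel_mult_summable:
  assumes K: "l1_kernel K" and C: "off_diagonal_decay \<alpha>1 \<alpha>2 C" and nn: "\<alpha>1 \<ge> 0" "\<alpha>2 \<ge> 0"
  shows "(\<lambda>(i, k, j). norm (K i k * C k j)) summable_on X"
proof -
  obtain G where G: "G \<ge> 0" "\<And>k. (\<lambda>j. norm (C k j)) summable_on UNIV" "\<And>k. (\<Sum>\<^sub>\<infinity>j. norm (C k j)) \<le> G"
    using off_diagonal_decay_row_sums[OF C nn] by metis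
  have K': "(\<lambda>x. norm (K (fst x) (snd x)) * G) summable_on UNIV"
    using K unfolding l1_kernel_def case_prod_unfold by (rule summable_on_cmult_left)
  have in1: "((\<lambda>j. norm (K (fst x) (snd x)) * norm (C (snd x) j)) has_sum norm (K (fst x) (snd x)) * (\<Sum>\<^sub>\<infinity>j. norm (C (snd x) j))) UNIV" for x
    by (intro has_sum_cmult_right has_sum_infsum G)
  have "(\<lambda>(x, j). norm (K (fst x) (snd x)) * norm (C (snd x) j)) summable_on (UNIV \<times> UNIV)"
  proof (rule summable_on_SigmaI[where g = "\<lambda>x. norm (K (fst x) (snd x)) * (\<Sum>\<^sub>\<infinity>j. norm (C (snd x) j))"])
    show "(\<lambda>x. norm (K (fst x) (snd x)) * (\<Sum>\<^sub>\<infinity>j. norm (C (snd x) j))) summable_on UNIV"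
      by (rule summable_on_comparison_test[OF K']) (auto intro!: mult_left_mono G mult_nonneg_nonneg infsum_nonneg)
  qed (use in1 in auto)
  then have "(\<lambda>(i, k, j). norm (K i k * C k j)) summable_on UNIV"
    using summable_on_reindex_bij_witness[of UNIV "\<lambda>((i, k), j). (i, k, j)" "\<lambda>(i, k, j). ((i, k), j)" "UNIV \<times> UNIV"
      "\<lambda>(x, j). norm (K (fst x) (snd x)) * norm (C (snd x) j)" "\<lambda>(i, k, j). norm (K i k * C k j)"] by (auto simp: norm_mult)
  then show ?thesis by (rule summable_on_subset) auto
qed

lemma decay_product_summable:
  assumes B: "off_diagonal_decay \<alpha>1 \<alpha>2 B" and C: "off_diagonal_decay \<alpha>1 \<alpha>2 C" and nn: "\<alpha>1 \<ge> 0" "\<alpha>2 \<ge> 0"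
  shows "(\<lambda>k. norm (B i k * C k j)) summable_on UNIV"
proof -
  obtain G where G: "\<And>k j. norm (C k j) \<le> G"
    using off_diagonal_decay_row_sums[OF C nn] by metis
  have row: "\<And>k. (\<lambda>j. norm (B k j)) summable_on UNIV"
    using off_diagonal_decay_row_sums[OF B nn] by metis
  show ?thesis
    by (rule summable_on_comparison_test[OF summable_on_cmult_left[OF row[of i], where c = G]])
       (auto simp: norm_mult intro!: mult_left_mono G)
qed

lemma infsum_int_split:
  fixes f :: "int \<Rightarrow> complex"
  assumes f: "(\<lambda>k. norm (f k)) summable_on UNIV" and "s \<le> t"
  shows "infsum f {s..} = sum f {s..<t} + infsum f {t..}" "infsum f {..<t} = infsum f {..<s} + sum f {s..<t}"
    "infsum f UNIV = infsum f {..<s} + sum f {s..<t} + infsum f {t..}"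
proof -
  have s: "f summable_on A" for A
    using abs_summable_summable[OF f] by (rule summable_on_subset) auto
  have u: "infsum f (A \<union> B) = infsum f A + infsum f B" if "A \<inter> B = {}" for A B
    by (rule infsum_Un_disjoint[OF s s that])
  have e: "{s..<t} \<union> {t..} = {s..}" "{..<s} \<union> {s..<t} = {..<t}" "{..<s} \<union> {s..} = UNIV" using \<open>s \<le> t\<close> by auto
  show 1: "infsum f {s..} = sum f {s..<t} + infsum f {t..}" using u[of "{s..<t}" "{t..}"] e by (simp add: ivl_disj_int)
  show "infsum f {..<t} = infsum f {..<s} + sum f {s..<t}" using u[of "{..<s}" "{s..<t}"] e by (simp add: ivl_disj_int)
  show "infsum f UNIV = infsum f {..<s} + sum f {s..<t} + infsum f {t..}"
    using u[of "{..<s}" "{s..}"] e 1 by (simp add: disjoint_iff add.assoc)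
qed

lemma l1_kernel_row_summable:
  assumes "l1_kernel K"
  shows "(\<lambda>k. norm (K i k)) summable_on A"
  using summable_on_SigmaD1[where f = "\<lambda>i k. norm (K i k)" and A = UNIV and B = "\<lambda>_. UNIV" and x = i] assms
  unfolding l1_kernel_def by (auto intro: summable_on_subset)

lemma has_sum_finite_sum:
  fixes f :: "'i \<Rightarrow> 'a \<Rightarrow> 'b::{topological_comm_monoid_add}"
  assumes "finite I" "\<And>i. (f i has_sum s i) A"
  shows "((\<lambda>x. \<Sum>i\<in>I. f i x) has_sum (\<Sum>i\<in>I. s i)) A"
  using assms by (induction I rule: finite_induct) (auto intro: has_sum_add)

text \<open>
  Multiplication by a matrix with bounded row sums multiplies the entrywise norm by at most the
  bound. The premise on finite sums is the form in which \<open>l1_kernel_tail\<close> provides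
  smallness.
\<close>

lemma norm_contraction_tail_le:
  assumes K: "l1_kernel K" and G: "\<And>k. (\<Sum>j\<in>Y. norm (C k j)) \<le> G" "\<And>k j. norm (C k j) \<le> G" and Y: "finite Y" and X: "finite X"
    and e: "\<And>F. finite F \<Longrightarrow> F \<subseteq> X \<times> Z \<Longrightarrow> (\<Sum>(i, k)\<in>F. norm (K i k)) \<le> e"
  shows "(\<Sum>i\<in>X. \<Sum>j\<in>Y. norm (\<Sum>\<^sub>\<infinity>k\<in>Z. K i k * C k j)) \<le> G * e"
proof -
  have G0: "G \<ge> 0" using order_trans[OF norm_ge_zero G(2)] .
  note row = l1_kernel_row_summable[OF K]
  have s: "(\<lambda>k. norm (K i k * C k j)) summable_on Z" for i j
    by (rule summable_on_comparison_test[OF summable_on_cmult_left[OF row[of i Z], where c = G]])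
       (auto simp: norm_mult intro: mult_left_mono G)
  have inner: "(\<Sum>j\<in>Y. norm (\<Sum>\<^sub>\<infinity>k\<in>Z. K i k * C k j)) \<le> G * (\<Sum>\<^sub>\<infinity>k\<in>Z. norm (K i k))" for i
  proof -
    have "(\<Sum>j\<in>Y. norm (\<Sum>\<^sub>\<infinity>k\<in>Z. K i k * C k j)) \<le> (\<Sum>j\<in>Y. \<Sum>\<^sub>\<infinity>k\<in>Z. norm (K i k * C k j))"
      by (intro sum_mono norm_infsum_bound s)
    also have "\<dots> = (\<Sum>\<^sub>\<infinity>k\<in>Z. \<Sum>j\<in>Y. norm (K i k * C k j))"
      using infsumI[OF has_sum_finite_sum[OF Y has_sum_infsum[OF s]]] by simp
    also have "\<dots> \<le> (\<Sum>\<^sub>\<infinity>k\<in>Z. G * norm (K i k))"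
    proof (rule infsum_mono)
      show "(\<lambda>k. \<Sum>j\<in>Y. norm (K i k * C k j)) summable_on Z" by (rule has_sum_imp_summable[OF has_sum_finite_sum[OF Y has_sum_infsum[OF s]]])
      show "(\<lambda>k. G * norm (K i k)) summable_on Z" by (intro summable_on_cmult_right row)
      show "(\<Sum>j\<in>Y. norm (K i k * C k j)) \<le> G * norm (K i k)" for k
        using mult_left_mono[OF G(1)[of k], of "norm (K i k)"] by (simp add: norm_mult sum_distrib_left mult.commute)
    qed
    finally show ?thesis by (simp add: infsum_cmult_right')
  qed
  have "(\<Sum>i\<in>X. \<Sum>\<^sub>\<infinity>k\<in>Z. norm (K i k)) = infsum (\<lambda>(i, k). norm (K i k)) (X \<times> Z)"
  proof -
    have "(\<lambda>(i, k). norm (K i k)) summable_on (X \<times> Z)"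
      using K unfolding l1_kernel_def by (rule summable_on_subset) auto
    from infsum_Sigma'_banach[OF this] show ?thesis using X by simp
  qed
  also have "\<dots> \<le> e"
    by (rule infsum_le_finite_sums) (use K e in \<open>auto simp: l1_kernel_def intro: summable_on_subset\<close>)
  finally have "G * (\<Sum>i\<in>X. \<Sum>\<^sub>\<infinity>k\<in>Z. norm (K i k)) \<le> G * e" using G0 by (rule mult_left_mono)
  moreover have "(\<Sum>i\<in>X. \<Sum>j\<in>Y. norm (\<Sum>\<^sub>\<infinity>k\<in>Z. K i k * C k j)) \<le> G * (\<Sum>i\<in>X. \<Sum>\<^sub>\<infinity>k\<in>Z. norm (K i k))"
    unfolding sum_distrib_left by (intro sum_mono inner)
  ultimately show ?thesis by linarith
qed

text \<open>
  The sum over \<open>k\<close> in the interval is the full sum minus the sums beyond both ends. For the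
  truncation of \<open>B\<close> both missing parts are corner corrections. For a correction at one end, the sum
  beyond that end is again a correction at the same end, and the sum beyond the opposite end is
  negligible because it involves only the tail of the correction. Periodicity moves the
  right corner back to its reference position.
\<close>

lemma boundary_form_mult:
  assumes M: "boundary_form N B M" and N: "N \<ge> 1" and nn: "\<alpha>1 \<ge> 0" "\<alpha>2 \<ge> 0" "\<alpha>1 + \<alpha>2 = 1"
    and B: "off_diagonal_decay \<alpha>1 \<alpha>2 B" and C: "off_diagonal_decay \<alpha>1 \<alpha>2 C"
    and perB: "\<And>i j m. B (i + int m * int N) (j + int m * int N) = B i j"
    and perC: "\<And>i j m. C (i + int m * int N) (j + int m * int N) = C i j"
  shows "boundary_form N (\<lambda>i j. \<Sum>\<^sub>\<infinity>k. B i k * C k j) (\<lambda>s t m i j. \<Sum>k\<in>{s..<t + int m * int N}. M s t m i k * C k j)"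
proof -
  obtain KL KR where KL: "\<And>s. l1_kernel (KL s)" and KR: "\<And>t. l1_kernel (KR t)"
    and lim: "\<And>s t. (\<lambda>m. box_norm s (t + int m * int N)
        (\<lambda>i j. M s t m i j - B i j - KL s i j - KR t (i - int m * int N) (j - int m * int N))) \<longlonglongrightarrow> 0"
    using M unfolding boundary_form_def by blast
  obtain G where G: "G \<ge> 0" "\<And>k X. finite X \<Longrightarrow> (\<Sum>j\<in>X. norm (C k j)) \<le> G" "\<And>k j. norm (C k j) \<le> G"
    using off_diagonal_decay_row_sums[OF C nn(1,2)] by metis
  define KL' where "KL' = (\<lambda>s i j. (if i \<in> {s..} \<and> j \<in> {s..} then \<Sum>\<^sub>\<infinity>k\<in>{s..}. KL s i k * C k j else 0)
     + - (if i \<in> {s..} \<and> j \<in> {s..} then \<Sum>\<^sub>\<infinity>k\<in>{..<s}. B i k * C k j else 0))"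
  define KR' where "KR' = (\<lambda>t i j. (if i \<in> {..<t} \<and> j \<in> {..<t} then \<Sum>\<^sub>\<infinity>k\<in>{..<t}. KR t i k * C k j else 0)
     + - (if i \<in> {..<t} \<and> j \<in> {..<t} then \<Sum>\<^sub>\<infinity>k\<in>{t..}. B i k * C k j else 0))"
  have l1: "l1_kernel (KL' s)" "l1_kernel (KR' t)" for s t
    unfolding KL'_def KR'_def
    by (intro l1_kernel_add l1_kernel_uminus l1_kernel_contraction l1_kernel_mult_summable[OF KL C nn(1,2)]
        l1_kernel_mult_summable[OF KR C nn(1,2)] corner_products_summable[OF B C nn])+
  have lim': "(\<lambda>m. box_norm s (t + int m * int N)
        (\<lambda>i j. (\<Sum>k\<in>{s..<t + int m * int N}. M s t m i k * C k j) - (\<Sum>\<^sub>\<infinity>k. B i k * C k j) - KL' s i j - KR' t (i - int m * int N) (j - int m * int N))) \<longlonglongrightarrow> 0"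
    (is "?err \<longlonglongrightarrow> 0") for s t
  proof -
    let ?T = "\<lambda>m. t + int m * int N" and ?c = "\<lambda>m. int m * int N"
    let ?KR = "\<lambda>m i j. KR t (i - ?c m) (j - ?c m)"
    let ?E = "\<lambda>m i j. M s t m i j - B i j - KL s i j - ?KR m i j"
    let ?e1 = "\<lambda>m i j. \<Sum>k\<in>{s..<?T m}. ?E m i k * C k j"
    let ?e2 = "\<lambda>m i j. \<Sum>\<^sub>\<infinity>k\<in>{?T m..}. KL s i k * C k j"
    let ?e3 = "\<lambda>m i j. \<Sum>\<^sub>\<infinity>k\<in>{..<s}. ?KR m i k * C k j"
    have KRm: "l1_kernel (?KR m)" for m
      unfolding l1_kernel_def
      using summable_on_reindex_bij_witness[of UNIV "\<lambda>(i, j). (i + ?c m, j + ?c m)" "\<lambda>(i, j). (i - ?c m, j - ?c m)" UNIV "\<lambda>(i, j). norm (KR t i j)" "\<lambda>(i, j). norm (?KR m i j)"]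
        KR[of t] by (auto simp: l1_kernel_def)
    note sB = decay_product_summable[OF B C nn(1,2)]
    have sK: "(\<lambda>k. norm (K i k * C k j)) summable_on UNIV" if "l1_kernel K" for K i j
      by (rule summable_on_comparison_test[OF summable_on_cmult_left[OF l1_kernel_row_summable[OF that, of i UNIV], where c = G]])
         (auto simp: norm_mult intro: mult_left_mono G)
    have perC': "C (i - ?c m) (j - ?c m) = C i j" and perB': "B (i - ?c m) (j - ?c m) = B i j" for i j m
      using perC[of "i - ?c m" m "j - ?c m"] perB[of "i - ?c m" m "j - ?c m"] by simp_all
    have eq: "(\<Sum>k\<in>{s..<?T m}. M s t m i k * C k j) - (\<Sum>\<^sub>\<infinity>k. B i k * C k j) - KL' s i j - KR' t (i - ?c m) (j - ?c m)
        = ?e1 m i j + - (?e2 m i j + ?e3 m i j)" if ij: "i \<in> {s..<?T m}" "j \<in> {s..<?T m}" for i j m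
    proof -
      have sT: "s \<le> ?T m" using ij by auto
      have r1: "(\<Sum>\<^sub>\<infinity>k\<in>{..<t}. KR t (i - ?c m) k * C k (j - ?c m)) = (\<Sum>\<^sub>\<infinity>k\<in>{..<?T m}. ?KR m i k * C k j)"
        by (rule infsum_reindex_bij_witness[of _ "\<lambda>k. k - ?c m" "\<lambda>k. k + ?c m"]) (use perC'[of "k + ?c m" m j for k] in auto)
      have r2: "(\<Sum>\<^sub>\<infinity>k\<in>{t..}. B (i - ?c m) k * C k (j - ?c m)) = (\<Sum>\<^sub>\<infinity>k\<in>{?T m..}. B i k * C k j)"
        by (rule infsum_reindex_bij_witness[of _ "\<lambda>k. k - ?c m" "\<lambda>k. k + ?c m"]) (use perC'[of "k + ?c m" m j for k] perB'[of i m "k + ?c m" for k] in auto)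
      have L: "KL' s i j = (\<Sum>\<^sub>\<infinity>k\<in>{s..}. KL s i k * C k j) - (\<Sum>\<^sub>\<infinity>k\<in>{..<s}. B i k * C k j)"
        using ij by (simp add: KL'_def)
      have R: "KR' t (i - ?c m) (j - ?c m) = (\<Sum>\<^sub>\<infinity>k\<in>{..<?T m}. ?KR m i k * C k j) - (\<Sum>\<^sub>\<infinity>k\<in>{?T m..}. B i k * C k j)"
        using ij r1 r2 by (simp add: KR'_def)
      have Meq: "(\<Sum>k\<in>{s..<?T m}. M s t m i k * C k j) = ?e1 m i j + (\<Sum>k\<in>{s..<?T m}. B i k * C k j) + (\<Sum>k\<in>{s..<?T m}. KL s i k * C k j) + (\<Sum>k\<in>{s..<?T m}. ?KR m i k * C k j)"
        unfolding sum.distrib[symmetric] by (intro sum.cong refl) (simp add: algebra_simps)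
      show ?thesis unfolding Meq L R infsum_int_split(3)[OF sB sT] infsum_int_split(1)[OF sK[OF KL] sT] infsum_int_split(2)[OF sK[OF KRm] sT]
        by simp
    qed
    have "?err m = box_norm s (?T m) (\<lambda>i j. ?e1 m i j + - (?e2 m i j + ?e3 m i j))" for m
      by (intro sum.cong refl arg_cong[of _ _ norm] eq)
    moreover have "box_norm s (?T m) (\<lambda>i j. ?e1 m i j + - (?e2 m i j + ?e3 m i j)) \<le> box_norm s (?T m) (?e1 m) + (box_norm s (?T m) (?e2 m) + box_norm s (?T m) (?e3 m))" for m
      by (rule order_trans[OF box_norm_add_le]) (use box_norm_add_le[of "?e2 m" "?e3 m" s "?T m"] in \<open>simp add: norm_minus_cancel del: minus_add_distrib\<close>)
    ultimately have err_le: "?err m \<le> box_norm s (?T m) (?e1 m) + (box_norm s (?T m) (?e2 m) + box_norm s (?T m) (?e3 m))" for m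
      by simp
    have e1: "(\<lambda>m. box_norm s (?T m) (?e1 m)) \<longlonglongrightarrow> 0"
    proof (rule tendsto_sandwich[OF _ _ tendsto_const])
      show "(\<lambda>m. box_norm s (?T m) (?E m) * G) \<longlonglongrightarrow> 0"
        using tendsto_mult[OF lim tendsto_const[of G]] by simp
      have "box_norm s (?T m) (?e1 m) \<le> box_norm s (?T m) (?E m) * G" for m
      proof -
        have "box_norm s (?T m) (?e1 m) \<le> (\<Sum>k\<in>{s..<?T m}. (\<Sum>i\<in>{s..<?T m}. norm (?E m i k)) * (\<Sum>j\<in>{s..<?T m}. norm (C k j)))"
          by (rule box_norm_product_le)
        also have "\<dots> \<le> (\<Sum>k\<in>{s..<?T m}. (\<Sum>i\<in>{s..<?T m}. norm (?E m i k)) * G)"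
          by (intro sum_mono mult_left_mono G sum_nonneg) auto
        also have "\<dots> = (\<Sum>k\<in>{s..<?T m}. \<Sum>i\<in>{s..<?T m}. norm (?E m i k)) * G" by (simp only: sum_distrib_right)
        also have "(\<Sum>k\<in>{s..<?T m}. \<Sum>i\<in>{s..<?T m}. norm (?E m i k)) = box_norm s (?T m) (?E m)" by (rule sum.swap)
        finally show ?thesis .
      qed
      then show "\<forall>\<^sub>F m in sequentially. box_norm s (?T m) (?e1 m) \<le> box_norm s (?T m) (?E m) * G" by simp
    qed (auto intro!: always_eventually box_norm_nonneg)
    have tend0: "f \<longlonglongrightarrow> 0" if f0: "\<And>m. f m \<ge> 0" and fe: "\<And>e. e > 0 \<Longrightarrow> \<exists>m0. \<forall>m\<ge>m0. f m \<le> G * e" for f :: "nat \<Rightarrow> real"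
    proof (rule LIMSEQ_I)
      fix r :: real assume r: "r > 0"
      define e where "e = r / (2 * (G + 1))"
      have "e > 0" using r G(1) by (simp add: e_def)
      then obtain m0 where m0: "\<forall>m\<ge>m0. f m \<le> G * e" using fe by blast
      have "G * e \<le> (G + 1) * e" using \<open>e > 0\<close> by simp
      also have "\<dots> = r / 2" using G(1) by (simp add: e_def divide_simps)
      also have "\<dots> < r" using r by simp
      finally show "\<exists>m0. \<forall>m\<ge>m0. norm (f m - 0) < r" using m0 f0 by (intro exI[of _ m0]) fastforce
    qed
    have cm: "?c m \<ge> int m" for m using N by (simp add: mult_le_cancel_left1)
    have e2: "(\<lambda>m. box_norm s (?T m) (?e2 m)) \<longlonglongrightarrow> 0"
    proof (rule tend0[OF box_norm_nonneg])
      fix e :: real assume "e > 0"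
      then obtain R where R: "R \<ge> 0" "\<And>X. finite X \<Longrightarrow> (\<And>i j. (i, j) \<in> X \<Longrightarrow> \<bar>i\<bar> \<ge> R \<or> \<bar>j\<bar> \<ge> R) \<Longrightarrow> (\<Sum>(i, j)\<in>X. norm (KL s i j)) \<le> e"
        using l1_kernel_tail[OF KL] by metis
      have "box_norm s (?T m) (?e2 m) \<le> G * e" if m: "m \<ge> nat (R - t)" for m
      proof (rule norm_contraction_tail_le[OF KL G(2,3)])
        fix F assume F: "finite F" "F \<subseteq> {s..<?T m} \<times> {?T m..}"
        show "(\<Sum>(i, k)\<in>F. norm (KL s i k)) \<le> e"
          by (rule R(2)[OF F(1)]) (use F m cm[of m] in \<open>auto dest!: subsetD\<close>)
      qed auto
      then show "\<exists>m0. \<forall>m\<ge>m0. box_norm s (?T m) (?e2 m) \<le> G * e" by blast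
    qed
    have e3: "(\<lambda>m. box_norm s (?T m) (?e3 m)) \<longlonglongrightarrow> 0"
    proof (rule tend0[OF box_norm_nonneg])
      fix e :: real assume "e > 0"
      then obtain R where R: "R \<ge> 0" "\<And>X. finite X \<Longrightarrow> (\<And>i j. (i, j) \<in> X \<Longrightarrow> \<bar>i\<bar> \<ge> R \<or> \<bar>j\<bar> \<ge> R) \<Longrightarrow> (\<Sum>(i, j)\<in>X. norm (KR t i j)) \<le> e"
        using l1_kernel_tail[OF KR] by metis
      have "box_norm s (?T m) (?e3 m) \<le> G * e" if m: "m \<ge> nat (R + s)" for m
      proof (rule norm_contraction_tail_le[OF KRm G(2,3)])
        fix F assume F: "finite F" "F \<subseteq> {s..<?T m} \<times> {..<s}"
        have "(\<Sum>(i, k)\<in>F. norm (?KR m i k)) = (\<Sum>(i, k)\<in>(\<lambda>(i, k). (i - ?c m, k - ?c m)) ` F. norm (KR t i k))"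
          by (subst sum.reindex) (auto simp: inj_on_def intro!: sum.cong)
        also have "\<dots> \<le> e"
          by (rule R(2)) (use F m cm[of m] in \<open>auto dest!: subsetD\<close>)
        finally show "(\<Sum>(i, k)\<in>F. norm (?KR m i k)) \<le> e" .
      qed auto
      then show "\<exists>m0. \<forall>m\<ge>m0. box_norm s (?T m) (?e3 m) \<le> G * e" by blast
    qed
    have "(\<lambda>m. box_norm s (?T m) (?e1 m) + (box_norm s (?T m) (?e2 m) + box_norm s (?T m) (?e3 m))) \<longlonglongrightarrow> 0"
      using tendsto_add[OF e1 tendsto_add[OF e2 e3]] by simp
    then show ?thesis
      by (rule tendsto_sandwich[OF always_eventually[OF allI[OF box_norm_nonneg]] always_eventually[OF allI[OF err_le]] tendsto_const])
  qed
  show ?thesis unfolding boundary_form_def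
    by (intro exI[of _ KL'] exI[of _ KR'] conjI allI l1 lim')
qed

section \<open>Block Laurent matrices\<close>

lemma nat_mod_less: "N \<ge> 1 \<Longrightarrow> nat (x mod int N) < N"
  using pos_mod_bound[of "int N" x] pos_mod_sign[of "int N" x] by linarith

lemma nat_mod_eq_iff: "N \<ge> 1 \<Longrightarrow> nat (x mod int N) = y \<longleftrightarrow> x mod int N = int y"
  using pos_mod_sign[of "int N" x] by (metis int_nat_eq nat_int of_nat_0_less_iff less_eq_Suc_le One_nat_def)

lemma nat_mod_eq_nat_mod_iff:
  "N \<ge> 1 \<Longrightarrow> nat (x mod int N) = nat (y mod int N) \<longleftrightarrow> x mod int N = y mod int N"
  by (simp add: eq_nat_nat_iff)

lemma laurent_entry_eq:
  assumes "N \<ge> 1"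
  shows "laurent_entry N b r s =
    fourier_coeff (\<lambda>t. b t $$ (nat (r mod int N), nat (s mod int N))) (r div int N - s div int N)"
proof -
  show ?thesis using nat_mod_less[OF assms] by (simp add: laurent_entry_def fourier_coeff_mat_def)
qed

lemma laurent_entry_periodic:
  assumes "N \<ge> 1"
  shows "laurent_entry N b (r + int m * int N) (s + int m * int N) = laurent_entry N b r s"
  using assms by (simp add: laurent_entry_eq)

lemma laurent_entry_cong:
  assumes "\<And>t. t \<in> sphere 0 1 \<Longrightarrow> b t = b' t"
  shows "laurent_entry N b = laurent_entry N b'"
  unfolding laurent_entry_def fourier_coeff_mat_def
  by (intro ext arg_cong2[of _ _ _ _ "($$)"] cong_mat refl) (auto intro!: fourier_coeff_cong simp: assms)

text \<open>
  The block distance of two scalar indices depends on more than their difference, but takes at most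
  two values for a given difference; this yields a majorant that is a function of \<open>i - j\<close>.
\<close>

lemma div_diff_cases:
  fixes r s :: int
  assumes "n > 0"
  shows "r div n - s div n = (r - s) div n \<or> r div n - s div n = (r - s) div n + 1"
proof -
  have eq: "r - s = n * (r div n - s div n) + (r mod n - s mod n)"
    by (simp add: algebra_simps minus_mod_eq_mult_div[symmetric])
  have b: "0 \<le> r mod n" "r mod n < n" "0 \<le> s mod n" "s mod n < n" using assms by auto
  show ?thesis
  proof (cases "r mod n \<ge> s mod n")
    case True
    then have "(r - s) div n = r div n - s div n" using eq b by (intro int_div_pos_eq[where r = "r mod n - s mod n"]) linarith+
    then show ?thesis by simp
  next
    case False
    have "r - s = n * (r div n - s div n - 1) + (n + r mod n - s mod n)" using eq by (simp add: algebra_simps)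
    then have "(r - s) div n = r div n - s div n - 1" using False b by (intro int_div_pos_eq[where r = "n + r mod n - s mod n"]) linarith+
    then show ?thesis by simp
  qed
qed

lemma summable_on_finite_sum:
  fixes f :: "'i \<Rightarrow> 'a \<Rightarrow> real"
  assumes "finite I" "\<And>i. i \<in> I \<Longrightarrow> f i summable_on A"
  shows "(\<lambda>x. \<Sum>i\<in>I. f i x) summable_on A"
  using assms by (induction I rule: finite_induct) (auto intro: summable_on_add)

context wiener_exponents begin

lemma weight_block_le:
  assumes N: "N \<ge> 1" and r: "0 \<le> r" "r < int N"
  shows "w (k * int N + r) \<le> real N * w k"
proof -
  have pw: "x powr a \<le> real N * y powr a" if "0 \<le> x" "x \<le> real N * y" "0 \<le> y" "0 \<le> a" "a \<le> 1" for x y a :: real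
  proof -
    have "x powr a \<le> (real N * y) powr a" using that by (intro powr_mono2) auto
    also have "\<dots> = real N powr a * y powr a" using that by (simp add: powr_mult)
    also have "\<dots> \<le> real N powr 1 * y powr a" using N that by (intro mult_right_mono powr_mono) auto
    finally show ?thesis by simp
  qed
  show ?thesis
  proof (cases "k \<ge> 0")
    case True
    have "real_of_int r \<le> real N - 1" using r by linarith
    then have "1 + (real_of_int k * real N + real_of_int r) \<le> real N * (1 + real_of_int k)"
      by (simp add: algebra_simps)
    moreover have "k * int N + r \<ge> 0" using True r by simp
    ultimately show ?thesis using True r nonneg sum1
      by (simp add: wiener_weight_def pw)
  next
    case False
    then have "k * int N \<le> - 1 * int N" by (intro mult_right_mono) auto
    then have neg: "k * int N + r < 0" using r by linarith
    have "real_of_int r \<ge> 0" using r by simp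
    moreover have "real N \<ge> 1" using N by simp
    moreover have "real_of_int (k * int N + r) < 0" using neg by linarith
    ultimately have le: "1 + real_of_int \<bar>k * int N + r\<bar> \<le> real N * (1 + real_of_int \<bar>k\<bar>)"
      using False by (simp add: algebra_simps)
    have wx: "w x = (1 + real_of_int \<bar>x\<bar>) powr \<alpha>2" if "x < 0" for x
      using that by (simp add: wiener_weight_def)
    have "k < 0" using False by simp
    show ?thesis unfolding wx[OF neg] wx[OF \<open>k < 0\<close>] by (rule pw[OF _ le]) (use nonneg sum1 in auto)
  qed
qed

lemma block_weighted_summable:
  fixes \<rho> :: "int \<Rightarrow> real"
  assumes N: "N \<ge> 1" and \<rho>: "(\<lambda>k. w k * \<rho> k) summable_on UNIV" "\<And>k. \<rho> k \<ge> 0"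
  shows "(\<lambda>n. w n * \<rho> (n div int N + e)) summable_on UNIV"
proof -
  have "(\<lambda>k. w (k + e) * \<rho> (k + e)) summable_on UNIV"
    using summable_on_reindex_bij_witness[of UNIV "\<lambda>k. k + e" "\<lambda>k. k - e" UNIV "\<lambda>k. w (k + e) * \<rho> (k + e)" "\<lambda>k. w k * \<rho> k"] \<rho>(1) by auto
  then have "(\<lambda>k. w (- e) * (w (k + e) * \<rho> (k + e))) summable_on UNIV"
    by (rule summable_on_cmult_right)
  then have "(\<lambda>k. w k * \<rho> (k + e)) summable_on UNIV"
  proof (rule summable_on_comparison_test)
    show "w k * \<rho> (k + e) \<le> w (- e) * (w (k + e) * \<rho> (k + e))" for k
      using mult_right_mono[OF weight_submult[of "- e" "k + e"] \<rho>(2)[of "k + e"]] by (simp add: mult.assoc)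
  qed (auto simp: \<rho>)
  then have "(\<lambda>k. real N * (w k * \<rho> (k + e))) summable_on UNIV" by (rule summable_on_cmult_right)
  from has_sum_product[OF this _ summable_on_finite[of "{0..<int N}" "\<lambda>_. 1"]]
  have "(\<lambda>(k, r). real N * (w k * \<rho> (k + e)) * 1) summable_on (UNIV \<times> {0..<int N})"
    by (intro has_sum_imp_summable) (auto simp: \<rho>)
  then have "(\<lambda>(k, r). w (k * int N + r) * \<rho> (k + e)) summable_on (UNIV \<times> {0..<int N})"
    by (rule summable_on_comparison_test)
       (use weight_block_le[OF N] mult_right_mono[OF weight_block_le[OF N] \<rho>(2)] in \<open>auto simp: \<rho> mult.assoc\<close>)
  moreover have "(\<lambda>(k, r). w (k * int N + r) * \<rho> (k + e)) summable_on (UNIV \<times> {0..<int N}) \<longleftrightarrow>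
      (\<lambda>n. w n * \<rho> (n div int N + e)) summable_on UNIV"
    by (rule summable_on_reindex_bij_witness[of _ "\<lambda>n. (n div int N, n mod int N)" "\<lambda>(k, r). k * int N + r"])
       (use N in auto)
  ultimately show ?thesis by blast
qed

abbreviation "WM N \<equiv> wiener_mat N \<alpha>1 \<alpha>2"

lemma wiener_matD:
  assumes "b \<in> WM N"
  shows "t \<in> sphere 0 1 \<Longrightarrow> b t \<in> carrier_mat N N" "p < N \<Longrightarrow> q < N \<Longrightarrow> (\<lambda>t. b t $$ (p, q)) \<in> W"
  using assms by (auto simp: wiener_mat_def)

lemma off_diagonal_decay_laurent:
  assumes N: "N \<ge> 1" and b: "b \<in> WM N"
  shows "off_diagonal_decay \<alpha>1 \<alpha>2 (laurent_entry N b)"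
proof -
  define \<rho> where "\<rho> = (\<lambda>k. \<Sum>p<N. \<Sum>q<N. norm (fourier_coeff (\<lambda>t. b t $$ (p, q)) k))"
  have \<rho>0: "\<rho> k \<ge> 0" for k unfolding \<rho>_def by (intro sum_nonneg) auto
  have \<rho>s: "(\<lambda>k. w k * \<rho> k) summable_on UNIV"
    unfolding \<rho>_def sum_distrib_left
    by (intro summable_on_finite_sum wiener_weighted_summable wiener_matD(2)[OF b]) auto
  let ?\<beta> = "\<lambda>n. \<rho> (n div int N + 0) + \<rho> (n div int N + 1)"
  have "(\<lambda>n. w n * \<rho> (n div int N + 0) + w n * \<rho> (n div int N + 1)) summable_on UNIV"
    by (intro summable_on_add block_weighted_summable[OF N \<rho>s \<rho>0])
  then have 1: "(\<lambda>n. w n * ?\<beta> n) summable_on UNIV" by (simp only: distrib_left)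
  have "norm (laurent_entry N b i j) \<le> ?\<beta> (i - j)" for i j
  proof -
    note m = nat_mod_less[OF N]
    have "norm (laurent_entry N b i j) \<le> (\<Sum>q<N. norm (fourier_coeff (\<lambda>t. b t $$ (nat (i mod int N), q)) (i div int N - j div int N)))"
      unfolding laurent_entry_eq[OF N] by (rule member_le_sum[of "nat (j mod int N)"]) (use m in auto)
    also have "\<dots> \<le> \<rho> (i div int N - j div int N)"
      unfolding \<rho>_def by (rule member_le_sum[of "nat (i mod int N)"]) (use m in \<open>auto intro: sum_nonneg\<close>)
    also have "\<dots> \<le> ?\<beta> (i - j)"
      using div_diff_cases[of "int N" i j] N \<rho>0 by (auto simp: add_increasing add_increasing2)
    finally show ?thesis .
  qed
  then show ?thesis unfolding off_diagonal_decay_def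
    using 1 \<rho>0 by (intro exI[of _ ?\<beta>]) (auto intro: add_nonneg_nonneg)
qed

lemma wiener_mat_mult:
  assumes b: "b \<in> WM N" and c: "c \<in> WM N"
  shows "(\<lambda>t. b t * c t) \<in> WM N"
    "\<And>t p q. t \<in> sphere 0 1 \<Longrightarrow> p < N \<Longrightarrow> q < N \<Longrightarrow> (b t * c t) $$ (p, q) = (\<Sum>k<N. b t $$ (p, k) * c t $$ (k, q))"
proof -
  show e: "(b t * c t) $$ (p, q) = (\<Sum>k<N. b t $$ (p, k) * c t $$ (k, q))" if "t \<in> sphere 0 1" "p < N" "q < N" for t p q
    using wiener_matD(1)[OF b that(1)] wiener_matD(1)[OF c that(1)] that
    by (auto simp: scalar_prod_def atLeast0LessThan)
  have "(\<lambda>t. (b t * c t) $$ (p, q)) \<in> W" if "p < N" "q < N" for p q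
    by (rule wiener_transfer[OF _ e]) (use that in \<open>auto intro!: wiener_sum wiener_mult(1) wiener_matD(2)[OF b] wiener_matD(2)[OF c]\<close>)
  then show "(\<lambda>t. b t * c t) \<in> WM N"
    using wiener_matD(1)[OF b] wiener_matD(1)[OF c] by (auto simp: wiener_mat_def intro!: mult_carrier_mat)
qed

lemma laurent_entry_mult:
  assumes N: "N \<ge> 1" and b: "b \<in> WM N" and c: "c \<in> WM N"
  shows "laurent_entry N (\<lambda>t. b t * c t) i j = (\<Sum>\<^sub>\<infinity>k. laurent_entry N b i k * laurent_entry N c k j)"
proof -
  note m = nat_mod_less[OF N]
  define p q I J where "p = nat (i mod int N)" "q = nat (j mod int N)" "I = i div int N" "J = j div int N"
  have pq: "p < N" "q < N" using m by (auto simp: p_q_I_J_def)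
  let ?f = "\<lambda>l k. fourier_coeff (\<lambda>t. b t $$ (p, l)) (I - k) * fourier_coeff (\<lambda>t. c t $$ (l, q)) (k - J)"
  have hs: "(?f l has_sum fourier_coeff (\<lambda>t. b t $$ (p, l) * c t $$ (l, q)) (I - J)) UNIV" if l: "l < N" for l
  proof -
    have "((\<lambda>k. fourier_coeff (\<lambda>t. c t $$ (l, q)) k * fourier_coeff (\<lambda>t. b t $$ (p, l)) (I - J - k)) has_sum fourier_coeff (\<lambda>t. b t $$ (p, l) * c t $$ (l, q)) (I - J)) UNIV"
      by (rule wiener_mult(3)[OF wiener_matD(2)[OF b] wiener_matD(2)[OF c]]) (use pq l in auto)
    then show ?thesis
      using has_sum_reindex_bij_witness[of UNIV "\<lambda>k. k + J" "\<lambda>k. k - J" UNIV "\<lambda>k. fourier_coeff (\<lambda>t. c t $$ (l, q)) k * fourier_coeff (\<lambda>t. b t $$ (p, l)) (I - J - k)" "?f l"]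
      by (auto simp: algebra_simps)
  qed
  have s: "(\<lambda>k. laurent_entry N b i k * laurent_entry N c k j) summable_on UNIV"
    by (rule abs_summable_summable, rule decay_product_summable[OF off_diagonal_decay_laurent[OF N b] off_diagonal_decay_laurent[OF N c] nonneg])
  let ?g = "\<lambda>(l, k). ?f l k"
  have re: "(\<lambda>k. laurent_entry N b i k * laurent_entry N c k j) summable_on UNIV \<longleftrightarrow> ?g summable_on ({..<N} \<times> UNIV)"
    by (rule summable_on_reindex_bij_witness[of _ "\<lambda>(l, k). k * int N + int l" "\<lambda>k. (nat (k mod int N), k div int N)"])
       (use N m in \<open>auto simp: laurent_entry_eq p_q_I_J_def\<close>)
  have re': "infsum (\<lambda>k. laurent_entry N b i k * laurent_entry N c k j) UNIV = infsum ?g ({..<N} \<times> UNIV)"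
    by (rule infsum_reindex_bij_witness[of _ "\<lambda>(l, k). k * int N + int l" "\<lambda>k. (nat (k mod int N), k div int N)"])
       (use N m in \<open>auto simp: laurent_entry_eq p_q_I_J_def\<close>)
  have fsum: "fourier_coeff (\<lambda>t. \<Sum>l\<in>L. b t $$ (p, l) * c t $$ (l, q)) n = (\<Sum>l\<in>L. fourier_coeff (\<lambda>t. b t $$ (p, l) * c t $$ (l, q)) n)"
    if "finite L" "L \<subseteq> {..<N}" for L n
    using that
  proof (induction L rule: finite_induct)
    case empty
    then show ?case using fourier_coeff_const[of 0] by simp
  next
    case (insert l L)
    have "(\<lambda>t. b t $$ (p, l) * c t $$ (l, q)) \<in> W" if "l < N" for l
      using that pq by (intro wiener_mult(1) wiener_matD(2)[OF b] wiener_matD(2)[OF c]) auto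
    then show ?case using insert
      by (simp add: fourier_coeff_add wiener_continuous wiener_sum subset_iff)
  qed
  have "laurent_entry N (\<lambda>t. b t * c t) i j = fourier_coeff (\<lambda>t. (b t * c t) $$ (p, q)) (I - J)"
    by (simp add: laurent_entry_eq[OF N] p_q_I_J_def)
  also have "\<dots> = fourier_coeff (\<lambda>t. \<Sum>l<N. b t $$ (p, l) * c t $$ (l, q)) (I - J)"
    by (rule fourier_coeff_cong) (use wiener_mat_mult(2)[OF b c] pq in auto)
  also have "\<dots> = (\<Sum>l<N. \<Sum>\<^sub>\<infinity>k. ?f l k)"
    using infsumI[OF hs] by (subst fsum) auto
  also have "\<dots> = infsum ?g ({..<N} \<times> UNIV)"
    using infsum_Sigma'_banach[of ?f "{..<N}" "\<lambda>_. UNIV"] re s by simp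
  finally show ?thesis by (simp add: re')
qed

section \<open>Column operations\<close>

lemma det_wiener:
  assumes A: "\<And>t. t \<in> sphere 0 1 \<Longrightarrow> A t \<in> carrier_mat n n"
    and e: "\<And>i j. i < n \<Longrightarrow> j < n \<Longrightarrow> (\<lambda>t. A t $$ (i, j)) \<in> W"
  shows "(\<lambda>t. Determinant.det (A t)) \<in> W"
proof (rule wiener_transfer)
  show "(\<lambda>t. \<Sum>p | p permutes {0..<n}. signof p * (\<Prod>i = 0..<n. A t $$ (i, p i))) \<in> W"
    by (intro wiener_sum wiener_cmult wiener_prod e) (auto simp: permutes_in_image)
qed (rule det_def'[OF A])

text \<open>
  The symbol \<open>b\<close>, with logarithm \<open>lb\<close> of its determinant, has been obtained from \<open>a\<close> by
  multiplications that are visible in the determinants of the sections: some family \<open>M\<close> with symbol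
  \<open>b\<close> has the determinants of the sections of \<open>a\<close>, up to the growth recorded by \<open>lb\<close> and nonzero
  factors that depend on one end each. The sections of \<open>b\<close> itself would not do, since they differ from
  \<open>M\<close> by the corner corrections.
\<close>

definition section_reduct :: "nat \<Rightarrow> (complex \<Rightarrow> complex mat) \<Rightarrow> (complex \<Rightarrow> complex) \<Rightarrow> (complex \<Rightarrow> complex mat) \<Rightarrow> (complex \<Rightarrow> complex) \<Rightarrow> bool" where
  "section_reduct N a lg b lb \<longleftrightarrow> b \<in> WM N \<and> continuous_on (sphere 0 1) lb \<and>
     (\<forall>t\<in>sphere 0 1. Determinant.det (b t) = exp (lb t)) \<and>
     (\<exists>M e1 e2. boundary_form N (laurent_entry N b) M \<and> (\<forall>s. e1 s \<noteq> 0) \<and> (\<forall>t. e2 t \<noteq> 0) \<and>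
       (\<forall>s t m. s \<le> t + int m * int N \<longrightarrow>
         Determinant.det (finsec s (t + int m * int N) (M s t m)) =
         Determinant.det (finsec s (t + int m * int N) (laurent_entry N a)) *
         exp (of_nat m * (fourier_coeff lb 0 - fourier_coeff lg 0)) * e1 s * e2 t))"

lemma reduct_cong:
  assumes r: "section_reduct N a lg b lb" and b: "\<And>t. t \<in> sphere 0 1 \<Longrightarrow> b' t = b t" and lb: "\<And>t. t \<in> sphere 0 1 \<Longrightarrow> lb' t = lb t"
  shows "section_reduct N a lg b' lb'"
proof -
  have "laurent_entry N b' = laurent_entry N b" by (rule laurent_entry_cong[OF b])
  moreover have "fourier_coeff lb' 0 = fourier_coeff lb 0" by (rule fourier_coeff_cong[OF lb])
  moreover have "continuous_on (sphere 0 1) lb' \<longleftrightarrow> continuous_on (sphere 0 1) lb" by (rule continuous_on_cong[OF refl lb])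
  moreover have "b' \<in> WM N \<longleftrightarrow> b \<in> WM N"
    using b wiener_cong[of "\<lambda>t. b' t $$ (p, q)" "\<lambda>t. b t $$ (p, q)" for p q] by (simp add: wiener_mat_def)
  ultimately show ?thesis using r b lb unfolding section_reduct_def by simp
qed

lemma reduct_refl:
  assumes "a \<in> WM N" "continuous_on (sphere 0 1) lg" "\<And>t. t \<in> sphere 0 1 \<Longrightarrow> Determinant.det (a t) = exp (lg t)"
  shows "section_reduct N a lg a lg"
proof -
  have "boundary_form N (laurent_entry N a) (\<lambda>s t m. laurent_entry N a)"
    unfolding boundary_form_def by (intro exI[of _ "\<lambda>_ _ _. 0"]) (auto simp: l1_kernel_def case_prod_unfold)
  then show ?thesis unfolding section_reduct_def using assms
    by (intro conjI ballI exI[of _ "\<lambda>s t m. laurent_entry N a"] exI[of _ "\<lambda>_. 1"]) auto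
qed

text \<open>
  If the Laurent matrix of \<open>c\<close> is triangular, the determinant of its section is the product of the
  diagonal entries. The function \<open>f\<close> is a primitive of the diagonal: the product telescopes to
  \<open>f (t + m N) / f s\<close>, which splits into a factor for each end and the growth in \<open>m\<close>.
\<close>

lemma reduct_mult:
  assumes N: "N \<ge> 1" and r: "section_reduct N a lg b lb"
    and c: "c \<in> WM N" and l: "continuous_on (sphere 0 1) l" "\<And>t. t \<in> sphere 0 1 \<Longrightarrow> Determinant.det (c t) = exp (l t)"
    and tri: "(\<forall>i j. i < j \<longrightarrow> laurent_entry N c i j = 0) \<or> (\<forall>i j. j < i \<longrightarrow> laurent_entry N c i j = 0)"
    and diag: "\<And>k. laurent_entry N c k k * f k = f (k + 1)" and f0: "\<And>k. f k \<noteq> 0"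
    and f: "\<And>t m. f (t + int m * int N) = f t * exp (of_nat m * fourier_coeff l 0)"
  shows "section_reduct N a lg (\<lambda>t. b t * c t) (\<lambda>t. lb t + l t)"
proof -
  obtain M e1 e2 where M: "boundary_form N (laurent_entry N b) M" and e: "\<And>s. e1 s \<noteq> 0" "\<And>t. e2 t \<noteq> 0"
    and det: "\<And>s t m. s \<le> t + int m * int N \<Longrightarrow>
         Determinant.det (finsec s (t + int m * int N) (M s t m)) =
         Determinant.det (finsec s (t + int m * int N) (laurent_entry N a)) *
         exp (of_nat m * (fourier_coeff lb 0 - fourier_coeff lg 0)) * e1 s * e2 t"
    using r unfolding section_reduct_def by blast
  have b: "b \<in> WM N" "continuous_on (sphere 0 1) lb" "\<And>t. t \<in> sphere 0 1 \<Longrightarrow> Determinant.det (b t) = exp (lb t)"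
    using r unfolding section_reduct_def by auto
  let ?M = "\<lambda>s t m i j. \<Sum>k\<in>{s..<t + int m * int N}. M s t m i k * laurent_entry N c k j"
  have "boundary_form N (\<lambda>i j. \<Sum>\<^sub>\<infinity>k. laurent_entry N b i k * laurent_entry N c k j) ?M"
    by (rule boundary_form_mult[OF M N nonneg sum1 off_diagonal_decay_laurent[OF N b(1)] off_diagonal_decay_laurent[OF N c]])
       (rule laurent_entry_periodic[OF N])+
  then have bf: "boundary_form N (laurent_entry N (\<lambda>t. b t * c t)) ?M"
    unfolding laurent_entry_mult[OF N b(1) c, abs_def] .
  have prod: "(\<Prod>k\<in>{s..<t}. laurent_entry N c k k) = f t / f s" if "s \<le> t" for s t
    using that
  proof (induction t rule: int_ge_induct)
    case base
    then show ?case using f0 by simp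
  next
    case (step i)
    have "{s..<i + 1} = insert i {s..<i}" using step.hyps by auto
    moreover have "laurent_entry N c i i * (f i / f s) = f (i + 1) / f s" using diag[of i] by simp
    ultimately show ?case using step by simp
  qed
  have detc: "Determinant.det (finsec s t (laurent_entry N c)) = f t / f s" if "s \<le> t" for s t
    using tri prod[OF that] det_finsec_lower_triangular[of "laurent_entry N c" s t] det_finsec_upper_triangular[of "laurent_entry N c" s t]
    by auto
  have fl: "fourier_coeff (\<lambda>t. lb t + l t) 0 = fourier_coeff lb 0 + fourier_coeff l 0"
    by (rule fourier_coeff_add[OF b(2) l(1)])
  have "Determinant.det (finsec s (t + int m * int N) (?M s t m)) =
         Determinant.det (finsec s (t + int m * int N) (laurent_entry N a)) *
         exp (of_nat m * (fourier_coeff (\<lambda>t. lb t + l t) 0 - fourier_coeff lg 0)) * (e1 s / f s) * (e2 t * f t)"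
    if "s \<le> t + int m * int N" for s t m
  proof -
    have "exp (of_nat m * (fourier_coeff (\<lambda>t. lb t + l t) 0 - fourier_coeff lg 0)) =
      exp (of_nat m * (fourier_coeff lb 0 - fourier_coeff lg 0)) * exp (of_nat m * fourier_coeff l 0)"
      unfolding fl exp_add[symmetric] by (simp add: algebra_simps)
    then show ?thesis
      unfolding det_finsec_mult det[OF that] detc[OF that] f by simp
  qed
  moreover have "e1 s / f s \<noteq> 0" "e2 t * f t \<noteq> 0" for s t using e f0 by simp_all
  moreover have "Determinant.det (b t * c t) = exp (lb t + l t)" if "t \<in> sphere 0 1" for t
    using det_mult[OF wiener_matD(1)[OF b(1) that] wiener_matD(1)[OF c that]] b(3)[OF that] l(2)[OF that] by (simp add: exp_add)
  ultimately show ?thesis unfolding section_reduct_def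
    using bf wiener_mat_mult(1)[OF b(1) c] b(2) l(1)
    by (intro conjI ballI exI[of _ ?M] exI[of _ "\<lambda>s. e1 s / f s"] exI[of _ "\<lambda>t. e2 t * f t"] allI impI)
       (auto intro!: continuous_intros)
qed

lemma residue_order:
  fixes r s :: int
  assumes N: "N > 0"
  shows "r div N < s div N \<Longrightarrow> r < s" "r div N = s div N \<Longrightarrow> r mod N < s mod N \<Longrightarrow> r < s"
    "r div N = s div N \<Longrightarrow> r mod N = s mod N \<Longrightarrow> r = s"
proof -
  show "r div N < s div N \<Longrightarrow> r < s" using N zdiv_mono1[of s r N] by (meson not_le)
  show "r div N = s div N \<Longrightarrow> r mod N < s mod N \<Longrightarrow> r < s" by (metis add_strict_left_mono mult_div_mod_eq)
  show "r div N = s div N \<Longrightarrow> r mod N = s mod N \<Longrightarrow> r = s" by (metis mult_div_mod_eq)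
qed

text \<open>
  The nonzero entries outside the diagonal join the residues \<open>p\<close> (row) and \<open>q\<close> (column). At frequency
  \<open>0\<close> such an entry lies below the diagonal exactly if \<open>q < p\<close>, so this decides to which of the two
  triangular factors the constant term of \<open>h\<close> belongs.
\<close>

lemma reduct_addcol_half:
  assumes N: "N \<ge> 1" and r: "section_reduct N a lg b lb" and p: "p < N" and q: "q < N" and pq: "p \<noteq> q" and h: "h \<in> W"
    and supp: "(\<forall>k. k < (if q < p then 0 else 1) \<longrightarrow> fourier_coeff h k = 0) \<or> (\<forall>k. k \<ge> (if q < p then 0 else 1) \<longrightarrow> fourier_coeff h k = 0)"
  shows "section_reduct N a lg (\<lambda>t. b t * addrow_mat N (h t) p q) lb"
proof -
  let ?c = "\<lambda>t. addrow_mat N (h t) p q"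
  note m = nat_mod_less[OF N]
  have eq: "?c t $$ (i, j) = (if i = p \<and> j = q then h t else if i = j then 1 else 0)" if "i < N" "j < N" for t i j
    using that pq by (auto simp: addrow_mat_def)
  have "(\<lambda>t. ?c t $$ (i, j)) \<in> W" if "i < N" "j < N" for i j
    unfolding eq[OF that] using h by (cases "i = p"; cases "j = q"; cases "i = j") (simp_all add: wiener_const)
  then have c: "?c \<in> WM N"
    unfolding wiener_mat_def by (intro CollectI conjI ballI allI impI addrow_mat_carrier)
  have le: "laurent_entry N ?c i j = (if i mod int N = int p \<and> j mod int N = int q then fourier_coeff h (i div int N - j div int N) else if i = j then 1 else 0)" for i j
  proof -
    note mi = nat_mod_eq_iff[OF N] and mij = nat_mod_eq_nat_mod_iff[OF N]
    show ?thesis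
      using residue_order(3)[of "int N" i j] N
      unfolding laurent_entry_eq[OF N] eq[OF m m] mij mi
      by (cases "i mod int N = int p"; cases "j mod int N = int q"; cases "i mod int N = j mod int N")
         (auto simp: fourier_coeff_const pq)
  qed
  have N0: "int N > 0" using N by simp
  have "section_reduct N a lg (\<lambda>t. b t * ?c t) (\<lambda>t. lb t + 0)"
  proof (rule reduct_mult[OF N r c, where f = "\<lambda>_. 1"])
    show "Determinant.det (addrow_mat N (h t) p q) = exp 0" for t using det_addrow_mat[OF pq, of N "h t"] by simp
    show "(\<forall>i j. i < j \<longrightarrow> laurent_entry N ?c i j = 0) \<or> (\<forall>i j. j < i \<longrightarrow> laurent_entry N ?c i j = 0)"
      using supp
    proof
      assume s: "\<forall>k. k < (if q < p then 0 else 1) \<longrightarrow> fourier_coeff h k = 0"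
      have "laurent_entry N ?c i j = 0" if ij: "i < j" for i j
      proof -
        have "fourier_coeff h (i div int N - j div int N) = 0" if "i mod int N = int p" "j mod int N = int q"
          using ij residue_order(1,2)[OF N0, of j i] that s by (cases "i div int N = j div int N"; cases "j div int N < i div int N"; cases "q < p") auto
        then show ?thesis using ij by (auto simp: le)
      qed
      then show ?thesis by blast
    next
      assume s: "\<forall>k. k \<ge> (if q < p then 0 else 1) \<longrightarrow> fourier_coeff h k = 0"
      have "laurent_entry N ?c i j = 0" if ij: "j < i" for i j
      proof -
        have "fourier_coeff h (i div int N - j div int N) = 0" if "i mod int N = int p" "j mod int N = int q"
          using ij residue_order(1,2)[OF N0, of i j] that s pq by (cases "i div int N = j div int N"; cases "i div int N < j div int N"; cases "q < p") auto
        then show ?thesis using ij by (auto simp: le)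
      qed
      then show ?thesis by blast
    qed
    show "laurent_entry N ?c k k * 1 = 1" for k using pq by (auto simp: le)
  qed (auto simp: fourier_coeff_const)
  then show ?thesis by simp
qed

lemma reduct_addcol:
  assumes N: "N \<ge> 1" and r: "section_reduct N a lg b lb" and p: "p < N" and q: "q < N" and pq: "p \<noteq> q" and h: "h \<in> W"
    and b': "\<And>t. t \<in> sphere 0 1 \<Longrightarrow> b' t = mat N N (\<lambda>(i, j). if j = q then b t $$ (i, q) + h t * b t $$ (i, p) else b t $$ (i, j))"
  shows "section_reduct N a lg b' lb"
proof -
  let ?S = "{k::int. k \<ge> (if q < p then 0 else 1)}"
  let ?h1 = "fourier_part ?S h" and ?h2 = "fourier_part (- ?S) h"
  have r1: "section_reduct N a lg (\<lambda>t. b t * addrow_mat N (?h1 t) p q) lb"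
    by (rule reduct_addcol_half[OF N r p q pq fourier_part(1)[OF h]]) (auto simp: fourier_part(2)[OF h])
  have r2: "section_reduct N a lg (\<lambda>t. (b t * addrow_mat N (?h1 t) p q) * addrow_mat N (?h2 t) p q) lb"
    by (rule reduct_addcol_half[OF N r1 p q pq fourier_part(1)[OF h]]) (auto simp: fourier_part(2)[OF h])
  show ?thesis
  proof (rule reduct_cong[OF r2])
    fix t :: complex assume t: "t \<in> sphere 0 1"
    have bc: "b t \<in> carrier_mat N N" using r t by (auto simp: section_reduct_def intro: wiener_matD)
    have "b t * addrow_mat N (?h1 t) p q = addcol (?h1 t) q p (b t)"
      by (rule addcol_mat[OF bc p, symmetric])
    moreover have "addcol (?h1 t) q p (b t) \<in> carrier_mat N N" by (rule carrier_matI) (use bc in auto)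
    ultimately have "b t * addrow_mat N (?h1 t) p q * addrow_mat N (?h2 t) p q = addcol (?h2 t) q p (addcol (?h1 t) q p (b t))"
      using addcol_mat[OF _ p, of "addcol (?h1 t) q p (b t)" N "?h2 t" q] by simp
    then show "b' t = b t * addrow_mat N (?h1 t) p q * addrow_mat N (?h2 t) p q"
      unfolding b'[OF t] using bc p q pq fourier_part_add[OF h t, of ?S, symmetric]
      by (intro eq_matI) (auto simp: algebra_simps)
  qed simp
qed

text \<open>
  \<open>(k - 1 - p) div N\<close> counts the indices of residue \<open>p\<close> below \<open>k\<close>, up to a constant.
\<close>

lemma div_step:
  fixes k p N :: int
  assumes N: "N > 0" and p: "0 \<le> p" "p < N"
  shows "(k - p) div N - (k - 1 - p) div N = (if k mod N = p then 1 else 0)"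
proof (cases "k mod N = p")
  case True
  then have k: "k = N * (k div N) + p" using mult_div_mod_eq[of N k] by simp
  have "(k - p) div N = k div N" by (rule int_div_pos_eq[where r = 0]) (use k N in auto)
  moreover have "(k - 1 - p) div N = k div N - 1"
    by (rule int_div_pos_eq[where r = "N - 1"]) (use k N in \<open>auto simp: algebra_simps\<close>)
  ultimately show ?thesis using True by simp
next
  case False
  define r where "r = (k - p) mod N"
  have k: "k - p = N * ((k - p) div N) + r" using mult_div_mod_eq[of N "k - p"] by (simp add: r_def)
  have "r \<noteq> 0"
  proof
    assume "r = 0"
    then have "k mod N = p mod N" unfolding r_def by (metis mod_eq_dvd_iff mod_0_imp_dvd)
    then show False using False p by simp
  qed
  moreover have "0 \<le> r" "r < N" unfolding r_def using N by auto
  ultimately have "r \<ge> 1" "r < N" by auto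
  then have "(k - 1 - p) div N = (k - p) div N"
    by (intro int_div_pos_eq[where r = "r - 1"]) (use k in auto)
  then show ?thesis using False by simp
qed

text \<open>
  The diagonal entry is \<open>exp (fourier_coeff l 0)\<close> in the rows of residue \<open>p\<close> and \<open>1\<close> in the other
  rows, so its primitive is a power with the exponent that counts these rows.
\<close>

lemma reduct_multcol_half:
  assumes N: "N \<ge> 1" and r: "section_reduct N a lg b lb" and p: "p < N" and l: "half_wiener \<sigma> l" and \<sigma>: "\<sigma> = 1 \<or> \<sigma> = -1"
  shows "section_reduct N a lg (\<lambda>t. b t * multrow_mat N p (exp (l t))) (\<lambda>t. lb t + l t)"
proof -
  let ?c = "\<lambda>t. multrow_mat N p (exp (l t))"
  have \<sigma>0: "\<sigma> \<noteq> 0" using \<sigma> by auto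
  note he = half_wiener_exp[OF l \<sigma>0]
  have lW: "l \<in> W" using l by (simp add: half_wiener_def)
  note m = nat_mod_less[OF N]
  have eq: "?c t $$ (i, j) = (if i = p \<and> j = p then exp (l t) else if i = j then 1 else 0)" if "i < N" "j < N" for t i j
    using that by (auto simp: multrow_mat_def)
  have "(\<lambda>t. ?c t $$ (i, j)) \<in> W" if "i < N" "j < N" for i j
    unfolding eq[OF that] using wiener_exp[OF lW] by (cases "i = p"; cases "j = p"; cases "i = j") (simp_all add: wiener_const)
  then have c: "?c \<in> WM N"
    unfolding wiener_mat_def by (intro CollectI conjI ballI allI impI multrow_mat_carrier)
  have le: "laurent_entry N ?c i j = (if i mod int N = int p \<and> j mod int N = int p then fourier_coeff (\<lambda>t. exp (l t)) (i div int N - j div int N) else if i = j then 1 else 0)" for i j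
  proof -
    note mi = nat_mod_eq_iff[OF N] and mij = nat_mod_eq_nat_mod_iff[OF N]
    show ?thesis
      using residue_order(3)[of "int N" i j] N
      unfolding laurent_entry_eq[OF N] eq[OF m m] mij mi
      by (cases "i mod int N = int p"; cases "j mod int N = int p"; cases "i mod int N = j mod int N")
         (auto simp: fourier_coeff_const)
  qed
  have N0: "int N > 0" using N by simp
  let ?f = "\<lambda>k. exp (of_int ((k - 1 - int p) div int N) * fourier_coeff l 0)"
  show ?thesis
  proof (rule reduct_mult[OF N r c, where f = ?f])
    show "continuous_on (sphere 0 1) l" by (rule wiener_continuous[OF lW])
    show "Determinant.det (multrow_mat N p (exp (l t))) = exp (l t)" for t by (rule det_multrow_mat[OF p])
    show "(\<forall>i j. i < j \<longrightarrow> laurent_entry N ?c i j = 0) \<or> (\<forall>i j. j < i \<longrightarrow> laurent_entry N ?c i j = 0)"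
      using \<sigma>
    proof
      assume "\<sigma> = 1"
      then have s: "fourier_coeff (\<lambda>t. exp (l t)) k = 0" if "k < 0" for k using he(1) that by (auto simp: half_wiener_def)
      have "laurent_entry N ?c i j = 0" if ij: "i < j" for i j
      proof -
        have "fourier_coeff (\<lambda>t. exp (l t)) (i div int N - j div int N) = 0" if "i mod int N = int p" "j mod int N = int p"
          using ij residue_order[OF N0, of j i] that by (intro s) (metis diff_less_0_iff_less linorder_neqE order_less_asym order_less_irrefl)
        then show ?thesis using ij by (auto simp: le)
      qed
      then show ?thesis by blast
    next
      assume "\<sigma> = -1"
      then have s: "fourier_coeff (\<lambda>t. exp (l t)) k = 0" if "k > 0" for k using he(1) that by (auto simp: half_wiener_def)
      have "laurent_entry N ?c i j = 0" if ij: "j < i" for i j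
      proof -
        have "fourier_coeff (\<lambda>t. exp (l t)) (i div int N - j div int N) = 0" if "i mod int N = int p" "j mod int N = int p"
          using ij residue_order[OF N0, of i j] that by (intro s) (metis diff_gt_0_iff_gt linorder_neqE order_less_asym order_less_irrefl)
        then show ?thesis using ij by (auto simp: le)
      qed
      then show ?thesis by blast
    qed
    show "laurent_entry N ?c k k * ?f k = ?f (k + 1)" for k
    proof -
      have d: "(k - int p) div int N = (k - 1 - int p) div int N + (if k mod int N = int p then 1 else 0)"
        using div_step[OF N0, of "int p" k] p by simp
      have "laurent_entry N ?c k k = exp (of_int (if k mod int N = int p then 1 else 0) * fourier_coeff l 0)"
        using he(2) by (simp add: le)
      then show ?thesis by (simp add: d exp_add[symmetric] algebra_simps)
    qed
    show "?f (t + int m * int N) = ?f t * exp (of_nat m * fourier_coeff l 0)" for t m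
    proof -
      have "(t + int m * int N - 1 - int p) div int N = (t - 1 - int p + int m * int N) div int N" by (simp add: algebra_simps)
      also have "\<dots> = (t - 1 - int p) div int N + int m" using N0 by simp
      finally show ?thesis by (simp add: exp_add[symmetric] algebra_simps)
    qed
  qed auto
qed

lemma reduct_multcol:
  assumes N: "N \<ge> 1" and r: "section_reduct N a lg b lb" and p: "p < N" and l: "l \<in> W"
    and b': "\<And>t. t \<in> sphere 0 1 \<Longrightarrow> b' t = mat N N (\<lambda>(i, j). if j = p then exp (l t) * b t $$ (i, p) else b t $$ (i, j))"
  shows "section_reduct N a lg b' (\<lambda>t. lb t + l t)"
proof -
  let ?l1 = "fourier_part {0..} l" and ?l2 = "fourier_part (- {0..}) l"
  have r1: "section_reduct N a lg (\<lambda>t. b t * multrow_mat N p (exp (?l1 t))) (\<lambda>t. lb t + ?l1 t)"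
    by (rule reduct_multcol_half[OF N r p, where \<sigma> = 1]) (auto simp: half_wiener_def fourier_part[OF l])
  have r2: "section_reduct N a lg (\<lambda>t. (b t * multrow_mat N p (exp (?l1 t))) * multrow_mat N p (exp (?l2 t))) (\<lambda>t. lb t + ?l1 t + ?l2 t)"
    by (rule reduct_multcol_half[OF N r1 p, where \<sigma> = "-1"]) (auto simp: half_wiener_def fourier_part[OF l])
  show ?thesis
  proof (rule reduct_cong[OF r2])
    fix t :: complex assume t: "t \<in> sphere 0 1"
    have ladd: "l t = ?l1 t + ?l2 t" using fourier_part_add[OF l t, of "{0..}"] by simp
    then show "lb t + l t = lb t + ?l1 t + ?l2 t" by simp
    have bc: "b t \<in> carrier_mat N N" using r t by (auto simp: section_reduct_def intro: wiener_matD)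
    have "b t * multrow_mat N p (exp (?l1 t)) = multcol p (exp (?l1 t)) (b t)"
      by (rule multcol_mat[OF bc, symmetric])
    moreover have "multcol p (exp (?l1 t)) (b t) \<in> carrier_mat N N" using bc by (simp add: mat_multcol_def)
    ultimately have "b t * multrow_mat N p (exp (?l1 t)) * multrow_mat N p (exp (?l2 t)) = multcol p (exp (?l2 t)) (multcol p (exp (?l1 t)) (b t))"
      using multcol_mat[of "multcol p (exp (?l1 t)) (b t)" N N p "exp (?l2 t)"] by simp
    then show "b' t = b t * multrow_mat N p (exp (?l1 t)) * multrow_mat N p (exp (?l2 t))"
      unfolding b'[OF t] using bc p ladd
      by (intro eq_matI) (auto simp: exp_add)
  qed
qed

section \<open>Reduction to the identity\<close>

text \<open>
  Replace \<open>f\<close> by a nearby polynomial \<open>g\<close> minus a small constant that \<open>g\<close> does not attain on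
  the circle.
\<close>

lemma small_nonvanishing_shift:
  assumes f: "f \<in> W" and d: "\<delta> > 0"
  obtains x where "x \<in> W" "\<And>t. t \<in> sphere 0 1 \<Longrightarrow> norm (x t) \<le> \<delta>" "\<And>t. t \<in> sphere 0 1 \<Longrightarrow> f t + x t \<noteq> 0"
proof -
  obtain g where g: "polynomial_function g" "\<And>t. t \<in> sphere 0 1 \<Longrightarrow> norm (f t - g t) < \<delta> / 2"
    using Stone_Weierstrass_polynomial_function[OF compact_sphere wiener_continuous[OF f], of "\<delta> / 2"] d by auto
  obtain c where c: "norm c < \<delta> / 2" "\<And>t. t \<in> sphere 0 1 \<Longrightarrow> g t \<noteq> c"
    using polynomial_function_misses_small[OF g(1), of "\<delta> / 2"] d by auto
  show ?thesis
  proof (rule that[of "\<lambda>t. g t - c - f t"])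
    show "(\<lambda>t. g t - c - f t) \<in> W"
      by (intro wiener_diff wiener_polynomial g f wiener_const)
    fix t :: complex assume t: "t \<in> sphere 0 1"
    show "f t + (g t - c - f t) \<noteq> 0" using c(2)[OF t] by simp
    have "norm (g t - c - f t) \<le> norm (f t - g t) + norm c"
      using norm_triangle_ineq4[of "g t - f t" c] by (simp add: norm_minus_commute algebra_simps)
    then show "norm (g t - c - f t) \<le> \<delta>" using g(2)[OF t] c(1) by linarith
  qed
qed

lemma reductD:
  assumes "section_reduct N a lg b lb"
  shows "b \<in> WM N" "continuous_on (sphere 0 1) lb" "t \<in> sphere 0 1 \<Longrightarrow> Determinant.det (b t) = exp (lb t)"
    "t \<in> sphere 0 1 \<Longrightarrow> b t \<in> carrier_mat N N" "p < N \<Longrightarrow> q < N \<Longrightarrow> (\<lambda>t. b t $$ (p, q)) \<in> W"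
  using assms wiener_matD by (auto simp: section_reduct_def)

text \<open>
  Column operations require their multipliers to lie in the algebra; this makes \<open>1 / det b\<close> and the
  last pivot available.
\<close>

lemma reduct_log_wiener:
  assumes "section_reduct N a lg b lb"
  shows "lb \<in> W"
proof (rule wiener_log[OF reductD(2)[OF assms]])
  have "(\<lambda>t. Determinant.det (b t)) \<in> W"
    by (rule det_wiener[OF reductD(4)[OF assms] reductD(5)[OF assms]])
  then show "(\<lambda>t. exp (lb t)) \<in> W"
    by (rule wiener_transfer) (simp add: reductD(3)[OF assms])
qed

lemma reduct_add_to_column:
  assumes N: "N \<ge> 1" and r: "section_reduct N a lg b lb" and k: "k < N" and S: "finite S" "S \<subseteq> {..<N}" "k \<notin> S"
    and h: "\<And>j. j \<in> S \<Longrightarrow> h j \<in> W"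
  shows "section_reduct N a lg (\<lambda>t. mat N N (\<lambda>(i, c). if c = k then b t $$ (i, k) + (\<Sum>j\<in>S. h j t * b t $$ (i, j)) else b t $$ (i, c))) lb"
  using S h
proof (induction S rule: finite_induct)
  case empty
  have dims: "dim_row (b t) = N" "dim_col (b t) = N" if "t \<in> sphere 0 1" for t
    using reductD(4)[OF r that] by auto
  show ?case by (rule reduct_cong[OF r]) (auto intro!: eq_matI simp: dims)
next
  case (insert j S)
  show ?case
    by (rule reduct_addcol[OF N insert.IH, where p = j and q = k and h = "h j"])
       (use insert k in \<open>auto intro!: cong_mat simp: algebra_simps\<close>)
qed

lemma reduct_add_column_to:
  assumes N: "N \<ge> 1" and r: "section_reduct N a lg b lb" and k: "k < N" and S: "finite S" "S \<subseteq> {..<N}" "k \<notin> S"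
    and h: "\<And>j. j \<in> S \<Longrightarrow> h j \<in> W"
  shows "section_reduct N a lg (\<lambda>t. mat N N (\<lambda>(i, c). if c \<in> S then b t $$ (i, c) + h c t * b t $$ (i, k) else b t $$ (i, c))) lb"
  using S h
proof (induction S rule: finite_induct)
  case empty
  have dims: "dim_row (b t) = N" "dim_col (b t) = N" if "t \<in> sphere 0 1" for t
    using reductD(4)[OF r that] by auto
  show ?case by (rule reduct_cong[OF r]) (auto intro!: eq_matI simp: dims)
next
  case (insert j S)
  show ?case
    by (rule reduct_addcol[OF N insert.IH, where p = k and q = j and h = "h j"])
       (use insert k in \<open>auto intro!: cong_mat simp: algebra_simps\<close>)
qed

lemma adj_column:
  fixes A :: "complex mat"
  assumes A: "A \<in> carrier_mat N N" and d: "Determinant.det A \<noteq> 0" and ik: "i < N" "k < N"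
  shows "(\<Sum>j<N. A $$ (i, j) * (adj_mat A $$ (j, k) / Determinant.det A)) = (if i = k then 1 else 0)"
proof -
  have "(A * adj_mat A) $$ (i, k) = (\<Sum>j<N. A $$ (i, j) * adj_mat A $$ (j, k))"
    using A adj_mat(1)[OF A] ik by (auto simp: scalar_prod_def atLeast0LessThan)
  moreover have "(A * adj_mat A) $$ (i, k) = (if i = k then Determinant.det A else 0)"
    unfolding adj_mat(2)[OF A] using ik by simp
  ultimately have "(\<Sum>j<N. A $$ (i, j) * adj_mat A $$ (j, k)) = (if i = k then Determinant.det A else 0)" by simp
  then show ?thesis using d by (auto simp: sum_divide_distrib[symmetric])
qed

text \<open>
  The unit vector \<open>e\<^sub>k\<close> is the combination of the columns of \<open>b\<close> with the coefficients \<open>v j\<close>, the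
  \<open>k\<close>-th column of the inverse. Adding \<open>x e\<^sub>k\<close> to the column \<open>k\<close> is therefore multiplication of that
  column by \<open>1 + x v k\<close> followed by additions of multiples of the other columns. If \<open>x\<close> is small, the
  factor \<open>1 + x v k\<close> has a logarithm.
\<close>

lemma reduct_perturb_diagonal:
  assumes N: "N \<ge> 1" and r: "section_reduct N a lg b lb" and k: "k < N"
  obtains b' lb' where "section_reduct N a lg b' lb'" "\<And>t. t \<in> sphere 0 1 \<Longrightarrow> b' t $$ (k, k) \<noteq> 0"
    "\<And>t i j. t \<in> sphere 0 1 \<Longrightarrow> i < N \<Longrightarrow> j < N \<Longrightarrow> (i, j) \<noteq> (k, k) \<Longrightarrow> b' t $$ (i, j) = b t $$ (i, j)"
proof -
  note lbW = reduct_log_wiener[OF r]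
  define v where "v = (\<lambda>j t. adj_mat (b t) $$ (j, k) / Determinant.det (b t))"
  have vW: "v j \<in> W" if j: "j < N" for j
  proof (rule wiener_transfer)
    have idx: "(if i' < k then i' else Suc i') < N" "(if j' < j then j' else Suc j') < N" if "i' < N - 1" "j' < N - 1" for i' j'
      using that by auto
    have cof: "(\<lambda>t. Determinant.det (mat (N - 1) (N - 1) (\<lambda>(i', j'). b t $$ (if i' < k then i' else Suc i', if j' < j then j' else Suc j')))) \<in> W"
      by (rule det_wiener[where n = "N - 1"]) (use reductD(5)[OF r idx] in auto)
    show "(\<lambda>t. ((-1) ^ (k + j) * Determinant.det (mat (N - 1) (N - 1) (\<lambda>(i', j'). b t $$ (if i' < k then i' else Suc i', if j' < j then j' else Suc j')))) * exp (- lb t)) \<in> W"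
      by (intro wiener_mult(1) wiener_cmult cof wiener_exp wiener_minus lbW)
    fix t :: complex assume t: "t \<in> sphere 0 1"
    have bt: "dim_row (b t) = N" "dim_col (b t) = N" using reductD(4)[OF r t] by auto
    show "v j t = ((-1) ^ (k + j) * Determinant.det (mat (N - 1) (N - 1) (\<lambda>(i', j'). b t $$ (if i' < k then i' else Suc i', if j' < j then j' else Suc j')))) * exp (- lb t)"
      unfolding v_def reductD(3)[OF r t] using bt j k
      by (simp add: adj_mat_def cofactor_def mat_delete_def exp_minus divide_inverse)
  qed
  have vsum: "(\<Sum>j<N. b t $$ (i, j) * v j t) = (if i = k then 1 else 0)" if "t \<in> sphere 0 1" "i < N" for t i
    unfolding v_def by (rule adj_column[OF reductD(4)[OF r that(1)] _ that(2) k]) (simp add: reductD(3)[OF r that(1)])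
  obtain V where V: "V > 0" "\<And>t. t \<in> sphere 0 1 \<Longrightarrow> norm (v k t) \<le> V"
  proof -
    have "bounded (v k ` sphere 0 1)"
      by (intro compact_imp_bounded compact_continuous_image wiener_continuous[OF vW[OF k]]) auto
    then show ?thesis using that unfolding bounded_pos by blast
  qed
  obtain x where x: "x \<in> W" "\<And>t. t \<in> sphere 0 1 \<Longrightarrow> norm (x t) \<le> 1 / (2 * V)" "\<And>t. t \<in> sphere 0 1 \<Longrightarrow> b t $$ (k, k) + x t \<noteq> 0"
    using small_nonvanishing_shift[OF reductD(5)[OF r k k], of "1 / (2 * V)"] V by auto
  have xv: "norm (x t * v k t) \<le> 1/2" if "t \<in> sphere 0 1" for t
  proof -
    have "norm (x t * v k t) \<le> 1 / (2 * V) * V"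
      unfolding norm_mult using V(1) V(2)[OF that] x(2)[OF that] by (intro mult_mono) auto
    then show ?thesis using V(1) by simp
  qed
  have slit: "1 + x t * v k t \<notin> \<real>\<^sub>\<le>\<^sub>0" "1 + x t * v k t \<noteq> 0" if "t \<in> sphere 0 1" for t
  proof -
    have "Re (1 + x t * v k t) > 0"
      using xv[OF that] abs_Re_le_cmod[of "x t * v k t"] by simp
    then show "1 + x t * v k t \<notin> \<real>\<^sub>\<le>\<^sub>0" by (auto simp: complex_nonpos_Reals_iff)
    then show "1 + x t * v k t \<noteq> 0" by auto
  qed
  have uW: "(\<lambda>t. 1 + x t * v k t) \<in> W" by (intro wiener_add wiener_const wiener_mult(1) x vW k)
  define l where "l = (\<lambda>t. Ln (1 + x t * v k t))"
  have el: "exp (l t) = 1 + x t * v k t" if "t \<in> sphere 0 1" for t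
    using slit(2)[OF that] by (simp add: l_def)
  have lW: "l \<in> W"
  proof (rule wiener_log)
    show "continuous_on (sphere 0 1) l"
      unfolding l_def by (intro continuous_on_Ln' wiener_continuous[OF uW] slit)
    show "(\<lambda>t. exp (l t)) \<in> W" by (rule wiener_transfer[OF uW el])
  qed
  let ?b1 = "\<lambda>t. mat N N (\<lambda>(i, j). if j = k then exp (l t) * b t $$ (i, k) else b t $$ (i, j))"
  have r1: "section_reduct N a lg ?b1 (\<lambda>t. lb t + l t)"
    by (rule reduct_multcol[OF N r k lW]) simp
  let ?S = "{..<N} - {k}"
  have r2: "section_reduct N a lg (\<lambda>t. mat N N (\<lambda>(i, c). if c = k then ?b1 t $$ (i, k) + (\<Sum>j\<in>?S. (x t * v j t) * ?b1 t $$ (i, j)) else ?b1 t $$ (i, c))) (\<lambda>t. lb t + l t)"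
    (is "section_reduct _ _ _ ?b2 _")
    by (rule reduct_add_to_column[OF N r1 k, where h = "\<lambda>j t. x t * v j t"]) (auto intro!: wiener_mult(1) x vW)
  have b2: "?b2 t $$ (i, j) = (if j = k then b t $$ (i, k) + (if i = k then x t else 0) else b t $$ (i, j))"
    if t: "t \<in> sphere 0 1" and ij: "i < N" "j < N" for t i j
  proof (cases "j = k")
    case True
    have sumeq: "(\<Sum>j\<in>?S. (x t * v j t) * ?b1 t $$ (i, j)) = (\<Sum>j\<in>?S. (x t * v j t) * b t $$ (i, j))"
      by (intro sum.cong refl) (use ij in auto)
    have "?b2 t $$ (i, k) = exp (l t) * b t $$ (i, k) + (\<Sum>j\<in>?S. (x t * v j t) * b t $$ (i, j))"
      using ij k by (simp add: sumeq)
    also have "\<dots> = b t $$ (i, k) + ((x t * v k t) * b t $$ (i, k) + (\<Sum>j\<in>?S. (x t * v j t) * b t $$ (i, j)))"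
      by (simp add: el[OF t] algebra_simps)
    also have "(x t * v k t) * b t $$ (i, k) + (\<Sum>j\<in>?S. (x t * v j t) * b t $$ (i, j)) = (\<Sum>j<N. (x t * v j t) * b t $$ (i, j))"
      using k by (subst sum.remove[of "{..<N}" k]) auto
    also have "\<dots> = x t * (\<Sum>j<N. b t $$ (i, j) * v j t)"
      by (simp add: sum_distrib_left mult_ac)
    also have "\<dots> = (if i = k then x t else 0)" using vsum[OF t ij(1)] by simp
    finally show ?thesis using True by simp
  qed (use ij in simp)
  show ?thesis
    by (rule that[OF r2]) (use b2 x(3) k in \<open>auto simp del: index_mat\<close>)
qed

definition identity_rows :: "nat \<Rightarrow> nat \<Rightarrow> (complex \<Rightarrow> complex mat) \<Rightarrow> bool" where
  "identity_rows N k b \<longleftrightarrow> (\<forall>t\<in>sphere 0 1. \<forall>i<k. \<forall>j<N. b t $$ (i, j) = (if i = j then 1 else 0))"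

text \<open>
  The column \<open>k\<close> vanishes in the rows above \<open>k\<close>, so subtracting its multiples does not disturb the rows
  that are already unit vectors.
\<close>

lemma reduct_clear_row:
  assumes N: "N \<ge> 1" and r: "section_reduct N a lg b lb" and k: "k < N" and I: "identity_rows N k b"
    and piv: "\<And>t. t \<in> sphere 0 1 \<Longrightarrow> b t $$ (k, k) = 1"
  obtains b' where "section_reduct N a lg b' lb" "identity_rows N (Suc k) b'"
proof -
  let ?S = "{..<N} - {k}"
  have r': "section_reduct N a lg (\<lambda>t. mat N N (\<lambda>(i, c). if c \<in> ?S then b t $$ (i, c) + (- b t $$ (k, c)) * b t $$ (i, k) else b t $$ (i, c))) lb"
    by (rule reduct_add_column_to[OF N r k, where h = "\<lambda>c t. - b t $$ (k, c)"]) (use k in \<open>auto intro!: wiener_minus reductD(5)[OF r]\<close>)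
  show ?thesis
    by (rule that[OF r']) (use I piv k in \<open>auto simp: identity_rows_def less_Suc_eq\<close>)
qed

text \<open>
  A pivot without zeros cannot in general be scaled to \<open>1\<close>, because it may have a nonzero winding
  number. Instead it is used to create an entry \<open>1\<close> in the next column, and this entry is used to
  turn the pivot into \<open>1\<close>.
\<close>

lemma reduct_next_row:
  assumes N: "N \<ge> 1" and r: "section_reduct N a lg b lb" and k: "Suc k < N" and I: "identity_rows N k b"
  obtains b' lb' where "section_reduct N a lg b' lb'" "identity_rows N (Suc k) b'"
proof -
  have kN: "k < N" using k by simp
  obtain b1 lb1 where r1: "section_reduct N a lg b1 lb1" and ne: "\<And>t. t \<in> sphere 0 1 \<Longrightarrow> b1 t $$ (k, k) \<noteq> 0"
    and eq: "\<And>t i j. t \<in> sphere 0 1 \<Longrightarrow> i < N \<Longrightarrow> j < N \<Longrightarrow> (i, j) \<noteq> (k, k) \<Longrightarrow> b1 t $$ (i, j) = b t $$ (i, j)"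
    using reduct_perturb_diagonal[OF N r kN] by metis
  have I1: "identity_rows N k b1" using I eq kN by (auto simp: identity_rows_def)
  let ?h = "\<lambda>t. (1 - b1 t $$ (k, Suc k)) * (1 / b1 t $$ (k, k))"
  let ?b2 = "\<lambda>t. mat N N (\<lambda>(i, j). if j = Suc k then b1 t $$ (i, Suc k) + ?h t * b1 t $$ (i, k) else b1 t $$ (i, j))"
  have hW: "?h \<in> W"
    by (intro wiener_mult(1) wiener_diff wiener_const wiener_inverse reductD(5)[OF r1] kN k ne)
  have r2: "section_reduct N a lg ?b2 lb1"
    by (rule reduct_addcol[OF N r1 kN k _ hW]) auto
  let ?g = "\<lambda>t. 1 - b1 t $$ (k, k)"
  let ?b3 = "\<lambda>t. mat N N (\<lambda>(i, j). if j = k then ?b2 t $$ (i, k) + ?g t * ?b2 t $$ (i, Suc k) else ?b2 t $$ (i, j))"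
  have gW: "?g \<in> W" by (intro wiener_diff wiener_const reductD(5)[OF r1] kN)
  have r3: "section_reduct N a lg ?b3 lb1"
    by (rule reduct_addcol[OF N r2 k kN _ gW]) auto
  have I3: "identity_rows N k ?b3"
    using I1 k by (auto simp: identity_rows_def)
  have "?b3 t $$ (k, k) = 1" if "t \<in> sphere 0 1" for t
    using k ne[OF that] by simp
  then show ?thesis using reduct_clear_row[OF N r3 kN I3] that by blast
qed

lemma det_last_row:
  fixes A :: "complex mat"
  assumes A: "A \<in> carrier_mat N N" and N: "N = Suc n" and I: "\<And>i j. i < n \<Longrightarrow> j < N \<Longrightarrow> A $$ (i, j) = (if i = j then 1 else 0)"
  shows "Determinant.det A = A $$ (n, n)"
proof -
  have "Determinant.det A = prod_list (diag_mat A)"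
    by (rule det_lower_triangular[OF _ A]) (use N I in auto)
  also have "\<dots> = (\<Prod>i<Suc n. A $$ (i, i))"
    unfolding prod_list_diag_prod using A N by (simp add: atLeast0LessThan)
  also have "\<dots> = A $$ (n, n)" using I N by simp
  finally show ?thesis .
qed

text \<open>
  After \<open>N - 1\<close> rows the matrix is lower triangular with diagonal \<open>1, \<dots>, 1, det b\<close>, and \<open>det b\<close> has
  a logarithm in the algebra by which the last column can be scaled.
\<close>

lemma reduct_identity:
  assumes N: "N \<ge> 1" and r: "section_reduct N a lg a lg"
  obtains b where "section_reduct N a lg b (\<lambda>t. 0)" "identity_rows N N b"
proof -
  obtain n where n: "N = Suc n" using N by (cases N) auto
  have "\<exists>b lb. section_reduct N a lg b lb \<and> identity_rows N k b" if "k \<le> n" for k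
    using that
  proof (induction k)
    case 0
    then show ?case using r by (auto simp: identity_rows_def)
  next
    case (Suc k)
    then obtain b lb where "section_reduct N a lg b lb" "identity_rows N k b" by auto
    then show ?case using reduct_next_row[OF N, of a lg b lb k] Suc.prems n by (metis le_imp_less_Suc)
  qed
  then obtain b lb where b: "section_reduct N a lg b lb" "identity_rows N n b" by blast
  have bnn: "b t $$ (n, n) = exp (lb t)" if t: "t \<in> sphere 0 1" for t
    using det_last_row[OF reductD(4)[OF b(1) t] n] b(2) t reductD(3)[OF b(1) t] by (simp add: identity_rows_def)
  let ?b1 = "\<lambda>t. mat N N (\<lambda>(i, j). if j = n then exp (- lb t) * b t $$ (i, n) else b t $$ (i, j))"
  have "section_reduct N a lg ?b1 (\<lambda>t. lb t + - lb t)"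
    by (rule reduct_multcol[OF N b(1) _ wiener_minus[OF reduct_log_wiener[OF b(1)]]]) (auto simp: n)
  then have r1: "section_reduct N a lg ?b1 (\<lambda>t. 0)" by simp
  have I1: "identity_rows N n ?b1" using b(2) by (auto simp: identity_rows_def n)
  have "?b1 t $$ (n, n) = 1" if "t \<in> sphere 0 1" for t
    using bnn[OF that] by (simp add: n exp_minus)
  then show ?thesis using reduct_clear_row[OF N r1 _ I1, of thesis] that unfolding n by blast
qed

lemma laurent_entry_identity:
  assumes N: "N \<ge> 1" and I: "identity_rows N N b"
  shows "laurent_entry N b = kronecker"
proof (intro ext)
  fix r s :: int
  note m = nat_mod_less[OF N]
  note mij = nat_mod_eq_nat_mod_iff[OF N]
  have "laurent_entry N b r s = fourier_coeff (\<lambda>t. if r mod int N = s mod int N then 1 else 0) (r div int N - s div int N)"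
    unfolding laurent_entry_eq[OF N] by (rule fourier_coeff_cong) (use I m mij in \<open>auto simp: identity_rows_def\<close>)
  then show "laurent_entry N b r s = kronecker r s"
    using residue_order(3)[of "int N" r s] N by (auto simp: fourier_coeff_const kronecker_def)
qed

end

section \<open>The limit theorem\<close>

theorem theorem7p10:
  fixes N :: nat and \<alpha>1 \<alpha>2 :: real
    and a :: "complex \<Rightarrow> complex mat" and lg :: "complex \<Rightarrow> complex"
  assumes "N \<ge> 1"
    and "\<alpha>1 \<ge> 0" and "\<alpha>2 \<ge> 0" and "\<alpha>1 + \<alpha>2 = 1"
    and "a \<in> wiener_mat N \<alpha>1 \<alpha>2"
    and "\<And>t. t \<in> sphere 0 1 \<Longrightarrow> Determinant.det (a t) \<noteq> 0"
    and "winding_number ((\<lambda>t. Determinant.det (a t)) \<circ> circlepath 0 1) 0 = 0"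
    and "continuous_log_on_circle (\<lambda>t. Determinant.det (a t)) lg"
  shows "\<exists>E1 E2 :: nat \<Rightarrow> complex. \<forall>k1<N. \<forall>k2<N.
    (\<lambda>m. Determinant.det (compression_mat (int k1) (int k2 + int m * int N) (laurent_op N a))
          / szego_const N lg powi (int k2 - int k1 + int m * int N))
      \<longlonglongrightarrow> E1 k1 * E2 k2"
proof -
  interpret wiener_exponents \<alpha>1 \<alpha>2 by unfold_locales fact+
  note N = \<open>N \<ge> 1\<close>
  have lg: "continuous_on (sphere 0 1) lg" "\<And>t. t \<in> sphere 0 1 \<Longrightarrow> exp (lg t) = Determinant.det (a t)"
    using assms(8) by (auto simp: continuous_log_on_circle_def)
  have "section_reduct N a lg a lg" by (rule reduct_refl[OF assms(5) lg(1)]) (simp add: lg)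
  then obtain b where b: "section_reduct N a lg b (\<lambda>t. 0)" "identity_rows N N b" by (rule reduct_identity[OF N])
  obtain M e1 e2 where M: "boundary_form N kronecker M" and e: "\<And>s. e1 s \<noteq> 0" "\<And>t. e2 t \<noteq> 0"
    and det: "\<And>s t m. s \<le> t + int m * int N \<Longrightarrow>
         Determinant.det (finsec s (t + int m * int N) (M s t m)) =
         Determinant.det (finsec s (t + int m * int N) (laurent_entry N a)) *
         exp (of_nat m * (fourier_coeff (\<lambda>t. 0) 0 - fourier_coeff lg 0)) * e1 s * e2 t"
    using b(1) unfolding section_reduct_def laurent_entry_identity[OF N b(2)] by blast
  obtain E1 E2 where E: "\<And>s t. (\<lambda>m. Determinant.det (finsec s (t + int m * int N) (M s t m))) \<longlonglongrightarrow> E1 s * E2 t"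
    using boundary_form_det_limit[OF M N] by metis
  let ?G = "szego_const N lg"
  have G0: "?G \<noteq> 0" by (simp add: szego_const_def)
  have GN: "?G ^ N = exp (fourier_coeff lg 0)"
    using N by (simp add: szego_const_def fourier_coeff_def exp_of_nat_mult[symmetric])
  have "(\<lambda>m. Determinant.det (compression_mat (int k1) (int k2 + int m * int N) (laurent_op N a))
          / ?G powi (int k2 - int k1 + int m * int N))
      \<longlonglongrightarrow> (E1 (int k1) * ?G powi int k1 / e1 (int k1)) * (E2 (int k2) / (?G powi int k2 * e2 (int k2)))"
    if k: "k1 < N" "k2 < N" for k1 k2
  proof -
    let ?s = "int k1" and ?t = "int k2"
    have "(\<lambda>m. Determinant.det (finsec ?s (?t + int m * int N) (M ?s ?t m)) * (?G powi int k1 / e1 ?s / (?G powi int k2 * e2 ?t)))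
      \<longlonglongrightarrow> E1 ?s * E2 ?t * (?G powi int k1 / e1 ?s / (?G powi int k2 * e2 ?t))"
      by (intro tendsto_intros E)
    moreover have "Determinant.det (finsec ?s (?t + int m * int N) (M ?s ?t m)) * (?G powi int k1 / e1 ?s / (?G powi int k2 * e2 ?t))
        = Determinant.det (compression_mat (int k1) (int k2 + int m * int N) (laurent_op N a)) / ?G powi (int k2 - int k1 + int m * int N)"
      if m: "m \<ge> 1" for m
    proof -
      \<comment> \<open>For \<open>m = 0\<close> the interval may be reversed (\<open>k2 < k1\<close>), where the determinant formula fails.\<close>
      have "int N \<le> int m * int N" using m by (simp add: mult_le_cancel_right1)
      then have le: "?s \<le> ?t + int m * int N" using k by linarith
      have "?G powi (int m * int N) = exp (of_nat m * fourier_coeff lg 0)"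
        by (metis GN exp_of_nat_mult mult.commute of_nat_mult power_int_of_nat power_mult)
      then have P: "?G powi (int k2 - int k1 + int m * int N) = ?G powi int k2 / ?G powi int k1 * exp (of_nat m * fourier_coeff lg 0)"
        using G0 by (simp add: power_int_add power_int_diff)
      have c: "compression_mat (int k1) (int k2 + int m * int N) (laurent_op N a) = finsec ?s (?t + int m * int N) (laurent_entry N a)"
        by (simp add: compression_mat_laurent_op finsec_def)
      have x: "exp (of_nat m * (fourier_coeff (\<lambda>t. 0) 0 - fourier_coeff lg 0)) = 1 / exp (of_nat m * fourier_coeff lg 0)"
        by (simp add: fourier_coeff_const exp_minus divide_inverse)
      show ?thesis unfolding det[OF le] P c x using e G0 by (simp add: divide_simps)
    qed
    ultimately have "(\<lambda>m. Determinant.det (compression_mat (int k1) (int k2 + int m * int N) (laurent_op N a))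
          / ?G powi (int k2 - int k1 + int m * int N))
      \<longlonglongrightarrow> E1 ?s * E2 ?t * (?G powi int k1 / e1 ?s / (?G powi int k2 * e2 ?t))"
      by (rule Lim_transform_eventually[OF _ eventually_sequentiallyI[of 1]])
    then show ?thesis by (simp add: mult_ac divide_inverse)
  qed
  note lim = this
  show ?thesis
    by (intro exI[of _ "\<lambda>k1. E1 (int k1) * ?G powi int k1 / e1 (int k1)"] exI[of _ "\<lambda>k2. E2 (int k2) / (?G powi int k2 * e2 (int k2))"] allI impI lim)
qed

end
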